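(* Let $K$ be a pure cubical complex of dimension $d$ and let $K'$ be a cubical subdivision of $K$. Then $$h^{(c)}(K',x)\;=\;h^{(c)}(K,x)+\sum_{F\in K,\ \dim F\ge1}\mathcal L_F(K'_F,x)\,h(\mathrm{link}_K(F),x),$$ where $\mathcal L_F(K'_F,x)=\sum_{G\in\mathcal F(K),\,G\le F}(-1)^{\dim F-\dim G}h^{(c)}(K'_G,x)$ and $h(\mathrm{link}_K(F),x)=\sum_{G\in K,\,G\ge F}x^{\dim G-\dim F}(1-x)^{d-\dim G}$.
   Context: A $d$-dimensional (abstract) cube is a poset isomorphic to the poset of all faces (including the empty face) of $[0,1]^d$. A cubical complex is a finite poset $K$ with a minimum element $\varnothing$ (the empty face) such that every interval $[\varnothing,F]$ is a cube and any two elements have a greatest lower bound; elements are faces, $\dim F$ is the dimension of the cube $[\varnothing,F]$ ($\dim\varnothing=-1$), $\dim K$ is the maximum face dimension, $K$ is pure if all maximal faces have the same dimension, $\mathcal F(K)$ is the set of nonempty faces, subcomplexes are nonempty order ideals, and topological properties refer to the order complex of $\mathcal F(K)$. A face $F$ is regarded as the cubical complex $[\varnothing,F]$. A cubical subdivision of a cubical complex $K$ is a cubical complex $K'$ with a map $\sigma:\mathcal F(K')\to\mathcal F(K)$ such that for every $F\in\mathcal F(K)$: (a) $K'_F:=\sigma^{-1}(\{G\in\mathcal F(K):G\le F\})\cup\{\varnothing\}$ is a subcomplex of $K'$ homeomorphic to a ball of dimension $\dim F$; (b) $\sigma^{-1}(F)$ is the set of interior faces of this ball. For a cubical complex $L$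 of dimension $k$: $h^{(sc)}(L,x)=\sum_{E\in L\setminus\{\varnothing\}}(2x)^{\dim E}(1-x)^{k-\dim E}$; $\widetilde\chi(L)=\sum_{E\in L}(-1)^{\dim E}$; the (long) cubical $h$-polynomial $h^{(c)}(L,x)$ is the polynomial defined by $(x+1)h^{(c)}(L,x)=2^k+x\,h^{(sc)}(L,x)+(-2)^k\widetilde\chi(L)x^{k+2}$ (so $h^{(c)}(K'_G,x)$ uses $k=\dim G$). $\mathrm{link}_K(F)$ is the simplicial complex whose face poset is the poset of faces $G\ge F$ of $K$; the displayed formula is its $h$-polynomial. *)

theory Defs
  imports "HOL-Analysis.Analysis" "HOL-Analysis.Finite_Function_Topology"
    "HOL-Computational_Algebra.Polynomial"
begin

section \<open>Cubical complexes\<close>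

text \<open>
  A poset is represented by its order relation \<open>K\<close> (with \<open>Partial_order K\<close>); its elements
  are \<open>Field K\<close>, the interval below \<open>F\<close> is \<open>Restr K (under K F)\<close>, and in general
  \<open>Restr K A\<close> is the induced order on \<open>A \<subseteq> Field K\<close>.
\<close>

text \<open>
  The cube \<open>[0,1]^d\<close> for variable \<open>d\<close>, placed in the real vector space of finitely
  supported sequences. Recall that \<open>face_of\<close> admits both the empty face and the cube itself.
\<close>

definition unit_cube :: "nat \<Rightarrow> (nat \<Rightarrow>\<^sub>0 real) set" where
  "unit_cube d = {x. (\<forall>i<d. Poly_Mapping.lookup x i \<in> {0..1}) \<and> (\<forall>i\<ge>d. Poly_Mapping.lookup x i = 0)}"

definition cube_face_poset :: "nat \<Rightarrow> (nat \<Rightarrow>\<^sub>0 real) set rel" where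
  "cube_face_poset d = relation_of (\<subseteq>) {T. T face_of unit_cube d}"

definition is_cube :: "nat \<Rightarrow> 'a rel \<Rightarrow> bool" where
  "is_cube d r \<longleftrightarrow> (\<exists>f. iso r (cube_face_poset d) f)"

definition empty_face :: "'a rel \<Rightarrow> 'a" where
  "empty_face K = (THE m. m \<in> Field K \<and> (\<forall>F\<in>Field K. (m, F) \<in> K))"

definition nonempty_faces :: "'a rel \<Rightarrow> 'a set" where
  "nonempty_faces K = Field K - {empty_face K}"

text \<open>
  The interval below the empty face is a single point, i.e. the cube of dimension \<open>-1\<close>;
  so the cube condition only says something for nonempty faces.
\<close>

definition cubical_complex :: "'a rel \<Rightarrow> bool" where
  "cubical_complex K \<longleftrightarrow>
     Partial_order K \<and> finite (Field K) \<and>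
     (\<exists>m\<in>Field K. \<forall>F\<in>Field K. (m, F) \<in> K) \<and>
     (\<forall>F\<in>nonempty_faces K. \<exists>d. is_cube d (Restr K (under K F))) \<and>
     (\<forall>F\<in>Field K. \<forall>G\<in>Field K. \<exists>H. (H, F) \<in> K \<and> (H, G) \<in> K \<and>
        (\<forall>H'. (H', F) \<in> K \<and> (H', G) \<in> K \<longrightarrow> (H', H) \<in> K))"

definition face_dim :: "'a rel \<Rightarrow> 'a \<Rightarrow> int" where
  "face_dim K F =
     (if F = empty_face K then - 1 else int (THE d. is_cube d (Restr K (under K F))))"

definition complex_dim :: "'a rel \<Rightarrow> int" where
  "complex_dim K = Max (face_dim K ` Field K)"

definition maximal_faces :: "'a rel \<Rightarrow> 'a set" where
  "maximal_faces K = {F \<in> Field K. \<forall>G. (F, G) \<in> K \<longrightarrow> G = F}"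

definition pure_complex :: "'a rel \<Rightarrow> bool" where
  "pure_complex K \<longleftrightarrow>
     (\<forall>F\<in>maximal_faces K. \<forall>G\<in>maximal_faces K. face_dim K F = face_dim K G)"

definition subcomplex :: "'a rel \<Rightarrow> 'a set \<Rightarrow> bool" where
  "subcomplex K A \<longleftrightarrow> A \<noteq> {} \<and> A \<subseteq> Field K \<and> (\<forall>F\<in>A. under K F \<subseteq> A)"


section \<open>Topology and cubical subdivisions\<close>

text \<open>
  Geometric realization of the order complex of the nonempty faces, in barycentric coordinates:
  a point is a convex combination of the elements of a chain of nonempty faces. As there are
  finitely many faces, the product topology induces the usual topology of the realization.
\<close>

definition order_complex_space :: "'a rel \<Rightarrow> ('a \<Rightarrow> real) topology" where
  "order_complex_space L = subtopology (powertop_real UNIV)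
     {\<alpha>. (\<forall>E. 0 \<le> \<alpha> E) \<and> {E. \<alpha> E \<noteq> 0} \<subseteq> nonempty_faces L \<and> {E. \<alpha> E \<noteq> 0} \<in> Chains L \<and>
         (\<Sum>E\<in>nonempty_faces L. \<alpha> E) = 1}"

definition face_space :: "'a rel \<Rightarrow> 'a \<Rightarrow> ('a \<Rightarrow> real) set" where
  "face_space L E = {\<alpha> \<in> topspace (order_complex_space L). {G. \<alpha> G \<noteq> 0} \<subseteq> under L E}"

definition nball :: "nat \<Rightarrow> (nat \<Rightarrow> real) topology" where
  "nball n = subtopology (Euclidean_space n) {x. (\<Sum>i<n. (x i)\<^sup>2) \<le> 1}"

text \<open>
  The boundary of an \<open>n\<close>-ball \<open>X\<close>: the points corresponding to the unit sphere under a
  homeomorphism with the standard ball (which homeomorphism is used does not matter, by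
  invariance of domain). It is empty for \<open>n = 0\<close>.
\<close>

definition ball_boundary :: "nat \<Rightarrow> 'b topology \<Rightarrow> 'b set" where
  "ball_boundary n X =
     {x \<in> topspace X. \<exists>f. homeomorphic_map X (nball n) f \<and> (\<Sum>i<n. (f x i)\<^sup>2) = 1}"

definition interior_faces :: "nat \<Rightarrow> 'a rel \<Rightarrow> 'a set" where
  "interior_faces n L =
     {E \<in> nonempty_faces L. \<not> face_space L E \<subseteq> ball_boundary n (order_complex_space L)}"

definition restriction_faces :: "'a rel \<Rightarrow> 'b rel \<Rightarrow> ('b \<Rightarrow> 'a) \<Rightarrow> 'a \<Rightarrow> 'b set" where
  "restriction_faces K K' \<sigma> F = {E \<in> nonempty_faces K'. (\<sigma> E, F) \<in> K} \<union> {empty_face K'}"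

definition restriction :: "'a rel \<Rightarrow> 'b rel \<Rightarrow> ('b \<Rightarrow> 'a) \<Rightarrow> 'a \<Rightarrow> 'b rel" where
  "restriction K K' \<sigma> F = Restr K' (restriction_faces K K' \<sigma> F)"

definition cubical_subdivision :: "'a rel \<Rightarrow> 'b rel \<Rightarrow> ('b \<Rightarrow> 'a) \<Rightarrow> bool" where
  "cubical_subdivision K K' \<sigma> \<longleftrightarrow>
     cubical_complex K' \<and> \<sigma> \<in> nonempty_faces K' \<rightarrow> nonempty_faces K \<and>
     (\<forall>F\<in>nonempty_faces K.
        subcomplex K' (restriction_faces K K' \<sigma> F) \<and>
        order_complex_space (restriction K K' \<sigma> F) homeomorphic_space nball (nat (face_dim K F)) \<and>
        {E \<in> nonempty_faces K'. \<sigma> E = F} =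
          interior_faces (nat (face_dim K F)) (restriction K K' \<sigma> F))"


section \<open>The polynomials\<close>

definition short_cubical_h :: "'a rel \<Rightarrow> real poly" where
  "short_cubical_h L =
     (\<Sum>E\<in>nonempty_faces L.
        [:0, 2:] ^ nat (face_dim L E) * [:1, - 1:] ^ nat (complex_dim L - face_dim L E))"

definition reduced_euler_char :: "'a rel \<Rightarrow> real" where
  "reduced_euler_char L = (\<Sum>E\<in>Field L. (- 1) powi face_dim L E)"

text \<open>
  The right-hand side of the defining equation of the cubical \<open>h\<close>-polynomial. Real
  coefficients and \<open>powi\<close> make it meaningful also for the complex consisting of the
  empty face only (dimension \<open>-1\<close>).
\<close>

definition cubical_h_rhs :: "'a rel \<Rightarrow> real poly" where
  "cubical_h_rhs L =
     [:2 powi complex_dim L:] + [:0, 1:] * short_cubical_h L +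
     monom ((- 2) powi complex_dim L * reduced_euler_char L) (nat (complex_dim L + 2))"

definition cubical_h :: "'a rel \<Rightarrow> real poly" where
  "cubical_h L = (THE p. [:1, 1:] * p = cubical_h_rhs L)"

definition cubical_local_h :: "'a rel \<Rightarrow> 'b rel \<Rightarrow> ('b \<Rightarrow> 'a) \<Rightarrow> 'a \<Rightarrow> real poly" where
  "cubical_local_h K K' \<sigma> F =
     (\<Sum>G\<in>{G \<in> nonempty_faces K. (G, F) \<in> K}.
        (- 1) ^ nat (face_dim K F - face_dim K G) * cubical_h (restriction K K' \<sigma> G))"

definition link_h :: "'a rel \<Rightarrow> 'a \<Rightarrow> real poly" where
  "link_h K F =
     (\<Sum>G\<in>{G \<in> Field K. (F, G) \<in> K}.
        [:0, 1:] ^ nat (face_dim K G - face_dim K F) *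
        [:1, - 1:] ^ nat (complex_dim K - face_dim K G))"

lemma empty_face_in_Field:
  assumes "cubical_complex K"
  shows "empty_face K \<in> Field K"
proof -
  obtain m where m: "m \<in> Field K" "\<forall>F\<in>Field K. (m, F) \<in> K"
    using assms by (auto simp: cubical_complex_def)
  have anti: "antisym K"
    using assms by (auto simp: cubical_complex_def partial_order_on_def)
  have "empty_face K = m"
    unfolding empty_face_def
  proof (rule the_equality)
    show "n = m" if "n \<in> Field K \<and> (\<forall>F\<in>Field K. (n, F) \<in> K)" for n
      using that m anti by (meson antisymD)
  qed (use m in blast)
  with m show ?thesis by simp
qed

text \<open>The polynomial \<open>cubical_h\<close> is well defined.\<close>

lemma cubical_h_eq:
  assumes "cubical_complex L"
  shows "[:1, 1:] * cubical_h L = cubical_h_rhs L"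
proof -
  define k where "k = complex_dim L"
  have fin: "finite (Field L)" using assms by (simp add: cubical_complex_def)
  have e: "empty_face L \<in> Field L" using assms by (rule empty_face_in_Field)
  have le: "face_dim L E \<le> k" if "E \<in> Field L" for E
    unfolding k_def complex_dim_def using fin that by (intro Max_ge) auto
  have k: "- 1 \<le> k" using le[OF e] by (simp add: face_dim_def)
  define S :: real where "S = (\<Sum>E\<in>nonempty_faces L. (- 1) powi face_dim L E)"
  have chi: "reduced_euler_char L = S - 1"
    unfolding reduced_euler_char_def S_def nonempty_faces_def
    using fin e by (simp add: sum.remove face_dim_def)
  have summand: "(- 2) ^ nat (face_dim L E) * 2 ^ nat (k - face_dim L E)
      = (2::real) powi k * (- 1) powi face_dim L E"
    if "E \<in> nonempty_faces L" for E
  proof -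
    have E: "E \<in> Field L" "E \<noteq> empty_face L" using that by (auto simp: nonempty_faces_def)
    obtain n where n: "face_dim L E = int n" using E by (auto simp: face_dim_def)
    obtain m where m: "k = int n + int m" using le[OF E(1)] n by (metis zle_iff_zadd)
    show ?thesis
      by (simp add: n m power_int_add power_minus [of "2::real"])
  qed
  have h: "poly (short_cubical_h L) (- 1) = 2 powi k * S"
    unfolding short_cubical_h_def S_def
    by (simp add: poly_sum summand flip: k_def sum_distrib_left)
  have sgn: "(- 2) powi k * (- 1) ^ nat (k + 2) = (2::real) powi k"
  proof (cases "k = - 1")
    case True
    then show ?thesis by (simp add: power_int_minus)
  next
    case False
    then have "0 \<le> k" using k by simp
    then obtain n where "k = int n" by (rule nonneg_int_cases)
    then show ?thesis by (simp add: nat_add_distrib power_minus [of "2::real"])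
  qed
  have "poly (cubical_h_rhs L) (- 1)
      = 2 powi k - 2 powi k * S + ((- 2) powi k * (- 1) ^ nat (k + 2)) * (S - 1)"
    by (simp add: cubical_h_rhs_def h chi poly_monom flip: k_def)
  also have "\<dots> = 0" unfolding sgn by (simp add: algebra_simps)
  finally have "[:1, 1:] dvd cubical_h_rhs L"
    by (simp add: poly_eq_0_iff_dvd)
  then obtain p where p: "[:1, 1:] * p = cubical_h_rhs L" by (auto elim: dvdE)
  show ?thesis
    unfolding cubical_h_def
  proof (rule theI)
    show "[:1, 1:] * p = cubical_h_rhs L" by (fact p)
    show "q = p" if "[:1, 1:] * q = cubical_h_rhs L" for q
      using that p mult_left_cancel[of "[:1, 1:]" q p] by simp
  qed
qed

end

theory Submission
  imports Defs "HOL-Homology.Homology"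
begin

text \<open>
  For a nonempty face \<open>G\<close> of \<open>K\<close> put \<open>e(G) = \<Sum>\<^bsub>H \<ge> G\<^esub> (- 1)^(dim H - dim G)\<close>. Intervals above a nonempty face are
  Boolean, so that \<open>\<Sum>\<^bsub>F \<ge> G\<^esub> (- 1)^(dim F - dim G) h(link F) = (1 - x)^(d - dim G) e(G)\<close> and
  \<open>\<Sum>\<^bsub>G \<ge> S\<^esub> e(G) = 1\<close> for every nonempty face \<open>S\<close>. Interchanging sums, the second identity turns the sum of
  the short cubical \<open>h\<close>-polynomials of the balls \<open>K'_G\<close>, weighted by \<open>(1 - x)^(d - dim G) e(G)\<close>, into the short
  cubical \<open>h\<close>-polynomial of \<open>K'\<close>. The same computation applies to the trivial subdivision, whose local
  contributions vanish in positive dimension because the cubical \<open>h\<close>-polynomial of a cube is \<open>2^dim\<close>; the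
  difference of the two computations is the claim.

  Topology enters through the reduced Euler characteristic of \<open>K'_G\<close>, which must be \<open>0\<close>, and the dimension of
  \<open>K'_G\<close>, which must be \<open>dim G\<close>. The latter is invariance of domain on an open top-dimensional simplex. For
  the former, a simplicial cycle modulo 2 in a contractible complex bounds a singular chain; after iterated
  subdivision, labelling each point with its largest barycentric coordinate maps that singular chain back to
  simplicial chains, and this retraction is the identity on simplicial chains. So the complex is acyclic
  modulo 2, and counting cycles and boundaries gives the Euler characteristic.
\<close>

text \<open>Coefficients modulo 2 free the comparison of simplicial and singular chains from
  orientations, and they let a singular simplex with a repeated label count as zero: its faces onto
  a given simplex cancel in pairs. The price is that a simplicial cycle modulo 2 gives an integral
  chain whose boundary is only even, and that in degree 0 the contraction leaves a constant chain
  that need not vanish. Both defects are absorbed by correction terms whose labelled coefficients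
  are even. On the combinatorial side, the value 2^dim for a cube comes from (2x + 2(1-x))^dim. The
  factor (1-x)^(d - dim G) brings balls of different dimensions to the common degree d, so that a
  face of K' contributes the same term to every ball containing it; only then can the weights e(G)
  be collected face by face.\<close>

section \<open>Faces of the cube\<close>

text \<open>
  A nonempty face of the cube is described by the partial map recording the coordinates that are
  fixed on the face, together with their values.
\<close>

definition cube_face :: "nat \<Rightarrow> (nat \<rightharpoonup> bool) \<Rightarrow> (nat \<Rightarrow>\<^sub>0 real) set" where
  "cube_face d c = {x \<in> unit_cube d. \<forall>i b. c i = Some b \<longrightarrow> Poly_Mapping.lookup x i = of_bool b}"

lemma lookup_scaleR: "Poly_Mapping.lookup (r *\<^sub>R x) i = r *\<^sub>R Poly_Mapping.lookup x i"
proof -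
  have "finite {i. r *\<^sub>R Poly_Mapping.lookup x i \<noteq> 0}"
    by (rule finite_subset [OF _ finite_lookup [of x]]) auto
  then show ?thesis by (simp add: scaleR_poly_mapping_def lookup_Abs_poly_mapping)
qed

definition cube_point :: "nat \<Rightarrow> (nat \<Rightarrow> real) \<Rightarrow> nat \<Rightarrow>\<^sub>0 real" where
  "cube_point d g = Abs_poly_mapping (\<lambda>i. if i < d then g i else 0)"

lemma lookup_cube_point: "Poly_Mapping.lookup (cube_point d g) i = (if i < d then g i else 0)"
proof -
  have "finite {i. (if i < d then g i else 0) \<noteq> 0}"
    by (rule finite_subset [of _ "{..<d}"]) auto
  then show ?thesis by (simp add: cube_point_def lookup_Abs_poly_mapping)
qed

lemma cube_face_subset: "cube_face d c \<subseteq> unit_cube d"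
  by (auto simp: cube_face_def)

lemma convex_cube_face: "convex (cube_face d c)"
proof (rule convexI)
  fix x y :: "nat \<Rightarrow>\<^sub>0 real" and u v :: real
  assume xy: "x \<in> cube_face d c" "y \<in> cube_face d c" and uv: "0 \<le> u" "0 \<le> v" "u + v = 1"
  have "u * Poly_Mapping.lookup x i + v * Poly_Mapping.lookup y i \<in> {0..1}" if "i < d" for i
  proof -
    have b: "0 \<le> Poly_Mapping.lookup x i" "Poly_Mapping.lookup x i \<le> 1"
      "0 \<le> Poly_Mapping.lookup y i" "Poly_Mapping.lookup y i \<le> 1"
      using xy that by (auto simp: cube_face_def unit_cube_def)
    then show ?thesis using uv convex_bound_le [of _ 1 _ u v] by simp
  qed
  moreover have "u * of_bool b + v * of_bool b = (of_bool b :: real)" for b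
    using uv(3) by (metis distrib_right mult_1)
  ultimately show "u *\<^sub>R x + v *\<^sub>R y \<in> cube_face d c"
    using xy by (auto simp: cube_face_def unit_cube_def lookup_add lookup_scaleR)
qed

text \<open>The end points 0 and 1 are extreme in the unit interval: at the value 1 the distances
  1-a and 1-b are nonnegative with vanishing weighted sum, at the value 0 the coordinates themselves
  are.\<close>

lemma convex_comb_eq_of_bool:
  fixes a b u :: real
  assumes "0 \<le> a" "a \<le> 1" "0 \<le> b" "b \<le> 1" "0 < u" "u < 1"
    and "(1 - u) * a + u * b = of_bool t"
  shows "a = of_bool t \<and> b = of_bool t"
proof (cases t)
  case True
  then have "(1 - u) * (1 - a) + u * (1 - b) = 0" using assms by (simp add: algebra_simps)
  moreover have "0 \<le> (1 - u) * (1 - a)" "0 \<le> u * (1 - b)" using assms by auto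
  ultimately have "(1 - u) * (1 - a) = 0" "u * (1 - b) = 0" by linarith+
  then show ?thesis using assms True by simp
next
  case False
  have "0 \<le> (1 - u) * a" "0 \<le> u * b" using assms by auto
  then have "(1 - u) * a = 0" "u * b = 0" using False assms(7) by (auto simp: add_nonneg_eq_0_iff)
  then show ?thesis using assms False by simp
qed

lemma cube_face_face_of:
  assumes "dom c \<subseteq> {..<d}"
  shows "cube_face d c face_of unit_cube d"
  unfolding face_of_def
proof (intro conjI ballI impI)
  show "cube_face d c \<subseteq> unit_cube d" by (rule cube_face_subset)
  show "convex (cube_face d c)" by (rule convex_cube_face)
  fix a b x assume ab: "a \<in> unit_cube d" "b \<in> unit_cube d" and x: "x \<in> cube_face d c" "x \<in> open_segment a b"
  obtain u where u: "0 < u" "u < 1" "x = (1 - u) *\<^sub>R a + u *\<^sub>R b"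
    using x(2) by (auto simp: in_segment)
  have "Poly_Mapping.lookup a i = of_bool t \<and> Poly_Mapping.lookup b i = of_bool t" if t: "c i = Some t" for i t
  proof (rule convex_comb_eq_of_bool [OF _ _ _ _ u(1,2)])
    have i: "i < d" using assms t by auto
    then show "0 \<le> Poly_Mapping.lookup a i" "Poly_Mapping.lookup a i \<le> 1"
      "0 \<le> Poly_Mapping.lookup b i" "Poly_Mapping.lookup b i \<le> 1"
      using ab by (auto simp: unit_cube_def)
    have "Poly_Mapping.lookup x i = of_bool t" using x(1) t by (auto simp: cube_face_def)
    then show "(1 - u) * Poly_Mapping.lookup a i + u * Poly_Mapping.lookup b i = of_bool t"
      using u(3) by (simp add: lookup_add lookup_scaleR)
  qed
  then show "a \<in> cube_face d c" "b \<in> cube_face d c" using ab by (auto simp: cube_face_def)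
qed

text \<open>Averaging: a coordinate that is neither constantly 0 nor constantly 1 on T can be pushed
  into the open interval without pulling the earlier ones out of it.\<close>

lemma face_point_interior_coordinates:
  assumes T: "convex T" "T \<subseteq> unit_cube d" "T \<noteq> {}" and "finite I" "I \<subseteq> {..<d}"
    and I: "\<And>i b. i \<in> I \<Longrightarrow> \<exists>x\<in>T. Poly_Mapping.lookup x i \<noteq> of_bool b"
  shows "\<exists>z\<in>T. \<forall>i\<in>I. 0 < Poly_Mapping.lookup z i \<and> Poly_Mapping.lookup z i < 1"
  using \<open>finite I\<close> assms(5) I
proof (induction I rule: finite_induct)
  case empty
  then show ?case using T by auto
next
  case (insert i I)
  then obtain z where z: "z \<in> T" "\<forall>i\<in>I. 0 < Poly_Mapping.lookup z i \<and> Poly_Mapping.lookup z i < 1"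
    by (metis insert_iff insert_subset)
  obtain x y where xy: "x \<in> T" "Poly_Mapping.lookup x i \<noteq> 0" "y \<in> T" "Poly_Mapping.lookup y i \<noteq> 1"
    using insert.prems(2) [of i True] insert.prems(2) [of i False] by auto
  have b: "0 \<le> Poly_Mapping.lookup w j \<and> Poly_Mapping.lookup w j \<le> 1" if "w \<in> T" "j < d" for w j
    using T that by (auto simp: unit_cube_def)
  \<comment> \<open>\<open>x\<close> keeps the new coordinate away from 0 and \<open>y\<close> keeps
    it away from 1. All three weights 1/2, 1/4, 1/4 are positive, so a coordinate strictly between 0
    and 1 at \<open>z\<close> stays there.\<close>
  define w where "w = (1/2) *\<^sub>R z + (1/2) *\<^sub>R ((1/2) *\<^sub>R x + (1/2) *\<^sub>R y)"
  have xyT: "(1/2) *\<^sub>R x + (1/2) *\<^sub>R y \<in> T" by (rule convexD [OF T(1) xy(1,3)]) auto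
  have wT: "w \<in> T" unfolding w_def by (rule convexD [OF T(1) z(1) xyT]) auto
  have lw: "Poly_Mapping.lookup w j = Poly_Mapping.lookup z j / 2 + Poly_Mapping.lookup x j / 4 + Poly_Mapping.lookup y j / 4" for j
    by (simp add: w_def lookup_add lookup_scaleR)
  have "0 < Poly_Mapping.lookup w j \<and> Poly_Mapping.lookup w j < 1" if j: "j \<in> insert i I" for j
  proof -
    have jd: "j < d" using insert.prems j by auto
    note bb = b [OF z(1) jd] b [OF xy(1) jd] b [OF xy(3) jd]
    show ?thesis
    proof (cases "j = i")
      case True
      then show ?thesis using bb xy(2,4) unfolding lw by auto
    next
      case False
      then have "0 < Poly_Mapping.lookup z j \<and> Poly_Mapping.lookup z j < 1" using z j by auto
      then show ?thesis using bb unfolding lw by auto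
    qed
  qed
  then show ?case using wT by blast
qed

text \<open>Fix exactly the coordinates that are constantly 0 or constantly 1 on T, and take z in T
  with all other coordinates strictly inside. From any y in the resulting cube face the segment to z
  can be prolonged beyond z within the cube, so the face property pulls y into T.\<close>

lemma face_of_unit_cube_is_cube_face:
  assumes T: "T face_of unit_cube d" "T \<noteq> {}"
  shows "\<exists>c. dom c \<subseteq> {..<d} \<and> T = cube_face d c"
proof -
  have T': "convex T" "T \<subseteq> unit_cube d" using T by (auto simp: face_of_def)
  define c where "c i = (if i < d \<and> (\<exists>b. \<forall>x\<in>T. Poly_Mapping.lookup x i = of_bool b)
      then Some (SOME b. \<forall>x\<in>T. Poly_Mapping.lookup x i = of_bool b) else None)" for i
  have c: "\<forall>x\<in>T. Poly_Mapping.lookup x i = of_bool b" if "c i = Some b" for i b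
  proof -
    have P: "i < d \<and> (\<exists>b. \<forall>x\<in>T. Poly_Mapping.lookup x i = of_bool b)" (is ?P)
    proof (rule ccontr)
      assume "\<not> ?P"
      then have "c i = None" unfolding c_def by (rule if_not_P)
      then show False using that by simp
    qed
    have "c i = Some (SOME b. \<forall>x\<in>T. Poly_Mapping.lookup x i = of_bool b)"
      unfolding c_def by (rule if_P [OF P])
    from trans [OF that [symmetric] this]
    have b: "b = (SOME b. \<forall>x\<in>T. Poly_Mapping.lookup x i = of_bool b)"
      by (rule option.inject [THEN iffD1])
    show ?thesis unfolding b by (rule someI_ex [OF conjunct2 [OF P]])
  qed
  have dom: "dom c \<subseteq> {..<d}" by (auto simp: c_def split: if_splits)
  obtain z where z: "z \<in> T" "\<forall>i\<in>{..<d} - dom c. 0 < Poly_Mapping.lookup z i \<and> Poly_Mapping.lookup z i < 1"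
  proof -
    have "\<exists>z\<in>T. \<forall>i\<in>{..<d} - dom c. 0 < Poly_Mapping.lookup z i \<and> Poly_Mapping.lookup z i < 1"
    proof (rule face_point_interior_coordinates [OF T' T(2)])
      fix i b assume i: "i \<in> {..<d} - dom c"
      have "\<not> (\<forall>x\<in>T. Poly_Mapping.lookup x i = of_bool b)"
      proof
        assume "\<forall>x\<in>T. Poly_Mapping.lookup x i = of_bool b"
        then have "i < d \<and> (\<exists>b. \<forall>x\<in>T. Poly_Mapping.lookup x i = of_bool b)" using i by blast
        then have "c i \<noteq> None" unfolding c_def by (simp only: if_True simp_thms) simp
        then show False using i by blast
      qed
      then show "\<exists>x\<in>T. Poly_Mapping.lookup x i \<noteq> of_bool b" by blast
    qed auto
    then show thesis using that by blast
  qed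
  have "cube_face d c \<subseteq> T"
  proof
    fix y assume y: "y \<in> cube_face d c"
    show "y \<in> T"
    proof (cases "y = z")
      case True
      then show ?thesis using z by simp
    next
      case False
      let ?I = "{..<d} - dom c"
      \<comment> \<open>A safe length for the prolongation: coordinates differ by at most 1, so
        moving by \<open>m\<close> keeps the free ones in [0,1]. The inserted 1 makes the set
        nonempty when every coordinate is fixed.\<close>
      define m where "m = Min (insert 1 ((\<lambda>i. min (Poly_Mapping.lookup z i) (1 - Poly_Mapping.lookup z i)) ` ?I))"
      have m0: "0 < m" unfolding m_def using z by (subst Min_gr_iff) auto
      have m1: "m \<le> 1" unfolding m_def by (rule Min_le) auto
      have mi: "m \<le> Poly_Mapping.lookup z i" "m \<le> 1 - Poly_Mapping.lookup z i" if "i \<in> ?I" for i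
      proof -
        have "m \<le> min (Poly_Mapping.lookup z i) (1 - Poly_Mapping.lookup z i)"
          unfolding m_def using that by (intro Min_le) auto
        then show "m \<le> Poly_Mapping.lookup z i" "m \<le> 1 - Poly_Mapping.lookup z i" by auto
      qed
      define w where "w = z + m *\<^sub>R (z - y)"
      have lw: "Poly_Mapping.lookup w i = Poly_Mapping.lookup z i + m * (Poly_Mapping.lookup z i - Poly_Mapping.lookup y i)" for i
        by (simp add: w_def lookup_add lookup_scaleR lookup_minus)
      have yc: "y \<in> unit_cube d" "z \<in> unit_cube d" using y z T' by (auto simp: cube_face_def)
      have "w \<in> unit_cube d"
        unfolding unit_cube_def
      proof (intro CollectI conjI allI impI)
        fix i assume i: "i < d"
        have yz: "0 \<le> Poly_Mapping.lookup y i" "Poly_Mapping.lookup y i \<le> 1" "0 \<le> Poly_Mapping.lookup z i" "Poly_Mapping.lookup z i \<le> 1"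
          using yc i by (auto simp: unit_cube_def)
        show "Poly_Mapping.lookup w i \<in> {0..1}"
        proof (cases "i \<in> dom c")
          case True
          then obtain b where "c i = Some b" by blast
          then have "Poly_Mapping.lookup y i = Poly_Mapping.lookup z i" using c z y by (auto simp: cube_face_def)
          then show ?thesis using yz lw by simp
        next
          case False
          then have mm: "m \<le> Poly_Mapping.lookup z i" "m \<le> 1 - Poly_Mapping.lookup z i" using mi i by auto
          have "- m \<le> m * (Poly_Mapping.lookup z i - Poly_Mapping.lookup y i)"
            using mult_left_mono [of "-1" "Poly_Mapping.lookup z i - Poly_Mapping.lookup y i" m] m0 yz by simp
          moreover have "m * (Poly_Mapping.lookup z i - Poly_Mapping.lookup y i) \<le> m"
            using mult_left_mono [of "Poly_Mapping.lookup z i - Poly_Mapping.lookup y i" 1 m] m0 yz by simp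
          ultimately show ?thesis using mm lw by simp
        qed
      next
        fix i assume "d \<le> i"
        then show "Poly_Mapping.lookup w i = 0" using yc by (simp add: lw unit_cube_def)
      qed
      moreover have "z \<in> open_segment y w"
      proof -
        \<comment> \<open>Chosen so that \<open>z\<close> divides the segment from \<open>y\<close>
          to \<open>w\<close> correctly, as \<open>w - y\<close> is 1+m times
          \<open>z - y\<close>.\<close>
        define s where "s = 1 / (1 + m)"
        have s: "s * (1 + m) = 1" "0 < s" "s < 1" using m0 by (simp_all add: s_def)
        have "z = (1 - s) *\<^sub>R y + s *\<^sub>R w"
        proof (rule poly_mapping_eqI)
          fix i
          have "Poly_Mapping.lookup ((1 - s) *\<^sub>R y + s *\<^sub>R w) i =
              Poly_Mapping.lookup y i + (s * (1 + m)) * (Poly_Mapping.lookup z i - Poly_Mapping.lookup y i)"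
            unfolding lookup_add lookup_scaleR lw by (simp add: algebra_simps)
          then show "Poly_Mapping.lookup z i = Poly_Mapping.lookup ((1 - s) *\<^sub>R y + s *\<^sub>R w) i"
            unfolding s(1) by simp
        qed
        moreover have "y \<noteq> w"
        proof
          assume "y = w"
          then have "(1 + m) *\<^sub>R (z - y) = 0" by (simp add: w_def algebra_simps)
          then show False using False m0 by simp
        qed
        ultimately show ?thesis unfolding in_segment using s
          by (intro conjI exI [of _ s]) auto
      qed
      ultimately show ?thesis using face_ofD [OF T(1), of z y w] z(1) yc(1) by blast
    qed
  qed
  moreover have "T \<subseteq> cube_face d c" using T' c by (auto simp: cube_face_def)
  ultimately show ?thesis using dom by blast
qed

lemma cube_face_mono_iff:
  assumes "dom c \<subseteq> {..<d}" "dom c' \<subseteq> {..<d}"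
  shows "cube_face d c \<subseteq> cube_face d c' \<longleftrightarrow> c' \<subseteq>\<^sub>m c"
proof
  assume sub: "cube_face d c \<subseteq> cube_face d c'"
  \<comment> \<open>The barycentre of the face: 1/2 in a free coordinate agrees with neither
    prescribed value, so a coordinate fixed by \<open>c'\<close> must be fixed by \<open>c\<close>,
    to the same value.\<close>
  define x where "x = cube_point d (\<lambda>i. case c i of None \<Rightarrow> 1/2 | Some b \<Rightarrow> of_bool b)"
  have "x \<in> cube_face d c"
    using assms by (auto simp: x_def cube_face_def unit_cube_def lookup_cube_point split: option.splits)
  then have x: "x \<in> cube_face d c'" using sub by blast
  show "c' \<subseteq>\<^sub>m c"
    unfolding map_le_def
  proof
    fix i assume "i \<in> dom c'"
    then obtain b where b: "c' i = Some b" and i: "i < d" using assms by blast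
    then have "Poly_Mapping.lookup x i = of_bool b" using x by (auto simp: cube_face_def)
    then have "(case c i of None \<Rightarrow> 1/2 | Some b \<Rightarrow> of_bool b) = (of_bool b :: real)"
      using i by (simp add: x_def lookup_cube_point)
    then show "c' i = c i" using b by (cases b; auto split: option.splits)
  qed
next
  assume "c' \<subseteq>\<^sub>m c"
  then show "cube_face d c \<subseteq> cube_face d c'"
    by (auto simp: cube_face_def map_le_def dom_def)
qed

lemma cube_face_nonempty:
  assumes "dom c \<subseteq> {..<d}"
  shows "cube_face d c \<noteq> {}"
proof -
  have "cube_point d (\<lambda>i. case c i of None \<Rightarrow> 1/2 | Some b \<Rightarrow> of_bool b) \<in> cube_face d c"
    using assms by (auto simp: cube_face_def unit_cube_def lookup_cube_point split: option.splits)
  then show ?thesis by blast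
qed

lemma bij_betw_cube_face:
  "bij_betw (cube_face d) {c. dom c \<subseteq> {..<d}} {T. T face_of unit_cube d \<and> T \<noteq> {}}"
  unfolding bij_betw_def
proof
  show "inj_on (cube_face d) {c. dom c \<subseteq> {..<d}}"
    using cube_face_mono_iff by (metis (mono_tags, lifting) inj_onI map_le_antisym mem_Collect_eq order_refl)
  show "cube_face d ` {c. dom c \<subseteq> {..<d}} = {T. T face_of unit_cube d \<and> T \<noteq> {}}"
  proof (intro equalityI subsetI)
    fix T assume "T \<in> cube_face d ` {c. dom c \<subseteq> {..<d}}"
    then show "T \<in> {T. T face_of unit_cube d \<and> T \<noteq> {}}"
      using cube_face_face_of cube_face_nonempty by auto
  next
    fix T assume "T \<in> {T. T face_of unit_cube d \<and> T \<noteq> {}}"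
    then show "T \<in> cube_face d ` {c. dom c \<subseteq> {..<d}}"
      using face_of_unit_cube_is_cube_face [of T d] by auto
  qed
qed

section \<open>Weighted counts of partial maps\<close>

text \<open>Each element of A contributes independently: weight \<open>a\<close> if it is free,
  \<open>b\<close> for either of its two values. For a face of a cube the free coordinates count the
  dimension, the fixed ones the codimension.\<close>

lemma sum_partial_maps:
  fixes a b :: "'b::comm_semiring_1"
  assumes "finite A"
  shows "(\<Sum>c\<in>{c :: 'a \<rightharpoonup> bool. dom c \<subseteq> A}. a ^ (card A - card (dom c)) * b ^ card (dom c)) = (a + 2 * b) ^ card A"
proof -
  let ?f = "\<lambda>y :: bool option. if y = None then a else b"
  have "(a + 2 * b) ^ card A = (\<Prod>x\<in>A. \<Sum>y\<in>UNIV. ?f y)"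
  proof -
    have "(UNIV :: bool option set) = {None, Some True, Some False}"
      by (auto simp: UNIV_option_conv UNIV_bool)
    then have "(\<Sum>y\<in>UNIV. ?f y) = (\<Sum>y\<in>{None, Some True, Some False}. ?f y)" by (rule sum.cong) simp
    also have "\<dots> = a + 2 * b" by (simp add: mult_2)
    finally have "(\<Sum>y\<in>UNIV. ?f y) = a + 2 * b" .
    then show ?thesis by simp
  qed
  also have "\<dots> = (\<Sum>g\<in>PiE A (\<lambda>_. UNIV). \<Prod>x\<in>A. ?f (g x))"
    using assms by (intro prod_sum_PiE) auto
  also have "\<dots> = (\<Sum>c\<in>{c :: 'a \<rightharpoonup> bool. dom c \<subseteq> A}. \<Prod>x\<in>A. ?f (c x))"
  \<comment> \<open>The two index sets differ only in the default outside \<open>A\<close>: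
    \<open>undefined\<close> for extensional functions, \<open>None\<close> for partial
    maps.\<close>
  proof (rule sum.reindex_bij_witness [where i = "\<lambda>c. restrict c A" and j = "\<lambda>g x. if x \<in> A then g x else None"])
    fix c :: "'a \<rightharpoonup> bool" assume "c \<in> {c. dom c \<subseteq> A}"
    then have "c x = None" if "x \<notin> A" for x using that by (auto simp: domIff subset_iff)
    then show "(\<lambda>x. if x \<in> A then restrict c A x else None) = c" by (auto simp: fun_eq_iff)
  next
    fix g :: "'a \<Rightarrow> bool option" assume "g \<in> PiE A (\<lambda>_. UNIV)"
    then show "(\<lambda>x\<in>A. if x \<in> A then g x else None) = g" by (auto simp: fun_eq_iff PiE_def extensional_def)
  qed (auto split: if_splits)
  also have "\<dots> = (\<Sum>c\<in>{c :: 'a \<rightharpoonup> bool. dom c \<subseteq> A}. a ^ (card A - card (dom c)) * b ^ card (dom c))"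
  proof (rule sum.cong)
    fix c :: "'a \<rightharpoonup> bool" assume c: "c \<in> {c. dom c \<subseteq> A}"
    then have fin: "finite (dom c)" using assms finite_subset by blast
    have "(\<Prod>x\<in>A. ?f (c x)) = (\<Prod>x\<in>A - dom c. ?f (c x)) * (\<Prod>x\<in>dom c. ?f (c x))"
      using prod.subset_diff [of "dom c" A] c assms by auto
    also have "(\<Prod>x\<in>A - dom c. ?f (c x)) = (\<Prod>x\<in>A - dom c. a)" by (rule prod.cong) (auto simp: domIff)
    also have "(\<Prod>x\<in>dom c. ?f (c x)) = (\<Prod>x\<in>dom c. b)" by (rule prod.cong) auto
    finally show "(\<Prod>x\<in>A. ?f (c x)) = a ^ (card A - card (dom c)) * b ^ card (dom c)"
      using card_Diff_subset [OF fin] c by (simp add: fin)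
  qed auto
  finally show ?thesis by simp
qed

text \<open>A submap of \<open>c0\<close> is determined by its domain, so this is the binomial
  theorem over subsets. It encodes that the faces above a nonempty face of a cube form a Boolean
  lattice.\<close>

lemma sum_submaps:
  fixes a b :: "'b::comm_semiring_1" and c0 :: "'a \<rightharpoonup> bool"
  assumes "finite (dom c0)"
  shows "(\<Sum>c\<in>{c. c \<subseteq>\<^sub>m c0}. a ^ (card (dom c0) - card (dom c)) * b ^ card (dom c)) = (a + b) ^ card (dom c0)"
proof -
  have "(a + b) ^ card (dom c0) = (\<Prod>x\<in>dom c0. b + a)" by (simp add: add.commute)
  also have "\<dots> = (\<Sum>X\<in>Pow (dom c0). (\<Prod>x\<in>X. b) * (\<Prod>x\<in>dom c0 - X. a))"
    using assms by (rule prod_add)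
  also have "\<dots> = (\<Sum>X\<in>Pow (dom c0). a ^ (card (dom c0) - card X) * b ^ card X)"
    using assms by (intro sum.cong) (auto simp: card_Diff_subset finite_subset mult.commute)
  also have "\<dots> = (\<Sum>c\<in>{c. c \<subseteq>\<^sub>m c0}. a ^ (card (dom c0) - card (dom c)) * b ^ card (dom c))"
  proof (rule sum.reindex_bij_witness [where i = dom and j = "\<lambda>X. c0 |` X"])
    fix c assume "c \<in> {c. c \<subseteq>\<^sub>m c0}"
    then show "c0 |` dom c = c" by (auto simp: map_le_def restrict_map_def fun_eq_iff domIff)
    show "dom c \<in> Pow (dom c0)" using \<open>c \<in> _\<close> by (auto dest!: map_le_implies_dom_le)
  next
    fix X assume "X \<in> Pow (dom c0)"
    then show "dom (c0 |` X) = X" "c0 |` X \<in> {c. c \<subseteq>\<^sub>m c0}" by (auto simp: map_le_def)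
  qed (auto simp: Int_absorb1)
  finally show ?thesis by simp
qed

text \<open>Once the coordinates fixed by \<open>c0\<close> are deleted, every remaining one is
  free, true or false.\<close>

lemma card_partial_maps_extending:
  fixes c0 :: "'a \<rightharpoonup> bool"
  assumes A: "finite A" "dom c0 \<subseteq> A"
  shows "card {c. dom c \<subseteq> A \<and> c0 \<subseteq>\<^sub>m c} = 3 ^ (card A - card (dom c0))"
proof -
  have "card {c. dom c \<subseteq> A \<and> c0 \<subseteq>\<^sub>m c} = card {c :: 'a \<rightharpoonup> bool. dom c \<subseteq> A - dom c0}"
  proof (rule bij_betw_same_card [of "\<lambda>c. c |` (- dom c0)"], rule bij_betw_byWitness [where f' = "\<lambda>c. c ++ c0"])
    show "\<forall>c\<in>{c. dom c \<subseteq> A \<and> c0 \<subseteq>\<^sub>m c}. c |` (- dom c0) ++ c0 = c"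
      by (auto simp: map_le_def map_add_def restrict_map_def fun_eq_iff domIff split: option.splits)
    show "\<forall>c\<in>{c. dom c \<subseteq> A - dom c0}. (c ++ c0) |` (- dom c0) = c"
    proof (intro ballI ext)
      fix c :: "'a \<rightharpoonup> bool" and x assume "c \<in> {c. dom c \<subseteq> A - dom c0}"
      then have "x \<in> dom c0 \<Longrightarrow> x \<notin> dom c" by blast
      then show "((c ++ c0) |` (- dom c0)) x = c x"
        by (cases "x \<in> dom c0") (simp_all add: restrict_map_def map_add_dom_app_simps(3) domIff)
    qed
  qed (use A in \<open>auto simp: map_le_map_add restrict_map_def split: if_splits\<close>)
  also have "\<dots> = 3 ^ card (A - dom c0)"
    using sum_partial_maps [of "A - dom c0" "1::nat" 1] A by (simp add: numeral_eq_Suc)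
  also have "card (A - dom c0) = card A - card (dom c0)" using A by (simp add: card_Diff_subset finite_subset)
  finally show ?thesis .
qed

section \<open>Intervals in cubical complexes\<close>

locale cubical =
  fixes K :: "'a rel"
  assumes cubical: "cubical_complex K"
begin

abbreviation faces :: "'a set" where "faces \<equiv> nonempty_faces K"
abbreviation dim :: "'a \<Rightarrow> nat" where "dim F \<equiv> nat (face_dim K F)"

lemma partial_order: "Partial_order K" and finite_Field: "finite (Field K)"
  using cubical by (auto simp: cubical_complex_def)

lemma refl: "F \<in> Field K \<Longrightarrow> (F, F) \<in> K"
  using partial_order by (auto simp: partial_order_on_def preorder_on_def refl_on_def)

lemma trans: "(E, F) \<in> K \<Longrightarrow> (F, G) \<in> K \<Longrightarrow> (E, G) \<in> K"
  using partial_order by (auto simp: partial_order_on_def preorder_on_def dest: transD)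

lemma antisym: "(E, F) \<in> K \<Longrightarrow> (F, E) \<in> K \<Longrightarrow> E = F"
  using partial_order by (auto simp: partial_order_on_def dest: antisymD)

lemma in_Field: "(E, F) \<in> K \<Longrightarrow> E \<in> Field K" "(E, F) \<in> K \<Longrightarrow> F \<in> Field K"
  by (auto simp: Field_def)

lemma empty_face_le: "F \<in> Field K \<Longrightarrow> (empty_face K, F) \<in> K"
proof -
  obtain m where m: "m \<in> Field K" "\<forall>F\<in>Field K. (m, F) \<in> K"
    using cubical by (auto simp: cubical_complex_def)
  have "(m, empty_face K) \<in> K" using m empty_face_in_Field [OF cubical] by blast
  moreover have "empty_face K = m"
    unfolding empty_face_def
    by (rule the_equality) (use m antisym in blast)+
  ultimately show "F \<in> Field K \<Longrightarrow> (empty_face K, F) \<in> K" using m by simp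
qed

lemma finite_faces: "finite faces" and faces_Field: "F \<in> faces \<Longrightarrow> F \<in> Field K"
  using finite_Field by (auto simp: nonempty_faces_def)

lemma faces_up: "E \<in> faces \<Longrightarrow> (E, F) \<in> K \<Longrightarrow> F \<in> faces"
  using empty_face_le antisym in_Field by (metis DiffD1 DiffD2 DiffI nonempty_faces_def singletonD singletonI)

lemma faces_iff: "F \<in> faces \<longleftrightarrow> F \<in> Field K \<and> F \<noteq> empty_face K"
  by (auto simp: nonempty_faces_def)

text \<open>Coordinates on the nonempty faces of F. The order is reversed because fixing more
  coordinates gives a smaller face; a nonempty F itself corresponds to the empty map.\<close>

definition interval_chart :: "'a \<Rightarrow> nat \<Rightarrow> ('a \<Rightarrow> (nat \<rightharpoonup> bool)) \<Rightarrow> bool" where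
  "interval_chart F d \<phi> \<longleftrightarrow>
     bij_betw \<phi> {E \<in> faces. (E, F) \<in> K} {c. dom c \<subseteq> {..<d}} \<and>
     (\<forall>E\<in>{E \<in> faces. (E, F) \<in> K}. \<forall>E'\<in>{E \<in> faces. (E, F) \<in> K}. (E, E') \<in> K \<longleftrightarrow> \<phi> E' \<subseteq>\<^sub>m \<phi> E)"

lemma interval_chartD:
  assumes "interval_chart F d \<phi>"
  shows "bij_betw \<phi> {E \<in> faces. (E, F) \<in> K} {c. dom c \<subseteq> {..<d}}"
    and "\<And>E E'. E \<in> faces \<Longrightarrow> (E, F) \<in> K \<Longrightarrow> E' \<in> faces \<Longrightarrow> (E', F) \<in> K \<Longrightarrow>
       (E, E') \<in> K \<longleftrightarrow> \<phi> E' \<subseteq>\<^sub>m \<phi> E"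
  using assms unfolding interval_chart_def by blast+

lemma interval_chart_exists:
  assumes F: "F \<in> faces" and d: "is_cube d (Restr K (under K F))"
  shows "\<exists>\<phi>. interval_chart F d \<phi>"
proof -
  let ?r = "Restr K (under K F)" and ?r' = "cube_face_poset d"
  obtain f where f: "BNF_Wellorder_Embedding.iso ?r ?r' f" using d by (auto simp: is_cube_def)
  have FF: "F \<in> Field K" using F faces_Field by blast
  have Fr: "Field ?r = under K F"
  proof
    show "under K F \<subseteq> Field ?r"
    proof
      fix E assume "E \<in> under K F"
      then have "(E, E) \<in> ?r" using refl in_Field by (auto simp: under_def)
      then show "E \<in> Field ?r" by (auto simp: Field_def)
    qed
  qed (auto simp: Field_def)
  have ur: "under ?r E = under K E" if "E \<in> under K F" for E
    using that trans by (auto simp: under_def)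
  have Fr': "Field ?r' = {T. T face_of unit_cube d}"
    by (auto simp: cube_face_poset_def relation_of_def Field_def)
  have ur': "under ?r' T = {S. S face_of unit_cube d \<and> S \<subseteq> T}" if "T face_of unit_cube d" for T
    using that by (auto simp: cube_face_poset_def relation_of_def under_def)
  have bij: "bij_betw f (under K F) {T. T face_of unit_cube d}"
    using f unfolding BNF_Wellorder_Embedding.iso_def Fr Fr' by blast
  have und: "bij_betw f (under K E) {S. S face_of unit_cube d \<and> S \<subseteq> f E}" if E: "E \<in> under K F" for E
  proof -
    have "f E face_of unit_cube d" using bij E by (auto simp: bij_betw_def)
    then show ?thesis using f E unfolding BNF_Wellorder_Embedding.iso_def embed_def Fr using ur ur' by metis
  qed
  have inj: "inj_on f (under K F)" using bij by (simp add: bij_betw_def)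
  \<comment> \<open>\<open>iso\<close> only provides bijections between principal ideals; with
    injectivity these recover the order in both directions.\<close>
  have ord: "(E, E') \<in> K \<longleftrightarrow> f E \<subseteq> f E'" if E: "E \<in> under K F" and E': "E' \<in> under K F" for E E'
  proof
    assume "(E, E') \<in> K"
    then have "f E \<in> f ` under K E'" by (auto simp: under_def)
    then show "f E \<subseteq> f E'" using und [OF E'] by (auto simp: bij_betw_def)
  next
    assume "f E \<subseteq> f E'"
    moreover have "f E face_of unit_cube d" using bij E by (auto simp: bij_betw_def)
    ultimately have "f E \<in> f ` under K E'" using und [OF E'] by (auto simp: bij_betw_def)
    then obtain E'' where E'': "E'' \<in> under K E'" "f E = f E''" by blast
    have "E'' \<in> under K F" using E'' E' trans by (auto simp: under_def)
    then have "E'' = E" using inj E E'' by (auto simp: inj_on_def)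
    then show "(E, E') \<in> K" using E'' by (auto simp: under_def)
  qed
  have eF: "empty_face K \<in> under K F" using empty_face_le FF by (auto simp: under_def)
  have fe: "f (empty_face K) = {}"
  proof -
    have "{} \<in> f ` under K F" using bij by (auto simp: bij_betw_def)
    then obtain E where E: "E \<in> under K F" "f E = {}" by blast
    have "(empty_face K, E) \<in> K" using E empty_face_le in_Field by (auto simp: under_def)
    then show ?thesis using ord [OF eF E(1)] E by simp
  qed
  have set: "{E \<in> faces. (E, F) \<in> K} = under K F - {empty_face K}"
    using in_Field by (auto simp: nonempty_faces_def under_def)
  have "bij_betw f (under K F - {empty_face K}) ({T. T face_of unit_cube d} - {f (empty_face K)})"
    unfolding bij_betw_def
  proof
    show "inj_on f (under K F - {empty_face K})" using inj by (rule inj_on_subset) auto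
    show "f ` (under K F - {empty_face K}) = {T. T face_of unit_cube d} - {f (empty_face K)}"
      using inj_on_image_set_diff [OF inj, of "under K F" "{empty_face K}"] eF bij
      by (auto simp: bij_betw_def)
  qed
  then have bij2: "bij_betw f {E \<in> faces. (E, F) \<in> K} {T. T face_of unit_cube d \<and> T \<noteq> {}}"
    unfolding set fe by (simp add: set_diff_eq)
  let ?g = "the_inv_into {c. dom c \<subseteq> {..<d}} (cube_face d)"
  have bg: "bij_betw ?g {T. T face_of unit_cube d \<and> T \<noteq> {}} {c. dom c \<subseteq> {..<d}}"
    by (rule bij_betw_the_inv_into [OF bij_betw_cube_face])
  have b\<phi>: "bij_betw (?g \<circ> f) {E \<in> faces. (E, F) \<in> K} {c. dom c \<subseteq> {..<d}}"
    by (rule bij_betw_trans [OF bij2 bg])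
  have cf: "cube_face d ((?g \<circ> f) E) = f E" and dm: "dom ((?g \<circ> f) E) \<subseteq> {..<d}"
    if E: "E \<in> faces" "(E, F) \<in> K" for E
  proof -
    have "f E \<in> {T. T face_of unit_cube d \<and> T \<noteq> {}}"
      using bij_betwE [OF bij2] E by blast
    then show "cube_face d ((?g \<circ> f) E) = f E"
      unfolding comp_apply by (rule f_the_inv_into_f_bij_betw [OF bij_betw_cube_face])
    show "dom ((?g \<circ> f) E) \<subseteq> {..<d}" using bij_betwE [OF b\<phi>] E by blast
  qed
  have "(E, E') \<in> K \<longleftrightarrow> (?g \<circ> f) E' \<subseteq>\<^sub>m (?g \<circ> f) E"
    if E: "E \<in> faces" "(E, F) \<in> K" and E': "E' \<in> faces" "(E', F) \<in> K" for E E'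
  proof -
    have "(E, E') \<in> K \<longleftrightarrow> f E \<subseteq> f E'" using ord E E' by (auto simp: under_def)
    also have "\<dots> \<longleftrightarrow> cube_face d ((?g \<circ> f) E) \<subseteq> cube_face d ((?g \<circ> f) E')"
      using cf [OF E] cf [OF E'] by simp
    also have "\<dots> \<longleftrightarrow> (?g \<circ> f) E' \<subseteq>\<^sub>m (?g \<circ> f) E" by (rule cube_face_mono_iff [OF dm [OF E] dm [OF E']])
    finally show "(E, E') \<in> K \<longleftrightarrow> (?g \<circ> f) E' \<subseteq>\<^sub>m (?g \<circ> f) E" .
  qed
  then have "interval_chart F d (?g \<circ> f)" unfolding interval_chart_def using b\<phi> by blast
  then show ?thesis by blast
qed

text \<open>The count 3^d determines d. This gives the definite description in
  \<open>face_dim\<close> its meaning and lets dimensions be computed by counting.\<close>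

lemma is_cube_card:
  assumes F: "F \<in> faces" and d: "is_cube d (Restr K (under K F))"
  shows "card {E \<in> faces. (E, F) \<in> K} = 3 ^ d"
proof -
  obtain \<phi> where \<phi>: "interval_chart F d \<phi>" using interval_chart_exists [OF F d] by blast
  from interval_chartD(1) [OF \<phi>] have "card {E \<in> faces. (E, F) \<in> K} = card {c :: nat \<rightharpoonup> bool. dom c \<subseteq> {..<d}}"
    by (rule bij_betw_same_card)
  also have "\<dots> = 3 ^ d" using card_partial_maps_extending [of "{..<d}" Map.empty] by simp
  finally show ?thesis .
qed

lemma face_dim_eqI:
  assumes F: "F \<in> faces" and d: "card {E \<in> faces. (E, F) \<in> K} = 3 ^ d"
  shows "face_dim K F = int d"
proof -
  have uniq: "e = d" if "is_cube e (Restr K (under K F))" for e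
    using is_cube_card [OF F that] d by simp
  obtain e where e: "is_cube e (Restr K (under K F))"
    using cubical F by (auto simp: cubical_complex_def)
  then have "(THE d. is_cube d (Restr K (under K F))) = d"
    using uniq by (intro the_equality) auto
  then show ?thesis using F by (simp add: face_dim_def nonempty_faces_def)
qed

lemma face_dim_card:
  assumes "F \<in> faces"
  shows "card {E \<in> faces. (E, F) \<in> K} = 3 ^ dim F" "face_dim K F = int (dim F)"
proof -
  obtain e where e: "is_cube e (Restr K (under K F))"
    using cubical assms by (auto simp: cubical_complex_def)
  have "card {E \<in> faces. (E, F) \<in> K} = 3 ^ e" by (rule is_cube_card [OF assms e])
  moreover from face_dim_eqI [OF assms this] have "face_dim K F = int e" .
  ultimately show "card {E \<in> faces. (E, F) \<in> K} = 3 ^ dim F" "face_dim K F = int (dim F)" by simp_all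
qed

lemma face_dim_nonneg: "F \<in> faces \<Longrightarrow> 0 \<le> face_dim K F"
  using face_dim_card(2) by (metis of_nat_0_le_iff)

lemma chart:
  assumes F: "F \<in> faces"
  obtains \<phi> where "interval_chart F (dim F) \<phi>"
proof -
  obtain e where e: "is_cube e (Restr K (under K F))"
    using cubical F by (auto simp: cubical_complex_def)
  have "e = dim F" using face_dim_eqI [OF F is_cube_card [OF F e]] by simp
  then show thesis using interval_chart_exists [OF F e] that by blast
qed

text \<open>The nonempty faces below E are the partial maps extending \<open>\<phi> E\<close>; their
  number is 3 to the power of dim F minus the number of fixed coordinates.\<close>

lemma interval_chart_dim:
  assumes c: "interval_chart F (dim F) \<phi>" and E: "E \<in> faces" "(E, F) \<in> K"
  shows "dim E + card (dom (\<phi> E)) = dim F"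
proof -
  note \<phi> = interval_chartD(1) [OF c] and ord = interval_chartD(2) [OF c]
  have dE: "dom (\<phi> E) \<subseteq> {..<dim F}" using bij_betwE [OF \<phi>] E by blast
  have "bij_betw \<phi> {D \<in> faces. (D, E) \<in> K} {c. dom c \<subseteq> {..<dim F} \<and> \<phi> E \<subseteq>\<^sub>m c}"
    unfolding bij_betw_def
  proof
    have sub: "{D \<in> faces. (D, E) \<in> K} \<subseteq> {D \<in> faces. (D, F) \<in> K}" using trans E by blast
    show "inj_on \<phi> {D \<in> faces. (D, E) \<in> K}"
      using \<phi> sub by (auto simp: bij_betw_def intro: inj_on_subset)
    show "\<phi> ` {D \<in> faces. (D, E) \<in> K} = {c. dom c \<subseteq> {..<dim F} \<and> \<phi> E \<subseteq>\<^sub>m c}"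
    proof (intro equalityI subsetI)
      fix c assume "c \<in> \<phi> ` {D \<in> faces. (D, E) \<in> K}"
      then obtain D where D: "D \<in> faces" "(D, E) \<in> K" "c = \<phi> D" by blast
      then have "(D, F) \<in> K" using E trans by blast
      then show "c \<in> {c. dom c \<subseteq> {..<dim F} \<and> \<phi> E \<subseteq>\<^sub>m c}"
        using ord D E bij_betwE [OF \<phi>] by blast
    next
      fix c assume c: "c \<in> {c. dom c \<subseteq> {..<dim F} \<and> \<phi> E \<subseteq>\<^sub>m c}"
      then have "c \<in> \<phi> ` {E \<in> faces. (E, F) \<in> K}" using \<phi> by (auto simp: bij_betw_def)
      then obtain D where D: "D \<in> faces" "(D, F) \<in> K" "c = \<phi> D" by blast
      then show "c \<in> \<phi> ` {D \<in> faces. (D, E) \<in> K}" using ord E c by blast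
    qed
  qed
  then have "card {D \<in> faces. (D, E) \<in> K} = card {c. dom c \<subseteq> {..<dim F} \<and> \<phi> E \<subseteq>\<^sub>m c}"
    by (rule bij_betw_same_card)
  also have "\<dots> = 3 ^ (dim F - card (dom (\<phi> E)))"
    using card_partial_maps_extending [OF _ dE] by simp
  finally have "face_dim K E = int (dim F - card (dom (\<phi> E)))"
    using face_dim_eqI E by blast
  then have "dim E = dim F - card (dom (\<phi> E))" by (metis nat_int)
  moreover have "card (dom (\<phi> E)) \<le> dim F" using card_mono [OF _ dE] by simp
  ultimately show ?thesis by linarith
qed

text \<open>In a chart for F, the face F has codimension 0 and so is the empty map; by injectivity E
  then has a fixed coordinate.\<close>

lemma dim_strict_mono:
  assumes "E \<in> faces" "(E, F) \<in> K" "E \<noteq> F"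
  shows "dim E < dim F"
proof -
  have F: "F \<in> faces" using faces_up assms by blast
  then have FF: "(F, F) \<in> K" using refl faces_Field by blast
  obtain \<phi> where c: "interval_chart F (dim F) \<phi>" by (rule chart [OF F])
  note \<phi> = interval_chartD(1) [OF c] and ord = interval_chartD(2) [OF c] and d = interval_chart_dim [OF c]
  have "finite (dom (\<phi> E))" "finite (dom (\<phi> F))"
    using bij_betwE [OF \<phi>] assms F FF finite_subset [OF _ finite_lessThan] by blast+
  moreover have "card (dom (\<phi> F)) = 0" using d [OF F FF] by simp
  ultimately have "\<phi> F = Map.empty" by simp
  moreover have "\<phi> E \<noteq> \<phi> F" using \<phi> assms F FF unfolding bij_betw_def inj_on_def by blast
  ultimately have "card (dom (\<phi> E)) \<noteq> 0" using \<open>finite (dom (\<phi> E))\<close> by simp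
  then show ?thesis using d [OF assms(1,2)] by linarith
qed

lemma dim_mono: "E \<in> faces \<Longrightarrow> (E, F) \<in> K \<Longrightarrow> dim E \<le> dim F"
  using dim_strict_mono by (metis order_refl less_imp_le)

lemma facet_exists:
  assumes F: "F \<in> faces" and "dim F = Suc n"
  obtains E where "E \<in> faces" "(E, F) \<in> K" "dim E = n"
proof -
  obtain \<phi> where c: "interval_chart F (dim F) \<phi>" by (rule chart [OF F])
  note \<phi> = interval_chartD(1) [OF c] and ord = interval_chartD(2) [OF c] and d = interval_chart_dim [OF c]
  have "[0 \<mapsto> True] \<in> {c. dom c \<subseteq> {..<dim F}}" using assms by simp
  then have "[0 \<mapsto> True] \<in> \<phi> ` {E \<in> faces. (E, F) \<in> K}" using \<phi> by (simp add: bij_betw_def)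
  then obtain E where E: "[0 \<mapsto> True] = \<phi> E" "E \<in> {E \<in> faces. (E, F) \<in> K}" by (rule imageE)
  then have "dim E + 1 = dim F" using d [of E] by (simp flip: E(1))
  then show thesis using that [of E] E assms by simp
qed

text \<open>Used with (a, b) = (-1, 1) for the Euler characteristic of a cube, (2, -1) for the
  alternating sum of 2^dim, and (2x, 1-x) for the short cubical h-polynomial of a cube.\<close>

lemma sum_faces_below:
  fixes a b :: "'b::comm_semiring_1"
  assumes F: "F \<in> faces"
  shows "(\<Sum>E\<in>{E \<in> faces. (E, F) \<in> K}. a ^ dim E * b ^ (dim F - dim E)) = (a + 2 * b) ^ dim F"
proof -
  obtain \<phi> where c: "interval_chart F (dim F) \<phi>" by (rule chart [OF F])
  note \<phi> = interval_chartD(1) [OF c] and ord = interval_chartD(2) [OF c] and d = interval_chart_dim [OF c]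
  have "(a + 2 * b) ^ dim F =
      (\<Sum>c\<in>{c :: nat \<rightharpoonup> bool. dom c \<subseteq> {..<dim F}}. a ^ (dim F - card (dom c)) * b ^ card (dom c))"
    using sum_partial_maps [of "{..<dim F}" a b] by simp
  also have "\<dots> = (\<Sum>E\<in>{E \<in> faces. (E, F) \<in> K}. a ^ (dim F - card (dom (\<phi> E))) * b ^ card (dom (\<phi> E)))"
    by (rule sum.reindex_bij_betw [OF \<phi>, symmetric])
  also have "\<dots> = (\<Sum>E\<in>{E \<in> faces. (E, F) \<in> K}. a ^ dim E * b ^ (dim F - dim E))"
  proof (rule sum.cong)
    fix E assume "E \<in> {E \<in> faces. (E, F) \<in> K}"
    then have "dim F - card (dom (\<phi> E)) = dim E" "card (dom (\<phi> E)) = dim F - dim E" using d [of E] by auto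
    then show "a ^ (dim F - card (dom (\<phi> E))) * b ^ card (dom (\<phi> E)) = a ^ dim E * b ^ (dim F - dim E)" by simp
  qed auto
  finally show ?thesis by simp
qed

text \<open>In a chart for H the faces between G and H are the submaps of \<open>\<phi> G\<close>, a
  Boolean interval.\<close>

lemma sum_interval:
  fixes a b :: "'b::comm_semiring_1"
  assumes G: "G \<in> faces" "(G, H) \<in> K"
  shows "(\<Sum>F\<in>{F. (G, F) \<in> K \<and> (F, H) \<in> K}. a ^ (dim F - dim G) * b ^ (dim H - dim F)) = (a + b) ^ (dim H - dim G)"
proof -
  have H: "H \<in> faces" using faces_up G by blast
  obtain \<phi> where c: "interval_chart H (dim H) \<phi>" by (rule chart [OF H])
  note \<phi> = interval_chartD(1) [OF c] and ord = interval_chartD(2) [OF c] and d = interval_chart_dim [OF c]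
  have dG: "dom (\<phi> G) \<subseteq> {..<dim H}" using bij_betwE [OF \<phi>] G by blast
  have up: "F \<in> faces" if "(G, F) \<in> K" for F using that faces_up G by blast
  have b: "bij_betw \<phi> {F. (G, F) \<in> K \<and> (F, H) \<in> K} {c. c \<subseteq>\<^sub>m \<phi> G}"
    unfolding bij_betw_def
  proof
    have "{F. (G, F) \<in> K \<and> (F, H) \<in> K} \<subseteq> {E \<in> faces. (E, H) \<in> K}" using up by blast
    then show "inj_on \<phi> {F. (G, F) \<in> K \<and> (F, H) \<in> K}"
      using \<phi> by (auto simp: bij_betw_def intro: inj_on_subset)
    show "\<phi> ` {F. (G, F) \<in> K \<and> (F, H) \<in> K} = {c. c \<subseteq>\<^sub>m \<phi> G}"
    proof (intro equalityI subsetI)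
      fix c assume "c \<in> \<phi> ` {F. (G, F) \<in> K \<and> (F, H) \<in> K}"
      then show "c \<in> {c. c \<subseteq>\<^sub>m \<phi> G}" using ord G up by blast
    next
      fix c assume c: "c \<in> {c. c \<subseteq>\<^sub>m \<phi> G}"
      then have "c \<in> {c. dom c \<subseteq> {..<dim H}}" using dG map_le_implies_dom_le by fastforce
      then have "c \<in> \<phi> ` {E \<in> faces. (E, H) \<in> K}" using \<phi> by (simp add: bij_betw_def)
      then obtain F where F: "F \<in> faces" "(F, H) \<in> K" "c = \<phi> F" by blast
      then show "c \<in> \<phi> ` {F. (G, F) \<in> K \<and> (F, H) \<in> K}" using ord G c by blast
    qed
  qed
  have cG: "card (dom (\<phi> G)) = dim H - dim G" using d G by (metis add_diff_cancel_left')
  have "(a + b) ^ (dim H - dim G) =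
      (\<Sum>c\<in>{c. c \<subseteq>\<^sub>m \<phi> G}. a ^ (card (dom (\<phi> G)) - card (dom c)) * b ^ card (dom c))"
    unfolding cG [symmetric] by (rule sum_submaps [symmetric]) (rule finite_subset [OF dG finite_lessThan])
  also have "\<dots> = (\<Sum>F\<in>{F. (G, F) \<in> K \<and> (F, H) \<in> K}.
      a ^ (card (dom (\<phi> G)) - card (dom (\<phi> F))) * b ^ card (dom (\<phi> F)))"
    by (rule sum.reindex_bij_betw [OF b, symmetric])
  also have "\<dots> = (\<Sum>F\<in>{F. (G, F) \<in> K \<and> (F, H) \<in> K}. a ^ (dim F - dim G) * b ^ (dim H - dim F))"
  proof (rule sum.cong)
    fix F assume F: "F \<in> {F. (G, F) \<in> K \<and> (F, H) \<in> K}"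
    then have "dim F + card (dom (\<phi> F)) = dim H" using d up by blast
    moreover have "dim G \<le> dim F" using dim_mono F G by blast
    moreover have "x + c = h \<Longrightarrow> g \<le> x \<Longrightarrow> (h - g) - c = x - g \<and> c = h - x" for x c h g :: nat by auto
    ultimately have "card (dom (\<phi> G)) - card (dom (\<phi> F)) = dim F - dim G" "card (dom (\<phi> F)) = dim H - dim F"
      unfolding cG by blast+
    then show "a ^ (card (dom (\<phi> G)) - card (dom (\<phi> F))) * b ^ card (dom (\<phi> F)) =
        a ^ (dim F - dim G) * b ^ (dim H - dim F)" by simp
  qed auto
  finally show ?thesis by simp
qed

lemma sum_sign_faces_below:
  assumes "F \<in> faces"
  shows "(\<Sum>E\<in>{E \<in> faces. (E, F) \<in> K}. (- 1) ^ dim E) = (1::'b::comm_ring_1)"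
  using sum_faces_below [OF assms, of "- 1 :: 'b" 1] by simp

end

text \<open>An order ideal keeps the whole interval below each of its elements, so cubes, dimensions
  and the least element are those of K; greatest lower bounds lie below elements of A and hence in
  A.\<close>

lemma subcomplex_cubical:
  assumes K: "cubical_complex K" and A: "subcomplex K A"
  shows "cubical_complex (Restr K A)" "Field (Restr K A) = A" "empty_face (Restr K A) = empty_face K"
    "E \<in> A \<Longrightarrow> face_dim (Restr K A) E = face_dim K E"
proof -
  interpret cubical K by unfold_locales (rule K)
  have AF: "A \<subseteq> Field K" and down: "\<And>E F. F \<in> A \<Longrightarrow> (E, F) \<in> K \<Longrightarrow> E \<in> A" and "A \<noteq> {}"
    using A by (auto simp: subcomplex_def under_def)
  show F: "Field (Restr K A) = A"
  proof
    show "A \<subseteq> Field (Restr K A)"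
    proof
      fix x assume x: "x \<in> A"
      then have "(x, x) \<in> Restr K A" using refl AF by auto
      then show "x \<in> Field (Restr K A)" by (auto simp: Field_def)
    qed
  qed (auto simp: Field_def)
  have eA: "empty_face K \<in> A" using \<open>A \<noteq> {}\<close> down AF empty_face_le by blast
  have "empty_face (Restr K A) = (THE m. m = empty_face K)"
    unfolding empty_face_def [of "Restr K A"] F
  proof (rule arg_cong [where f = The], rule ext)
    fix m
    show "(m \<in> A \<and> (\<forall>F\<in>A. (m, F) \<in> Restr K A)) = (m = empty_face K)"
      using eA empty_face_le AF antisym by blast
  qed
  then show e: "empty_face (Restr K A) = empty_face K" by simp
  have und: "under (Restr K A) E = under K E" if "E \<in> A" for E
    using that down by (auto simp: under_def)
  have res: "Restr (Restr K A) (under (Restr K A) E) = Restr K (under K E)" if E: "E \<in> A" for E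
  proof -
    have "under K E \<subseteq> A" using E down by (auto simp: under_def)
    then show ?thesis unfolding und [OF E] by blast
  qed
  show "face_dim (Restr K A) E = face_dim K E" if "E \<in> A"
    using res [OF that] e by (simp add: face_dim_def)
  show "cubical_complex (Restr K A)"
    unfolding cubical_complex_def F
  proof (intro conjI)
    show "partial_order_on A (Restr K A)" using Partial_order_Restr [OF partial_order, of A] unfolding F .
    show "finite A" using AF finite_Field finite_subset by blast
    show "\<exists>m\<in>A. \<forall>F\<in>A. (m, F) \<in> Restr K A" using eA empty_face_le AF by blast
    show "\<forall>E\<in>nonempty_faces (Restr K A). \<exists>d. is_cube d (Restr (Restr K A) (under (Restr K A) E))"
    proof
      fix E assume "E \<in> nonempty_faces (Restr K A)"
      then have E: "E \<in> A" "E \<in> nonempty_faces K" using F e AF by (auto simp: nonempty_faces_def)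
      then show "\<exists>d. is_cube d (Restr (Restr K A) (under (Restr K A) E))"
        unfolding res [OF E(1)] using K by (auto simp: cubical_complex_def)
    qed
    show "\<forall>F\<in>A. \<forall>G\<in>A. \<exists>H. (H, F) \<in> Restr K A \<and> (H, G) \<in> Restr K A \<and>
        (\<forall>H'. (H', F) \<in> Restr K A \<and> (H', G) \<in> Restr K A \<longrightarrow> (H', H) \<in> Restr K A)"
    proof (intro ballI)
      fix F G assume FG: "F \<in> A" "G \<in> A"
      then obtain H where H: "(H, F) \<in> K" "(H, G) \<in> K"
        "\<forall>H'. (H', F) \<in> K \<and> (H', G) \<in> K \<longrightarrow> (H', H) \<in> K"
        using K AF unfolding cubical_complex_def by blast
      then have "H \<in> A" using down FG by blast
      then show "\<exists>H. (H, F) \<in> Restr K A \<and> (H, G) \<in> Restr K A \<and>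
        (\<forall>H'. (H', F) \<in> Restr K A \<and> (H', G) \<in> Restr K A \<longrightarrow> (H', H) \<in> Restr K A)"
        using H FG by blast
    qed
  qed
qed

section \<open>Euler characteristic of contractible simplicial complexes\<close>

definition finite_simplicial_complex :: "'a set set \<Rightarrow> bool" where
  "finite_simplicial_complex \<K> \<longleftrightarrow>
     finite \<K> \<and> (\<forall>\<sigma>\<in>\<K>. finite \<sigma>) \<and> (\<forall>\<sigma>\<in>\<K>. \<forall>\<tau>\<subseteq>\<sigma>. \<tau> \<in> \<K>)"

text \<open>The index is the dimension plus one. The empty simplex occupies degree 0, so the chain
  complex is augmented and its homology is reduced.\<close>

definition simplices_of_card :: "'a set set \<Rightarrow> nat \<Rightarrow> 'a set set" where
  "simplices_of_card \<K> n = {\<sigma> \<in> \<K>. card \<sigma> = n}"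

text \<open>A chain modulo 2 is the set of simplices with coefficient 1, and addition is
  \<open>sym_diff\<close>. The boundary lowers the cardinality from \<open>Suc n\<close> to
  \<open>n\<close>.\<close>

definition mod2_boundary :: "'a set set \<Rightarrow> nat \<Rightarrow> 'a set set \<Rightarrow> 'a set set" where
  "mod2_boundary \<K> n Z = {\<tau> \<in> simplices_of_card \<K> n. odd (card {\<sigma> \<in> Z. \<tau> \<subseteq> \<sigma>})}"

lemma odd_card_sym_diff:
  assumes "finite A" "finite B"
  shows "odd (card (sym_diff A B)) \<longleftrightarrow> odd (card A) \<noteq> odd (card B)"
proof -
  have "card A = card (A - B) + card (A \<inter> B)" "card B = card (B - A) + card (A \<inter> B)"
    using assms by (metis card_Int_Diff add.commute Int_commute)+
  moreover have "card (sym_diff A B) = card (A - B) + card (B - A)"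
    using assms by (intro card_Un_disjoint) auto
  ultimately show ?thesis by auto
qed

lemma mod2_boundary_sym_diff:
  assumes "finite A" "finite B"
  shows "mod2_boundary \<K> n (sym_diff A B) = sym_diff (mod2_boundary \<K> n A) (mod2_boundary \<K> n B)"
proof -
  have "{\<sigma> \<in> sym_diff A B. \<tau> \<subseteq> \<sigma>} = sym_diff {\<sigma> \<in> A. \<tau> \<subseteq> \<sigma>} {\<sigma> \<in> B. \<tau> \<subseteq> \<sigma>}" for \<tau>
    by auto
  then show ?thesis
    using assms by (auto simp: mod2_boundary_def odd_card_sym_diff)
qed

text \<open>Rank-nullity over the field with two elements, in terms of cardinalities: each nonempty
  fibre of g is a translate of the kernel.\<close>

lemma card_Pow_kernel_image:
  assumes "finite A"
    and hom: "\<And>X Y. X \<subseteq> A \<Longrightarrow> Y \<subseteq> A \<Longrightarrow> g (sym_diff X Y) = sym_diff (g X) (g Y)"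
  shows "2 ^ card A = card {X \<in> Pow A. g X = {}} * card (g ` Pow A)"
proof -
  have fib: "card {X \<in> Pow A. g X = b} = card {X \<in> Pow A. g X = {}}" if b: "b \<in> g ` Pow A" for b
  proof -
    obtain X0 where X0: "X0 \<subseteq> A" "g X0 = b" using b by auto
    have invol: "sym_diff (sym_diff X X0) X0 = X" for X by auto
    show ?thesis
    proof (rule bij_betw_same_card [of "\<lambda>X. sym_diff X X0"])
      show "bij_betw (\<lambda>X. sym_diff X X0) {X \<in> Pow A. g X = b} {X \<in> Pow A. g X = {}}"
        by (rule bij_betw_byWitness [where f' = "\<lambda>X. sym_diff X X0"])
          (use X0 hom in \<open>auto simp: invol image_subset_iff\<close>)
    qed
  qed
  have "2 ^ card A = card (Pow A)" using assms(1) by (simp add: card_Pow)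
  also have "\<dots> = card (\<Union>b\<in>g ` Pow A. {X \<in> Pow A. g X = b})"
    by (rule arg_cong [where f = card]) auto
  also have "\<dots> = (\<Sum>b\<in>g ` Pow A. card {X \<in> Pow A. g X = b})"
    using assms(1) by (intro card_UN_disjoint) auto
  also have "\<dots> = (\<Sum>b\<in>g ` Pow A. card {X \<in> Pow A. g X = {}})"
    by (rule sum.cong) (use fib in auto)
  finally show ?thesis by simp
qed

text \<open>Let b n be the number of boundaries in degree n. Since cycles are boundaries, the number
  of chains in degree n+1 is b (n+1) times b n, so the alternating sum of binary logarithms
  telescopes.\<close>

lemma mod2_acyclic_imp_Euler_char:
  assumes \<K>: "finite_simplicial_complex \<K>"
    and nontriv: "{} \<in> \<K>" "{v} \<in> \<K>"
    and acyclic: "\<And>n Z. Z \<subseteq> simplices_of_card \<K> (Suc n) \<Longrightarrow> mod2_boundary \<K> n Z = {} \<Longrightarrow>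
       \<exists>W \<subseteq> simplices_of_card \<K> (Suc (Suc n)). mod2_boundary \<K> (Suc n) W = Z"
  shows "(\<Sum>\<sigma>\<in>\<K>. (- 1) ^ card \<sigma>) = (0::real)"
proof -
  let ?S = "simplices_of_card \<K>"
  let ?d = "mod2_boundary \<K>"
  define b where "b n = card (?d n ` Pow (?S (Suc n)))" for n
  have fin: "finite \<K>" "finite (?S n)" for n
    using \<K> by (auto simp: finite_simplicial_complex_def simplices_of_card_def)
  have dd: "?d n (?d (Suc n) W) = {}" if "W \<subseteq> ?S (Suc (Suc n))" for n W
  proof -
    have finW: "finite W" using that fin finite_subset by blast
    have "even (card {\<sigma> \<in> ?d (Suc n) W. \<tau> \<subseteq> \<sigma>})" if \<tau>: "\<tau> \<in> ?S n" for \<tau>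
    proof -
      \<comment> \<open>The boundary of a boundary vanishes because a face with two vertices fewer
        lies in exactly two intermediate faces, obtained by adding back either missing
        vertex.\<close>
      let ?P = "\<lambda>\<omega>. {\<sigma> \<in> ?S (Suc n). \<tau> \<subseteq> \<sigma> \<and> \<sigma> \<subseteq> \<omega>}"
      have two: "even (card (?P \<omega>))" if \<omega>: "\<omega> \<in> W" for \<omega>
      proof (cases "\<tau> \<subseteq> \<omega>")
        case True
        have \<omega>': "\<omega> \<in> \<K>" "card \<omega> = Suc (Suc n)" "finite \<omega>" "finite \<tau>" "card \<tau> = n"
          using \<omega> \<open>W \<subseteq> _\<close> \<tau> \<K> by (auto simp: simplices_of_card_def finite_simplicial_complex_def)
        have "card (\<omega> - \<tau>) = 2" using True \<omega>' by (simp add: card_Diff_subset)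
        have "?P \<omega> = (\<lambda>x. insert x \<tau>) ` (\<omega> - \<tau>)"
        proof (intro equalityI subsetI)
          fix \<sigma> assume "\<sigma> \<in> ?P \<omega>"
          then have \<sigma>: "card \<sigma> = Suc n" "\<tau> \<subseteq> \<sigma>" "\<sigma> \<subseteq> \<omega>" by (auto simp: simplices_of_card_def)
          have "card (\<sigma> - \<tau>) = 1" using \<sigma> \<omega>' by (simp add: card_Diff_subset)
          then obtain x where "\<sigma> - \<tau> = {x}" by (meson card_1_singletonE)
          then show "\<sigma> \<in> (\<lambda>x. insert x \<tau>) ` (\<omega> - \<tau>)" using \<sigma> by auto
        next
          fix \<sigma> assume "\<sigma> \<in> (\<lambda>x. insert x \<tau>) ` (\<omega> - \<tau>)"
          then obtain x where x: "x \<in> \<omega>" "x \<notin> \<tau>" "\<sigma> = insert x \<tau>" by auto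
          then have "\<sigma> \<in> \<K>" using \<K> \<omega>' True by (metis finite_simplicial_complex_def insert_subset)
          then show "\<sigma> \<in> ?P \<omega>" using x \<omega>' True by (auto simp: simplices_of_card_def)
        qed
        moreover have "inj_on (\<lambda>x. insert x \<tau>) (\<omega> - \<tau>)" by (auto simp: inj_on_def)
        ultimately show ?thesis using \<open>card (\<omega> - \<tau>) = 2\<close> by (simp add: card_image)
      next
        case False
        then have "?P \<omega> = {}" by auto
        then show ?thesis by (metis card.empty even_zero)
      qed
      have "even (card {\<sigma> \<in> ?d (Suc n) W. \<tau> \<subseteq> \<sigma>}) \<longleftrightarrow>
          even (\<Sum>\<sigma>\<in>{\<sigma> \<in> ?S (Suc n). \<tau> \<subseteq> \<sigma>}. card {\<omega> \<in> W. \<sigma> \<subseteq> \<omega>})"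
      proof -
        have "{\<sigma> \<in> ?d (Suc n) W. \<tau> \<subseteq> \<sigma>} = {\<sigma> \<in> {\<sigma> \<in> ?S (Suc n). \<tau> \<subseteq> \<sigma>}. odd (card {\<omega> \<in> W. \<sigma> \<subseteq> \<omega>})}"
          by (auto simp: mod2_boundary_def)
        then show ?thesis using fin by (simp add: even_sum_iff)
      qed
      also have "(\<Sum>\<sigma>\<in>{\<sigma> \<in> ?S (Suc n). \<tau> \<subseteq> \<sigma>}. card {\<omega> \<in> W. \<sigma> \<subseteq> \<omega>}) = (\<Sum>\<omega>\<in>W. card (?P \<omega>))"
        using sum_multicount_gen [of "{\<sigma> \<in> ?S (Suc n). \<tau> \<subseteq> \<sigma>}" W "\<lambda>\<sigma> \<omega>. \<sigma> \<subseteq> \<omega>" "\<lambda>\<omega>. card (?P \<omega>)"]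
          fin finW by (simp add: conj_assoc)
      finally show ?thesis using two by (simp add: dvd_sum)
    qed
    then show ?thesis by (auto simp: mod2_boundary_def)
  qed
  have ker: "{X \<in> Pow (?S (Suc n)). ?d n X = {}} = ?d (Suc n) ` Pow (?S (Suc (Suc n)))" for n
  proof (intro equalityI subsetI)
    fix X assume "X \<in> {X \<in> Pow (?S (Suc n)). ?d n X = {}}"
    then show "X \<in> ?d (Suc n) ` Pow (?S (Suc (Suc n)))"
      using acyclic [of X n] by auto
  next
    fix X assume "X \<in> ?d (Suc n) ` Pow (?S (Suc (Suc n)))"
    then show "X \<in> {X \<in> Pow (?S (Suc n)). ?d n X = {}}"
      using dd by (auto simp: mod2_boundary_def)
  qed
  have step: "2 ^ card (?S (Suc n)) = b (Suc n) * b n" for n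
    unfolding b_def ker [symmetric]
    by (rule card_Pow_kernel_image) (auto intro!: mod2_boundary_sym_diff fin intro: finite_subset [OF _ fin(2)])
  have bpos: "b n > 0" for n using step [of n] by (metis gr0I mult_0_right power_not_zero zero_neq_numeral)
  have S0: "?S 0 = {{}}"
    using nontriv \<K> by (auto simp: simplices_of_card_def finite_simplicial_complex_def)
  \<comment> \<open>The vertex \<open>v\<close> has the empty simplex as boundary, so both chains in
    degree 0 are boundaries. This starts the telescoping.\<close>
  have "?d 0 ` Pow (?S (Suc 0)) = {{}, {{}}}"
  proof -
    have "?d 0 X \<subseteq> {{}}" for X using S0 by (auto simp: mod2_boundary_def)
    moreover have "?d 0 {{v}} = {{}}"
    proof -
      have "{\<sigma> \<in> {{v}}. {} \<subseteq> \<sigma>} = {{v}}" by auto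
      then show ?thesis unfolding mod2_boundary_def S0 by auto
    qed
    moreover have "?d 0 {} = {}" by (simp add: mod2_boundary_def)
    moreover have "{{v}} \<in> Pow (?S (Suc 0))" using nontriv by (auto simp: simplices_of_card_def)
    ultimately have "?d 0 {} \<in> ?d 0 ` Pow (?S (Suc 0))" "?d 0 {{v}} \<in> ?d 0 ` Pow (?S (Suc 0))"
      by blast+
    then have "{{}, {{}}} \<subseteq> ?d 0 ` Pow (?S (Suc 0))"
      using \<open>?d 0 {{v}} = {{}}\<close> \<open>?d 0 {} = {}\<close> by simp
    moreover have "?d 0 ` Pow (?S (Suc 0)) \<subseteq> {{}, {{}}}"
      using \<open>\<And>X. ?d 0 X \<subseteq> {{}}\<close> by (metis (no_types, lifting) image_subsetI insert_iff subset_singleton_iff)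
    ultimately show ?thesis by (rule subset_antisym [rotated])
  qed
  then have b0: "b 0 = 2" by (simp add: b_def)
  define \<beta> where "\<beta> n = log 2 (real (b n))" for n
  have f: "real (card (?S (Suc n))) = \<beta> (Suc n) + \<beta> n" for n
  proof -
    have "log 2 (2 ^ card (?S (Suc n))) = log 2 (real (b (Suc n)) * real (b n))"
      using step [of n] by (metis of_nat_mult of_nat_numeral of_nat_power)
    then show ?thesis using bpos [of n] bpos [of "Suc n"]
      by (simp add: \<beta>_def log_mult log_nat_power)
  qed
  have tele: "(\<Sum>k\<le>n. (- 1) ^ k * real (card (?S k))) = (- 1) ^ n * \<beta> n" for n
  proof (induction n)
    case 0
    then show ?case by (simp add: S0 \<beta>_def b0)
  next
    case (Suc n)
    then show ?case by (simp add: f algebra_simps)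
  qed
  define N where "N = Max (card ` \<K>)"
  have N: "card \<sigma> \<le> N" if "\<sigma> \<in> \<K>" for \<sigma> using that fin by (simp add: N_def)
  \<comment> \<open>Above the largest cardinality there are no simplices, so \<open>b N\<close> is 1
    and the remainder of the telescoping sum vanishes.\<close>
  have "?S (Suc N) = {}" "?S (Suc (Suc N)) = {}" using N by (force simp: simplices_of_card_def)+
  then have "b (Suc N) * b N = 1" "b (Suc (Suc N)) * b (Suc N) = 1"
    using step [of N] step [of "Suc N"] by auto
  then have "\<beta> N = 0" by (simp add: \<beta>_def)
  have "(\<Sum>\<sigma>\<in>\<K>. (- 1) ^ card \<sigma>) = (\<Sum>k\<le>N. \<Sum>\<sigma>\<in>{\<sigma> \<in> \<K>. card \<sigma> = k}. (- 1) ^ card \<sigma> :: real)"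
    using N fin by (intro sum.group [symmetric]) auto
  also have "\<dots> = (\<Sum>k\<le>N. (- 1) ^ k * real (card (?S k)))"
    by (rule sum.cong) (auto simp: simplices_of_card_def)
  finally show ?thesis using tele [of N] \<open>\<beta> N = 0\<close> by simp
qed

text \<open>The barycentric coordinates of \<open>order_complex_space\<close> for an arbitrary
  simplicial complex. The sum runs over the support because the type of vertices may be
  infinite.\<close>

definition realization :: "'a set set \<Rightarrow> ('a \<Rightarrow> real) topology" where
  "realization \<K> = subtopology (powertop_real UNIV)
     {\<alpha>. (\<forall>v. 0 \<le> \<alpha> v) \<and> {v. \<alpha> v \<noteq> 0} \<in> \<K> \<and> sum \<alpha> {v. \<alpha> v \<noteq> 0} = 1}"

lemma topspace_realization:
  "topspace (realization \<K>) =
     {\<alpha>. (\<forall>v. 0 \<le> \<alpha> v) \<and> {v. \<alpha> v \<noteq> 0} \<in> \<K> \<and> sum \<alpha> {v. \<alpha> v \<noteq> 0} = 1}"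
  by (simp add: realization_def)

section \<open>Labelled singular simplices modulo 2\<close>

text \<open>The reason why labelling commutes with the boundary. If the labels are distinct, at most
  one omission gives \<open>\<tau>\<close>. If they are not and some omission gives
  \<open>\<tau>\<close>, exactly one pair of labels coincides, and omitting either member of the
  pair gives \<open>\<tau>\<close>: an even count.\<close>

lemma odd_card_omit_one_image:
  assumes A: "finite A" "card A = Suc n" and \<tau>: "card \<tau> = n"
  shows "odd (card {k \<in> A. u ` (A - {k}) = \<tau>}) \<longleftrightarrow> card (u ` A) = Suc n \<and> \<tau> \<subseteq> u ` A"
proof (cases "inj_on u A")
  case True
  have cA: "card (u ` A) = Suc n" using A True by (simp add: card_image)
  have im: "u ` (A - {k}) = u ` A - {u k}" if "k \<in> A" for k
    using inj_on_image_set_diff [OF True, of A "{k}"] that by auto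
  show ?thesis
  proof (cases "\<tau> \<subseteq> u ` A")
    case sub: True
    have "card (u ` A - \<tau>) = 1" using card_Diff_subset [OF finite_subset [OF sub] sub] A cA \<tau> by simp
    then obtain x where x: "u ` A - \<tau> = {x}" by (meson card_1_singletonE)
    then have "x \<in> u ` A" by blast
    then obtain k where k: "k \<in> A" "u k = x" by (metis imageE)
    have \<tau>': "\<tau> = u ` A - {x}" unfolding x [symmetric] using sub by blast
    have "{k \<in> A. u ` (A - {k}) = \<tau>} = {k}"
      using k \<tau>' im True by (auto simp: inj_on_def)
    then show ?thesis using sub cA by simp
  next
    case False
    then have "{k \<in> A. u ` (A - {k}) = \<tau>} = {}" by auto
    then show ?thesis using False by (simp only: card.empty) simp
  qed
next
  case False
  then have cA: "card (u ` A) \<noteq> Suc n" using A by (metis eq_card_imp_inj_on)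
  have "even (card {k \<in> A. u ` (A - {k}) = \<tau>})"
  proof (cases "\<exists>k\<in>A. u ` (A - {k}) = \<tau>")
    case True
    then obtain k where k: "k \<in> A" "u ` (A - {k}) = \<tau>" by blast
    have "inj_on u (A - {k})" using k A \<tau> by (intro eq_card_imp_inj_on) auto
    with False k have "u k \<in> u ` (A - {k})"
      by (metis inj_on_insert insert_Diff Diff_idemp)
    then obtain j where "j \<in> A - {k}" "u k = u j" by (metis imageE)
    then have j: "j \<in> A" "j \<noteq> k" "u j = u k" by auto
    have "{l \<in> A. u ` (A - {l}) = \<tau>} = {k, j}"
    proof (intro equalityI subsetI)
      fix l assume l: "l \<in> {l \<in> A. u ` (A - {l}) = \<tau>}"
      have inj: "inj_on u (A - {l})" using l A \<tau> by (intro eq_card_imp_inj_on) auto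
      show "l \<in> {k, j}"
      proof (rule ccontr)
        assume "l \<notin> {k, j}"
        then have "k \<in> A - {l}" "j \<in> A - {l}" using k j by auto
        then show False using inj j by (metis inj_on_def)
      qed
    next
      fix l assume "l \<in> {k, j}"
      moreover have "u ` (A - {j}) = u ` (A - {k})"
        using j k by (auto simp: image_iff) (metis Diff_iff singletonD)+
      ultimately show "l \<in> {l \<in> A. u ` (A - {l}) = \<tau>}" using k j by auto
    qed
    then show ?thesis using j by simp
  next
    case False
    then have "{k \<in> A. u ` (A - {k}) = \<tau>} = {}" by auto
    then show ?thesis by (simp only: card.empty even_zero)
  qed
  then show ?thesis using cA by simp
qed

text \<open>As a set, it has fewer than \<open>p + 1\<close> elements exactly when a label is
  repeated; this is how degenerate simplices are recognized.\<close>

definition vertex_labels :: "('b \<Rightarrow> 'a) \<Rightarrow> nat \<Rightarrow> ((nat \<Rightarrow> real) \<Rightarrow> 'b) \<Rightarrow> 'a set" where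
  "vertex_labels v p f = (\<lambda>j. v (f (\<lambda>i. if i = j then 1 else 0))) ` {..p}"

lemma vertex_labels_singular_face:
  assumes "k \<le> Suc p"
  shows "vertex_labels v p (singular_face (Suc p) k f) =
         (\<lambda>j. v (f (\<lambda>i. if i = j then 1 else 0))) ` ({..Suc p} - {k})"
proof -
  have "singular_face (Suc p) k f (\<lambda>i. if i = j then 1 else 0) =
      f (\<lambda>i. if i = (if j < k then j else Suc j) then 1 else 0)" if "j \<le> p" for j
  proof -
    have "simplical_face k (\<lambda>i. if i = j then 1 else (0::real)) =
        (\<lambda>i. if i = (if j < k then j else Suc j) then 1 else 0)"
      by (rule ext) (auto simp: simplical_face_def)
    then show ?thesis using that by (simp add: singular_face_def)
  qed
  then have "vertex_labels v p (singular_face (Suc p) k f) =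
      (\<lambda>j. v (f (\<lambda>i. if i = j then 1 else 0))) ` ((\<lambda>j. if j < k then j else Suc j) ` {..p})"
    unfolding vertex_labels_def image_image by (intro image_cong) auto
  also have "(\<lambda>j. if j < k then j else Suc j) ` {..p} = {..Suc p} - {k}"
  proof (intro equalityI subsetI)
    fix i assume i: "i \<in> {..Suc p} - {k}"
    show "i \<in> (\<lambda>j. if j < k then j else Suc j) ` {..p}"
    proof (cases "i < k")
      case True
      with assms show ?thesis by (intro image_eqI [of _ _ i]) auto
    next
      case False
      with i show ?thesis by (intro image_eqI [of _ _ "i - 1"]) auto
    qed
  qed auto
  finally show ?thesis .
qed

text \<open>
  The chain map to simplicial chains modulo 2: \<open>label_coeff v p c \<sigma>\<close> is the coefficient of the
  simplex \<open>\<sigma>\<close> in the image of \<open>c\<close>; only its parity is meaningful.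
\<close>

definition label_coeff :: "('b \<Rightarrow> 'a) \<Rightarrow> nat \<Rightarrow> 'b chain \<Rightarrow> 'a set \<Rightarrow> int" where
  "label_coeff v p c \<sigma> =
     (\<Sum>f\<in>Poly_Mapping.keys c. Poly_Mapping.lookup c f * of_bool (card \<sigma> = Suc p \<and> vertex_labels v p f = \<sigma>))"

lemma label_coeff_superset:
  assumes "finite S" "Poly_Mapping.keys c \<subseteq> S"
  shows "label_coeff v p c \<sigma> =
     (\<Sum>f\<in>S. Poly_Mapping.lookup c f * of_bool (card \<sigma> = Suc p \<and> vertex_labels v p f = \<sigma>))"
  unfolding label_coeff_def using assms
  by (intro sum.mono_neutral_left) (auto simp: in_keys_iff)

lemma label_coeff_diff:
  "label_coeff v p (a - b) \<sigma> = label_coeff v p a \<sigma> - label_coeff v p b \<sigma>"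
proof -
  let ?S = "Poly_Mapping.keys a \<union> Poly_Mapping.keys b"
  have "finite ?S" "Poly_Mapping.keys (a - b) \<subseteq> ?S" "Poly_Mapping.keys a \<subseteq> ?S" "Poly_Mapping.keys b \<subseteq> ?S"
    using keys_diff [of a b] by auto
  then show ?thesis
    by (simp add: label_coeff_superset [of ?S] lookup_minus left_diff_distrib sum_subtractf)
qed

lemma label_coeff_0 [simp]: "label_coeff v p 0 \<sigma> = 0"
  by (simp add: label_coeff_def)

lemma label_coeff_of [simp]:
  "label_coeff v p (frag_of f) \<sigma> = of_bool (card \<sigma> = Suc p \<and> vertex_labels v p f = \<sigma>)"
  by (simp add: label_coeff_def)

lemma label_coeff_eq_0:
  assumes "\<And>f. f \<in> Poly_Mapping.keys c \<Longrightarrow> card \<sigma> = Suc p \<Longrightarrow> vertex_labels v p f \<noteq> \<sigma>"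
  shows "label_coeff v p c \<sigma> = 0"
  unfolding label_coeff_def by (rule sum.neutral) (use assms in auto)

lemma additiveI_diff:
  fixes f :: "'a::ab_group_add \<Rightarrow> 'b::ab_group_add"
  assumes "\<And>x y. f (x - y) = f x - f y"
  shows "Modules.additive f"
proof
  have f0: "f 0 = 0" using assms [of 0 0] by simp
  have "f (- y) = - f y" for y using assms [of 0 y] f0 by simp
  then show "f (x + y) = f x + f y" for x y using assms [of x "- y"] by simp
qed

lemma additive_label_coeff: "Modules.additive (\<lambda>c. label_coeff v p c \<sigma>)"
  by (rule additiveI_diff) (rule label_coeff_diff)

text \<open>Labelling is a chain map modulo 2. On a single singular simplex signs do not affect
  parity and \<open>odd_card_omit_one_image\<close> compares the faces; additivity does the rest.
  Confining the labels to a finite V keeps the sum over cofaces finite.\<close>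

lemma label_coeff_boundary:
  assumes "finite V" and \<tau>: "\<tau> \<subseteq> V" "card \<tau> = Suc p"
    and c: "\<And>f. f \<in> Poly_Mapping.keys c \<Longrightarrow> vertex_labels v (Suc p) f \<subseteq> V"
  shows "even (label_coeff v p (chain_boundary (Suc p) c) \<tau>
               - (\<Sum>\<sigma>\<in>{\<sigma> \<in> Pow V. \<tau> \<subseteq> \<sigma>}. label_coeff v (Suc p) c \<sigma>))"
proof -
  have "Poly_Mapping.keys c \<subseteq> {f. vertex_labels v (Suc p) f \<subseteq> V}" using c by auto
  then show ?thesis
  proof (induction c rule: frag_induction)
    case zero
    then show ?case by simp
  next
    case (one f)
    interpret Modules.additive "\<lambda>c. label_coeff v p c \<tau>" by (rule additive_label_coeff)
    let ?u = "\<lambda>j. v (f (\<lambda>i. if i = j then 1 else 0))"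
    let ?B = "{k \<in> {..Suc p}. ?u ` ({..Suc p} - {k}) = \<tau>}"
    have sgn: "label_coeff v p (frag_cmul ((- 1) ^ k) c) \<tau> = (- 1) ^ k * label_coeff v p c \<tau>" for k c
      by (cases "even k") (simp_all add: minus)
    have "label_coeff v p (chain_boundary (Suc p) (frag_of f)) \<tau> =
        (\<Sum>k\<le>Suc p. (- 1) ^ k * of_bool (?u ` ({..Suc p} - {k}) = \<tau>))"
      unfolding chain_boundary_of
      by (simp add: sum sgn vertex_labels_singular_face \<tau> del: sum.atMost_Suc)
    moreover have "even ((\<Sum>k\<le>Suc p. (- 1) ^ k * of_bool (?u ` ({..Suc p} - {k}) = \<tau>)) - int (card ?B))"
    proof -
      have "int (card ?B) = (\<Sum>k\<le>Suc p. of_bool (?u ` ({..Suc p} - {k}) = \<tau>))"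
        by (simp add: sum.If_cases of_bool_def Int_def conj_commute del: sum.atMost_Suc)
      then have "(\<Sum>k\<le>Suc p. (- 1) ^ k * of_bool (?u ` ({..Suc p} - {k}) = \<tau>)) - int (card ?B) =
          (\<Sum>k\<le>Suc p. ((- 1) ^ k - 1) * of_bool (?u ` ({..Suc p} - {k}) = \<tau>))"
        by (simp add: left_diff_distrib sum_subtractf del: sum.atMost_Suc)
      also have "even \<dots>" by (intro dvd_sum dvd_mult2) auto
      finally show ?thesis .
    qed
    moreover have "odd (card ?B) \<longleftrightarrow> card (?u ` {..Suc p}) = Suc (Suc p) \<and> \<tau> \<subseteq> ?u ` {..Suc p}"
      by (rule odd_card_omit_one_image) (use \<tau> in auto)
    moreover have "(\<Sum>\<sigma>\<in>{\<sigma> \<in> Pow V. \<tau> \<subseteq> \<sigma>}. label_coeff v (Suc p) (frag_of f) \<sigma>) =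
        of_bool (card (?u ` {..Suc p}) = Suc (Suc p) \<and> \<tau> \<subseteq> ?u ` {..Suc p})"
    proof -
      have fin: "finite {\<sigma> \<in> Pow V. \<tau> \<subseteq> \<sigma>}" using assms(1) by simp
      have "(\<Sum>\<sigma>\<in>{\<sigma> \<in> Pow V. \<tau> \<subseteq> \<sigma>}. label_coeff v (Suc p) (frag_of f) \<sigma>) =
         (\<Sum>\<sigma>\<in>{\<sigma> \<in> Pow V. \<tau> \<subseteq> \<sigma>}. if \<sigma> = ?u ` {..Suc p} then of_bool (card (?u ` {..Suc p}) = Suc (Suc p)) else 0)"
        by (intro sum.cong) (auto simp: vertex_labels_def)
      also have "\<dots> = of_bool (card (?u ` {..Suc p}) = Suc (Suc p) \<and> \<tau> \<subseteq> ?u ` {..Suc p})"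
        unfolding sum.delta [OF fin] using one by (auto simp: vertex_labels_def)
      finally show ?thesis .
    qed
    moreover have "even (x - int b) \<Longrightarrow> (odd b \<longleftrightarrow> P) \<Longrightarrow> even (x - of_bool P)" for x b P
      by (cases P) auto
    ultimately show ?case by (simp only:)
  next
    case (diff a b)
    have eq: "label_coeff v p (chain_boundary (Suc p) (a - b)) \<tau> -
          (\<Sum>\<sigma>\<in>{\<sigma> \<in> Pow V. \<tau> \<subseteq> \<sigma>}. label_coeff v (Suc p) (a - b) \<sigma>) =
      (label_coeff v p (chain_boundary (Suc p) a) \<tau> -
          (\<Sum>\<sigma>\<in>{\<sigma> \<in> Pow V. \<tau> \<subseteq> \<sigma>}. label_coeff v (Suc p) a \<sigma>)) -
      (label_coeff v p (chain_boundary (Suc p) b) \<tau> -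
          (\<Sum>\<sigma>\<in>{\<sigma> \<in> Pow V. \<tau> \<subseteq> \<sigma>}. label_coeff v (Suc p) b \<sigma>))"
      by (simp add: chain_boundary_diff label_coeff_diff sum_subtractf)
    show ?case unfolding eq by (rule dvd_diff [OF diff.IH])
  qed
qed

lemma singular_chain_iterated_subdivision:
  "singular_chain p X c \<Longrightarrow> singular_chain p X ((singular_subdivision p ^^ m) c)"
  by (induction m) (auto simp: singular_chain_singular_subdivision)

lemma chain_boundary_iterated_subdivision:
  "singular_chain p X c \<Longrightarrow>
   chain_boundary p ((singular_subdivision p ^^ m) c) =
   (singular_subdivision (p - Suc 0) ^^ m) (chain_boundary p c)"
  by (induction m)
    (auto simp: chain_boundary_singular_subdivision [OF singular_chain_iterated_subdivision])

lemma iterated_subdivision_zero: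
  "singular_chain 0 X c \<Longrightarrow> (singular_subdivision 0 ^^ m) c = c"
  by (induction m) (auto simp: singular_subdivision_zero)

lemma naturality_iterated_subdivision:
  "singular_chain p X c \<Longrightarrow>
   (singular_subdivision p ^^ m) (chain_map p g c) = chain_map p g ((singular_subdivision p ^^ m) c)"
  by (induction m)
    (auto simp: naturality_singular_subdivision [OF singular_chain_iterated_subdivision])

text \<open>A constant simplex of positive dimension repeats its only label.\<close>

lemma label_coeff_chain_map_const:
  "label_coeff v (Suc p) (chain_map (Suc p) (\<lambda>x. a) c) \<sigma> = 0"
  using subset_UNIV
proof (induction c rule: frag_induction)
  case (one f)
  have "vertex_labels v (Suc p) (simplex_map (Suc p) (\<lambda>x. a) f) = {v a}"
    by (auto simp: vertex_labels_def simplex_map_def)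
  then show ?case by auto
next
  case (diff a b)
  then show ?case by (simp add: chain_map_diff label_coeff_diff)
qed auto

text \<open>All simplices are ordered by restricting one list of all vertices. Omitting the k-th
  vertex then renumbers the others exactly as a singular face does, so that faces of affine
  simplices are again affine simplices.\<close>

lemma simplex_enumeration_exists:
  assumes "finite V"
  obtains en :: "'a set \<Rightarrow> nat \<Rightarrow> 'a" where
    "\<And>\<sigma>. \<sigma> \<subseteq> V \<Longrightarrow> bij_betw (en \<sigma>) {..<card \<sigma>} \<sigma>"
    "\<And>\<sigma> k j. \<sigma> \<subseteq> V \<Longrightarrow> k < card \<sigma> \<Longrightarrow> Suc j < card \<sigma> \<Longrightarrow>
       en (\<sigma> - {en \<sigma> k}) j = en \<sigma> (if j < k then j else Suc j)"
proof -
  obtain l where l: "set l = V" "distinct l" using assms finite_distinct_list by blast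
  define en where "en \<sigma> j = filter (\<lambda>x. x \<in> \<sigma>) l ! j" for \<sigma> :: "'a set" and j
  show thesis
  proof
    fix \<sigma> assume \<sigma>: "\<sigma> \<subseteq> V"
    let ?xs = "filter (\<lambda>x. x \<in> \<sigma>) l"
    have xs: "distinct ?xs" "set ?xs = \<sigma>" using l \<sigma> by auto
    then have len: "length ?xs = card \<sigma>" by (metis distinct_card)
    show "bij_betw (en \<sigma>) {..<card \<sigma>} \<sigma>"
      unfolding en_def len [symmetric] by (rule bij_betw_nth) (use xs in auto)
    fix k j assume k: "k < card \<sigma>" and j: "Suc j < card \<sigma>"
    have split: "?xs = take k ?xs @ ?xs ! k # drop (Suc k) ?xs"
      using k len by (metis id_take_nth_drop)
    have d: "distinct (take k ?xs @ ?xs ! k # drop (Suc k) ?xs)"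
      using xs split by metis
    have "filter (\<lambda>x. x \<in> \<sigma> - {?xs ! k}) l = filter (\<lambda>x. x \<noteq> ?xs ! k) ?xs"
      unfolding filter_filter by (rule filter_cong) auto
    also have "\<dots> = filter (\<lambda>x. x \<noteq> ?xs ! k) (take k ?xs @ ?xs ! k # drop (Suc k) ?xs)"
      using split by metis
    also have "\<dots> = take k ?xs @ drop (Suc k) ?xs"
    proof -
      have "filter (\<lambda>x. x \<noteq> y) (as @ y # bs) = as @ bs" if "distinct (as @ y # bs)" for as bs and y :: 'a
        using that by (auto intro!: filter_True arg_cong2 [of _ _ _ _ append])
      from this [OF d] show ?thesis .
    qed
    finally have "filter (\<lambda>x. x \<in> \<sigma> - {?xs ! k}) l ! j = (take k ?xs @ drop (Suc k) ?xs) ! j" by simp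
    also have "\<dots> = ?xs ! (if j < k then j else Suc j)"
      using k j len by (auto simp: nth_append)
    finally show "en (\<sigma> - {en \<sigma> k}) j = en \<sigma> (if j < k then j else Suc j)"
      unfolding en_def .
  qed
qed

lemma halve_even_chain:
  fixes c :: "'a \<Rightarrow>\<^sub>0 int"
  assumes "\<And>f. even (Poly_Mapping.lookup c f)"
  obtains y where "c = y + y" "Poly_Mapping.keys y \<subseteq> Poly_Mapping.keys c"
proof
  let ?y = "Poly_Mapping.map (\<lambda>x. x div 2) c"
  have lk: "Poly_Mapping.lookup ?y f = Poly_Mapping.lookup c f div 2" for f
    by (simp add: Poly_Mapping.map.rep_eq when_def)
  show "c = ?y + ?y"
    by (rule poly_mapping_eqI) (use assms in \<open>auto simp: lk lookup_add\<close>)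
  show "Poly_Mapping.keys ?y \<subseteq> Poly_Mapping.keys c"
    by (auto simp: in_keys_iff lk)
qed

text \<open>Ties are broken by choice. No continuity is asked of the labelling, since only its
  values at the vertices of singular simplices enter.\<close>

definition top_vertex :: "('a \<Rightarrow> real) \<Rightarrow> 'a" where
  "top_vertex \<alpha> = (SOME v. \<forall>w. \<alpha> w \<le> \<alpha> v)"

text \<open>The coordinates sum to 1 over the finitely many vertices, so the largest is at least the
  average. This bound dictates the mesh of the later subdivision.\<close>

lemma top_vertex:
  assumes \<K>: "finite_simplicial_complex \<K>" and \<alpha>: "\<alpha> \<in> topspace (realization \<K>)"
  shows "\<alpha> w \<le> \<alpha> (top_vertex \<alpha>)" "1 / real (card (\<Union>\<K>)) \<le> \<alpha> (top_vertex \<alpha>)"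
    "0 < \<alpha> (top_vertex \<alpha>)" "0 < card (\<Union>\<K>)"
proof -
  let ?S = "{v. \<alpha> v \<noteq> 0}"
  have *: "\<And>v. 0 \<le> \<alpha> v" "?S \<in> \<K>" "sum \<alpha> ?S = 1"
    using \<alpha> by (auto simp: topspace_realization)
  have fin: "finite ?S" "finite (\<Union>\<K>)" using *(2) \<K> by (auto simp: finite_simplicial_complex_def)
  have ne: "?S \<noteq> {}" using *(3) by (metis sum.empty zero_neq_one)
  have "Max (\<alpha> ` ?S) \<in> \<alpha> ` ?S" using fin ne by (intro Max_in) auto
  then obtain u where u: "u \<in> ?S" "\<alpha> u = Max (\<alpha> ` ?S)" by (metis imageE)
  have "\<forall>w. \<alpha> w \<le> \<alpha> u"
  proof
    fix w show "\<alpha> w \<le> \<alpha> u"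
    proof (cases "w \<in> ?S")
      case True
      then show ?thesis unfolding u(2) using fin by (intro Max_ge) auto
    next
      case False
      then show ?thesis using *(1) [of u] by simp
    qed
  qed
  then have "\<forall>w. \<alpha> w \<le> \<alpha> (top_vertex \<alpha>)"
    unfolding top_vertex_def by (rule someI [of "\<lambda>v. \<forall>w. \<alpha> w \<le> \<alpha> v"])
  then show le: "\<alpha> w \<le> \<alpha> (top_vertex \<alpha>)" for w by blast
  have sub: "?S \<subseteq> \<Union>\<K>" using *(2) by (rule Union_upper)
  have "\<Union>\<K> \<noteq> {}" using sub ne by (metis subset_empty)
  then show pos: "0 < card (\<Union>\<K>)" using fin by (simp add: card_gt_0_iff)
  have "1 = sum \<alpha> (\<Union>\<K>)"
    unfolding *(3) [symmetric] by (rule sum.mono_neutral_left) (use fin sub in auto)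
  also have "\<dots> \<le> (\<Sum>w\<in>\<Union>\<K>. \<alpha> (top_vertex \<alpha>))" by (intro sum_mono le)
  finally have "1 \<le> real (card (\<Union>\<K>)) * \<alpha> (top_vertex \<alpha>)" by simp
  then show "1 / real (card (\<Union>\<K>)) \<le> \<alpha> (top_vertex \<alpha>)"
    using pos by (simp add: divide_simps mult.commute)
  then show "0 < \<alpha> (top_vertex \<alpha>)" using pos
    by (meson divide_pos_pos less_le_trans of_nat_0_less_iff zero_less_one)
qed

lemma top_vertex_of_bool: "top_vertex (\<lambda>w. of_bool (w = x)) = x"
  unfolding top_vertex_def
proof (rule some_equality)
  fix v assume "\<forall>w. of_bool (w = x) \<le> (of_bool (v = x) :: real)"
  then have "of_bool (x = x) \<le> (of_bool (v = x) :: real)" by blast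
  then show "v = x" by (cases "v = x") auto
qed auto

lemma openin_coordinate_box:
  assumes "finite V"
  shows "openin (realization \<K>) {z \<in> topspace (realization \<K>). \<forall>w\<in>V. \<bar>z w - y w\<bar> < r}"
proof -
  let ?X = "realization \<K>"
  have "openin ?X {z \<in> topspace ?X. z w \<in> ball (y w) r}" for w
  proof (rule openin_continuous_map_preimage)
    show "continuous_map ?X euclideanreal (\<lambda>z. z w)"
      unfolding realization_def
      by (intro continuous_map_from_subtopology continuous_map_product_projection) auto
  qed auto
  then have "openin ?X (topspace ?X \<inter> (\<Inter>w\<in>V. {z \<in> topspace ?X. z w \<in> ball (y w) r}))"
    using assms by (cases "V = {}") (auto intro!: openin_Int openin_INT2)
  moreover have "topspace ?X \<inter> (\<Inter>w\<in>V. {z \<in> topspace ?X. z w \<in> ball (y w) r}) =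
      {z \<in> topspace ?X. \<forall>w\<in>V. \<bar>z w - y w\<bar> < r}"
    by (auto simp: dist_real_def abs_minus_commute)
  ultimately show ?thesis by simp
qed

text \<open>
  A label has coordinate at least \<open>1 / card (\<Union>\<K>)\<close> at the vertex it comes from, hence a positive coordinate
  at all vertices of a small simplex; so the labels lie in the support of a single point.
\<close>

lemma vertex_labels_small_in_complex:
  assumes \<K>: "finite_simplicial_complex \<K>" and y: "y \<in> topspace (realization \<K>)"
    and f: "f \<in> standard_simplex p \<rightarrow>
      {z \<in> topspace (realization \<K>). \<forall>w\<in>\<Union>\<K>. \<bar>z w - y w\<bar> < 1 / (2 * real (card (\<Union>\<K>)))}"
  shows "vertex_labels top_vertex p f \<in> \<K>"
proof -
  let ?e = "\<lambda>j::nat. \<lambda>i. if i = j then 1 else (0::real)"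
  have X: "f (?e j) \<in> topspace (realization \<K>)"
    and close: "\<And>w. w \<in> \<Union>\<K> \<Longrightarrow> \<bar>f (?e j) w - y w\<bar> < 1 / (2 * real (card (\<Union>\<K>)))"
    if "j \<le> p" for j
    using f that by (auto simp: Pi_iff)
  have sub: "{w. f (?e j) w \<noteq> 0} \<in> \<K>" if "j \<le> p" for j
    using X [OF that] by (auto simp: topspace_realization)
  have "f (?e 0) (top_vertex (f (?e j))) \<noteq> 0" if j: "j \<le> p" for j
  proof -
    let ?w = "top_vertex (f (?e j))"
    have "f (?e j) ?w \<noteq> 0" using top_vertex(3) [OF \<K> X [OF j]] by simp
    then have "?w \<in> \<Union>\<K>" using sub [OF j] by blast
    then have "\<bar>f (?e j) ?w - y ?w\<bar> < 1 / (2 * real (card (\<Union>\<K>)))"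
      "\<bar>f (?e 0) ?w - y ?w\<bar> < 1 / (2 * real (card (\<Union>\<K>)))"
      using close [of j ?w] close [of 0 ?w] j by auto
    moreover have "1 / real (card (\<Union>\<K>)) \<le> f (?e j) ?w" using top_vertex(2) [OF \<K> X [OF j]] .
    ultimately show ?thesis by (simp add: field_simps)
  qed
  then have "vertex_labels top_vertex p f \<subseteq> {w. f (?e 0) w \<noteq> 0}"
    by (auto simp: vertex_labels_def)
  then show ?thesis using sub [of 0] \<K> by (auto simp: finite_simplicial_complex_def)
qed

text \<open>The largest coordinate is positive, so a label lies in the support of its point. Hence
  the pieces of a subdivided simplex get their labels from that simplex.\<close>

lemma vertex_labels_subset:
  assumes \<K>: "finite_simplicial_complex \<K>"
    and f: "singular_simplex p (subtopology (realization \<K>) {\<alpha>. {v. \<alpha> v \<noteq> 0} \<subseteq> S}) f"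
  shows "vertex_labels top_vertex p f \<subseteq> S"
proof -
  let ?e = "\<lambda>j::nat. \<lambda>i. if i = j then 1 else (0::real)"
  have "top_vertex (f (?e j)) \<in> S" if "j \<le> p" for j
  proof -
    have "f (?e j) \<in> topspace (subtopology (realization \<K>) {\<alpha>. {v. \<alpha> v \<noteq> 0} \<subseteq> S})"
    proof -
      have "f \<in> standard_simplex p \<rightarrow> topspace (subtopology (realization \<K>) {\<alpha>. {v. \<alpha> v \<noteq> 0} \<subseteq> S})"
        using f unfolding singular_simplex_def
        by (metis continuous_map_funspace topspace_standard_simplex)
      moreover have "?e j \<in> standard_simplex p" using that by simp
      ultimately show ?thesis by (rule funcset_mem)
    qed
    then have *: "f (?e j) \<in> topspace (realization \<K>)" "{v. f (?e j) v \<noteq> 0} \<subseteq> S" by auto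
    then show ?thesis using top_vertex(3) [OF \<K> *(1)] by auto
  qed
  then show ?thesis by (auto simp: vertex_labels_def)
qed

section \<open>Contractible complexes are acyclic modulo 2\<close>

locale enumerated_complex =
  fixes \<K> :: "'a set set" and en :: "'a set \<Rightarrow> nat \<Rightarrow> 'a"
  assumes complex: "finite_simplicial_complex \<K>"
    and en_bij: "\<And>\<sigma>. \<sigma> \<subseteq> \<Union>\<K> \<Longrightarrow> bij_betw (en \<sigma>) {..<card \<sigma>} \<sigma>"
    and en_face: "\<And>\<sigma> k j. \<sigma> \<subseteq> \<Union>\<K> \<Longrightarrow> k < card \<sigma> \<Longrightarrow> Suc j < card \<sigma> \<Longrightarrow>
       en (\<sigma> - {en \<sigma> k}) j = en \<sigma> (if j < k then j else Suc j)"
begin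

definition affine_simplex :: "nat \<Rightarrow> 'a set \<Rightarrow> (nat \<Rightarrow> real) \<Rightarrow> 'a \<Rightarrow> real" where
  "affine_simplex p \<sigma> = oriented_simplex p (\<lambda>j w. of_bool (w = en \<sigma> j))"

abbreviation "X \<equiv> realization \<K>"

lemma finite_vertices: "finite (\<Union>\<K>)" "\<sigma> \<in> \<K> \<Longrightarrow> finite \<sigma>" "finite \<K>"
  using complex by (auto simp: finite_simplicial_complex_def)

lemma en_in: "\<sigma> \<in> \<K> \<Longrightarrow> k < card \<sigma> \<Longrightarrow> en \<sigma> k \<in> \<sigma>"
  using en_bij [of \<sigma>] by (auto simp: bij_betw_def)

lemma en_image: "\<sigma> \<in> \<K> \<Longrightarrow> en \<sigma> ` {..<card \<sigma>} = \<sigma>"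
  using en_bij [of \<sigma>] by (auto simp: bij_betw_def)

lemma face_in: "\<sigma> \<in> \<K> \<Longrightarrow> \<sigma> - A \<in> \<K>"
  using complex by (auto simp: finite_simplicial_complex_def)

text \<open>The target is cut down to the points supported in \<open>\<sigma>\<close>, so that after
  any subdivision all labels are known to lie in \<open>\<sigma>\<close>.\<close>

lemma singular_simplex_affine_simplex:
  assumes \<sigma>: "\<sigma> \<in> \<K>" "card \<sigma> = Suc p"
  shows "singular_simplex p (subtopology X {\<alpha>. {v. \<alpha> v \<noteq> 0} \<subseteq> \<sigma>}) (affine_simplex p \<sigma>)"
proof -
  let ?g = "\<lambda>x w. \<Sum>j\<le>p. of_bool (w = en \<sigma> j) * x j"
  have bij: "bij_betw (en \<sigma>) {..p} \<sigma>" using en_bij [of \<sigma>] \<sigma> by (auto simp: lessThan_Suc_atMost)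
  have "?g x \<in> {\<alpha>. (\<forall>v. 0 \<le> \<alpha> v) \<and> {v. \<alpha> v \<noteq> 0} \<in> \<K> \<and> sum \<alpha> {v. \<alpha> v \<noteq> 0} = 1} \<inter> {\<alpha>. {v. \<alpha> v \<noteq> 0} \<subseteq> \<sigma>}"
    if x: "x \<in> standard_simplex p" for x
  proof -
    have sub: "{v. ?g x v \<noteq> 0} \<subseteq> \<sigma>"
    proof
      fix v assume "v \<in> {v. ?g x v \<noteq> 0}"
      then obtain j where "j \<le> p" "v = en \<sigma> j"
        by (smt (verit) atMost_iff mem_Collect_eq mult_eq_0_iff of_bool_eq(1) sum.neutral)
      then show "v \<in> \<sigma>" using bij by (auto simp: bij_betw_def)
    qed
    have g: "?g x (en \<sigma> i) = x i" if "i \<le> p" for i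
    proof -
      have "?g x (en \<sigma> i) = (\<Sum>j\<le>p. if j = i then x j else 0)"
      proof (rule sum.cong)
        fix j assume "j \<in> {..p}"
        then have "en \<sigma> i = en \<sigma> j \<longleftrightarrow> j = i" using bij that by (auto simp: bij_betw_def inj_on_def)
        then show "of_bool (en \<sigma> i = en \<sigma> j) * x j = (if j = i then x j else 0)" by simp
      qed auto
      then show ?thesis using that by simp
    qed
    have "sum (?g x) {v. ?g x v \<noteq> 0} = sum (?g x) \<sigma>"
      by (rule sum.mono_neutral_left) (use sub finite_vertices \<sigma> in auto)
    also have "\<dots> = (\<Sum>i\<le>p. ?g x (en \<sigma> i))" by (rule sum.reindex_bij_betw [OF bij, symmetric])
    also have "\<dots> = (\<Sum>i\<le>p. x i)" by (rule sum.cong) (use g in auto)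
    also have "\<dots> = 1" using x by (simp add: standard_simplex_def)
    finally have "sum (?g x) {v. ?g x v \<noteq> 0} = 1" .
    moreover have "{v. ?g x v \<noteq> 0} \<in> \<K>"
      using sub \<sigma>(1) complex by (auto simp: finite_simplicial_complex_def)
    moreover have "0 \<le> ?g x v" for v using x by (intro sum_nonneg) (auto simp: standard_simplex_def)
    ultimately show ?thesis using sub by blast
  qed
  then have "simplicial_simplex p ({\<alpha>. (\<forall>v. 0 \<le> \<alpha> v) \<and> {v. \<alpha> v \<noteq> 0} \<in> \<K> \<and> sum \<alpha> {v. \<alpha> v \<noteq> 0} = 1} \<inter> {\<alpha>. {v. \<alpha> v \<noteq> 0} \<subseteq> \<sigma>})
     (affine_simplex p \<sigma>)"
    unfolding affine_simplex_def simplicial_simplex_oriented_simplex by (rule image_subsetI)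
  then show ?thesis
    using simplicial_imp_singular_simplex by (simp add: realization_def subtopology_subtopology)
qed

lemma singular_face_affine_simplex:
  assumes "\<sigma> \<in> \<K>" "card \<sigma> = Suc (Suc p)" "k \<le> Suc p"
  shows "singular_face (Suc p) k (affine_simplex (Suc p) \<sigma>) = affine_simplex p (\<sigma> - {en \<sigma> k})"
proof -
  have "en (\<sigma> - {en \<sigma> k}) j = en \<sigma> (if j < k then j else Suc j)" if "j \<le> p" for j
    by (rule en_face) (use assms that in auto)
  then show ?thesis
    using assms unfolding affine_simplex_def
    by (simp add: singular_face_oriented_simplex oriented_simplex_eq)
qed

lemma affine_simplex_inject:
  assumes "\<sigma> \<in> \<K>" "\<tau> \<in> \<K>" "card \<sigma> = Suc p" "card \<tau> = Suc p"
    and "affine_simplex p \<sigma> = affine_simplex p \<tau>"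
  shows "\<sigma> = \<tau>"
proof -
  have "en \<sigma> i = en \<tau> i" if "i \<le> p" for i
  proof -
    have "(\<lambda>w. of_bool (w = en \<sigma> i)) = (\<lambda>w. of_bool (w = en \<tau> i) :: real)"
      using assms(5) that unfolding affine_simplex_def oriented_simplex_eq by blast
    then have "of_bool (en \<sigma> i = en \<sigma> i) = (of_bool (en \<sigma> i = en \<tau> i) :: real)" by (rule fun_cong)
    then show ?thesis by (cases "en \<sigma> i = en \<tau> i") auto
  qed
  then have "en \<sigma> ` {..<card \<sigma>} = en \<tau> ` {..<card \<tau>}" using assms by (intro image_cong) auto
  then show ?thesis using en_image [OF assms(1)] en_image [OF assms(2)] by simp
qed

lemma chain_boundary_affine_simplex:
  assumes "\<sigma> \<in> \<K>" "card \<sigma> = Suc (Suc p)"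
  shows "chain_boundary (Suc p) (frag_of (affine_simplex (Suc p) \<sigma>)) =
    (\<Sum>k\<le>Suc p. frag_cmul ((- 1) ^ k) (frag_of (affine_simplex p (\<sigma> - {en \<sigma> k}))))"
  unfolding chain_boundary_of using singular_face_affine_simplex [OF assms]
  by (simp del: sum.atMost_Suc)

lemma inj_on_face:
  assumes "\<sigma> \<in> \<K>" "card \<sigma> = Suc p"
  shows "inj_on (\<lambda>k. \<sigma> - {en \<sigma> k}) {..p}"
proof
  fix i k assume ik: "i \<in> {..p}" "k \<in> {..p}" "\<sigma> - {en \<sigma> i} = \<sigma> - {en \<sigma> k}"
  then have "en \<sigma> i = en \<sigma> k" using en_in [of \<sigma>] assms by (metis (no_types, lifting) Diff_iff atMost_iff less_Suc_eq_le singletonD singletonI)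
  moreover have "inj_on (en \<sigma>) {..p}"
    using en_bij [of \<sigma>] assms by (auto simp: bij_betw_def lessThan_Suc_atMost)
  ultimately show "i = k" using ik by (auto simp: inj_on_def)
qed

abbreviation "subdivided_coeff m p c \<tau> \<equiv> label_coeff top_vertex p ((singular_subdivision p ^^ m) c) \<tau>"

lemma additive_subdivided_coeff: "Modules.additive (\<lambda>c. subdivided_coeff m p c \<tau>)"
  by (rule additiveI_diff) (simp add: singular_subdivision_power_diff label_coeff_diff)

lemma subdivided_coeff_sgn:
  "subdivided_coeff m p (frag_cmul ((- 1) ^ k) c) \<tau> = (- 1) ^ k * subdivided_coeff m p c \<tau>"
proof -
  interpret Modules.additive "\<lambda>c. subdivided_coeff m p c \<tau>" by (rule additive_subdivided_coeff)
  show ?thesis by (cases "even k") (simp_all add: minus)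
qed

text \<open>
  A chain map carrying every simplex to a chain supported on its faces is the identity modulo 2,
  because a \<open>p\<close>-simplex has no other face of dimension \<open>p\<close>.
\<close>

lemma odd_subdivided_coeff_affine_simplex:
  assumes "\<sigma> \<in> \<K>" "card \<sigma> = Suc p" "card \<tau> = Suc p"
  shows "odd (subdivided_coeff m p (frag_of (affine_simplex p \<sigma>)) \<tau>) \<longleftrightarrow> \<tau> = \<sigma>"
  using assms
proof (induction p arbitrary: \<sigma> \<tau>)
  case (0 \<sigma> \<tau>)
  have "singular_chain 0 (subtopology X {\<alpha>. {v. \<alpha> v \<noteq> 0} \<subseteq> \<sigma>}) (frag_of (affine_simplex 0 \<sigma>))"
    using singular_simplex_affine_simplex 0 by (simp add: singular_chain_of)
  then have "(singular_subdivision 0 ^^ m) (frag_of (affine_simplex 0 \<sigma>)) = frag_of (affine_simplex 0 \<sigma>)"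
    by (rule iterated_subdivision_zero)
  moreover have "affine_simplex 0 \<sigma> (\<lambda>i. if i = 0 then 1 else 0) = (\<lambda>w. of_bool (w = en \<sigma> 0))"
    by (rule ext) (auto simp: affine_simplex_def oriented_simplex_def)
  moreover have "\<sigma> = {en \<sigma> 0}" using en_image [of \<sigma>] 0 by auto
  ultimately show ?case using 0 by (auto simp: vertex_labels_def top_vertex_of_bool)
next
  case (Suc p \<sigma> \<tau>)
  let ?s = "affine_simplex (Suc p) \<sigma>"
  let ?c = "(singular_subdivision (Suc p) ^^ m) (frag_of ?s)"
  have sc: "singular_chain (Suc p) (subtopology X {\<alpha>. {v. \<alpha> v \<noteq> 0} \<subseteq> \<sigma>}) (frag_of ?s)"
    using singular_simplex_affine_simplex Suc.prems by (simp add: singular_chain_of)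
  have lab: "vertex_labels top_vertex (Suc p) f \<subseteq> \<sigma>" if "f \<in> Poly_Mapping.keys ?c" for f
    using singular_chain_iterated_subdivision [OF sc, of m] that
    by (intro vertex_labels_subset [OF complex]) (auto simp: singular_chain_def)
  have fin: "finite \<sigma>" using Suc.prems finite_vertices by blast
  show ?case
  proof (cases "\<tau> = \<sigma>")
    case False
    have "label_coeff top_vertex (Suc p) ?c \<tau> = 0"
    proof (rule label_coeff_eq_0)
      fix f assume f: "f \<in> Poly_Mapping.keys ?c"
      show "vertex_labels top_vertex (Suc p) f \<noteq> \<tau>"
        using lab [OF f] False Suc.prems fin by (metis card_subset_eq)
    qed
    then show ?thesis using False by simp
  next
    case True
    \<comment> \<open>The coefficient of \<open>\<sigma>\<close> is read off at one facet: of the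
      subsets of \<open>\<sigma>\<close> containing \<open>\<rho>\<close> only
      \<open>\<sigma>\<close> has enough vertices, so its parity is that of \<open>\<rho>\<close> in
      the boundary. By induction only the facet omitting \<open>en \<sigma> 0\<close> contributes
      there.\<close>
    define \<rho> where "\<rho> = \<sigma> - {en \<sigma> 0}"
    have e0: "en \<sigma> 0 \<in> \<sigma>" using en_in Suc.prems by simp
    have \<rho>: "\<rho> \<in> \<K>" "\<rho> \<subseteq> \<sigma>" "card \<rho> = Suc p"
      using face_in Suc.prems e0 fin by (auto simp: \<rho>_def)
    have "even (label_coeff top_vertex p (chain_boundary (Suc p) ?c) \<rho>
               - (\<Sum>\<omega>\<in>{\<omega> \<in> Pow \<sigma>. \<rho> \<subseteq> \<omega>}. label_coeff top_vertex (Suc p) ?c \<omega>))"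
      by (rule label_coeff_boundary) (use fin \<rho> lab in auto)
    moreover have "(\<Sum>\<omega>\<in>{\<omega> \<in> Pow \<sigma>. \<rho> \<subseteq> \<omega>}. label_coeff top_vertex (Suc p) ?c \<omega>) =
        label_coeff top_vertex (Suc p) ?c \<sigma>"
    proof -
      have "{\<omega> \<in> Pow \<sigma>. \<rho> \<subseteq> \<omega>} = {\<rho>, \<sigma>}" using e0 by (auto simp: \<rho>_def)
      moreover have "\<rho> \<noteq> \<sigma>" using \<rho> Suc.prems by auto
      moreover have "label_coeff top_vertex (Suc p) ?c \<rho> = 0"
        by (rule label_coeff_eq_0) (use \<rho> in auto)
      ultimately show ?thesis by simp
    qed
    moreover have "odd (label_coeff top_vertex p (chain_boundary (Suc p) ?c) \<rho>)"
    proof -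
      interpret Modules.additive "\<lambda>c. subdivided_coeff m p c \<rho>" by (rule additive_subdivided_coeff)
      have "label_coeff top_vertex p (chain_boundary (Suc p) ?c) \<rho> =
          subdivided_coeff m p (chain_boundary (Suc p) (frag_of ?s)) \<rho>"
        using chain_boundary_iterated_subdivision [OF sc] by simp
      also have "\<dots> = (\<Sum>k\<le>Suc p. (- 1) ^ k * subdivided_coeff m p (frag_of (affine_simplex p (\<sigma> - {en \<sigma> k}))) \<rho>)"
        using Suc.prems by (simp add: chain_boundary_affine_simplex sum subdivided_coeff_sgn del: sum.atMost_Suc)
      finally have eq: "label_coeff top_vertex p (chain_boundary (Suc p) ?c) \<rho> =
          (\<Sum>k\<le>Suc p. (- 1) ^ k * subdivided_coeff m p (frag_of (affine_simplex p (\<sigma> - {en \<sigma> k}))) \<rho>)" .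
      have odd: "odd ((- 1) ^ k * subdivided_coeff m p (frag_of (affine_simplex p (\<sigma> - {en \<sigma> k}))) \<rho>) \<longleftrightarrow> k = 0"
        if k: "k \<le> Suc p" for k
      proof -
        have "odd (subdivided_coeff m p (frag_of (affine_simplex p (\<sigma> - {en \<sigma> k}))) \<rho>) \<longleftrightarrow> \<rho> = \<sigma> - {en \<sigma> k}"
          by (rule Suc.IH) (use face_in Suc.prems \<rho> en_in [of \<sigma> k] k fin in auto)
        also have "\<dots> \<longleftrightarrow> k = 0"
          using inj_on_face [OF Suc.prems(1,2)] k unfolding \<rho>_def inj_on_def by (metis atMost_iff zero_le)
        finally show ?thesis by simp
      qed
      have "{k \<in> {..Suc p}. odd ((- 1) ^ k * subdivided_coeff m p (frag_of (affine_simplex p (\<sigma> - {en \<sigma> k}))) \<rho>)} = {0}"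
        using odd by (auto simp del: sum.atMost_Suc)
      then have "card {k \<in> {..Suc p}. odd ((- 1) ^ k * subdivided_coeff m p (frag_of (affine_simplex p (\<sigma> - {en \<sigma> k}))) \<rho>)} = 1"
        by simp
      then show ?thesis unfolding eq by (simp only: even_sum_iff finite_atMost odd_one not_False_eq_True)
    qed
    ultimately show ?thesis using True by simp
  qed
qed


text \<open>Distinct simplices have distinct affine parametrizations, so the coefficient at
  \<open>\<tau>\<close> is a signed count of the members of Z containing \<open>\<tau>\<close>, and
  the cycle condition makes it even.\<close>

lemma boundary_of_mod2_cycle_even:
  assumes Z: "Z \<subseteq> simplices_of_card \<K> (Suc (Suc p))" and cyc: "mod2_boundary \<K> (Suc p) Z = {}"
  shows "even (Poly_Mapping.lookup
    (chain_boundary (Suc p) (\<Sum>\<sigma>\<in>Z. frag_of (affine_simplex (Suc p) \<sigma>))) f)"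
proof -
  have finZ: "finite Z" by (rule finite_subset [OF Z]) (simp add: simplices_of_card_def finite_vertices)
  have Z': "\<sigma> \<in> \<K>" "card \<sigma> = Suc (Suc p)" "finite \<sigma>" if "\<sigma> \<in> Z" for \<sigma>
    using Z that finite_vertices by (auto simp: simplices_of_card_def)
  have "chain_boundary (Suc p) (\<Sum>\<sigma>\<in>Z. frag_of (affine_simplex (Suc p) \<sigma>)) =
     (\<Sum>\<sigma>\<in>Z. \<Sum>k\<le>Suc p. frag_cmul ((- 1) ^ k) (frag_of (affine_simplex p (\<sigma> - {en \<sigma> k}))))"
    unfolding chain_boundary_sum o_def
    by (rule sum.cong) (use chain_boundary_affine_simplex Z' in auto)
  then have "Poly_Mapping.lookup (chain_boundary (Suc p) (\<Sum>\<sigma>\<in>Z. frag_of (affine_simplex (Suc p) \<sigma>))) f =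
     (\<Sum>\<sigma>\<in>Z. \<Sum>k\<le>Suc p. (- 1) ^ k * of_bool (affine_simplex p (\<sigma> - {en \<sigma> k}) = f))"
    by (simp add: lookup_sum lookup_frag_cmul lookup_frag_of of_bool_def eq_commute [of f] if_distrib cong: if_cong del: sum.atMost_Suc)
  moreover have "even (\<Sum>\<sigma>\<in>Z. \<Sum>k\<le>Suc p. (- 1) ^ k * of_bool (affine_simplex p (\<sigma> - {en \<sigma> k}) = f) :: int)"
  proof (cases "\<exists>\<tau>\<in>\<K>. card \<tau> = Suc p \<and> f = affine_simplex p \<tau>")
    case False
    have "affine_simplex p (\<sigma> - {en \<sigma> k}) \<noteq> f" if "\<sigma> \<in> Z" "k \<le> Suc p" for \<sigma> k
      using False face_in [of \<sigma> "{en \<sigma> k}"] Z' [OF that(1)] en_in [of \<sigma> k] that by auto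
    then show ?thesis by (intro dvd_sum) auto
  next
    case True
    then obtain \<tau> where \<tau>: "\<tau> \<in> \<K>" "card \<tau> = Suc p" "f = affine_simplex p \<tau>" by blast
    have "odd (\<Sum>k\<le>Suc p. (- 1) ^ k * of_bool (affine_simplex p (\<sigma> - {en \<sigma> k}) = f) :: int) \<longleftrightarrow> \<tau> \<subseteq> \<sigma>"
      if \<sigma>: "\<sigma> \<in> Z" for \<sigma>
    proof -
      have eq: "affine_simplex p (\<sigma> - {en \<sigma> k}) = f \<longleftrightarrow> \<sigma> - {en \<sigma> k} = \<tau>" if "k \<le> Suc p" for k
        using affine_simplex_inject [of "\<sigma> - {en \<sigma> k}" \<tau> p] face_in Z' [OF \<sigma>] en_in [of \<sigma> k] \<tau> that by auto
      let ?B = "{k \<in> {..Suc p}. odd ((- 1) ^ k * of_bool (affine_simplex p (\<sigma> - {en \<sigma> k}) = f) :: int)}"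
      have B: "?B = {k \<in> {..Suc p}. \<sigma> - {en \<sigma> k} = \<tau>}" using eq by (auto simp del: sum.atMost_Suc)
      show ?thesis
      proof (cases "\<tau> \<subseteq> \<sigma>")
        case sub: True
        have "card (\<sigma> - \<tau>) = 1"
          using card_Diff_subset [OF finite_subset [OF sub] sub] Z' [OF \<sigma>] \<tau> by simp
        then obtain x where x: "\<sigma> - \<tau> = {x}" by (meson card_1_singletonE)
        then have "x \<in> en \<sigma> ` {..<card \<sigma>}" using en_image [OF Z'(1) [OF \<sigma>]] by auto
        then obtain k where "k < card \<sigma>" "x = en \<sigma> k" by blast
        then have k: "k \<le> Suc p" "en \<sigma> k = x" using Z' [OF \<sigma>] by auto
        have "\<sigma> - {x} = \<tau>" unfolding x [symmetric] using sub by blast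
        then have "{k \<in> {..Suc p}. \<sigma> - {en \<sigma> k} = \<tau>} = {k}"
          using k inj_on_face [OF Z'(1,2) [OF \<sigma>]] by (auto simp: inj_on_def)
        then have "card ?B = 1" using B by simp
        then show ?thesis using sub by (simp only: even_sum_iff finite_atMost) simp
      next
        case False
        then have "?B = {}" unfolding B by auto
        then have "card ?B = 0" by (simp only: card.empty)
        then show ?thesis using False by (simp only: even_sum_iff finite_atMost) simp
      qed
    qed
    then have "{\<sigma> \<in> Z. odd (\<Sum>k\<le>Suc p. (- 1) ^ k * of_bool (affine_simplex p (\<sigma> - {en \<sigma> k}) = f) :: int)}
        = {\<sigma> \<in> Z. \<tau> \<subseteq> \<sigma>}" by blast
    moreover have "even (card {\<sigma> \<in> Z. \<tau> \<subseteq> \<sigma>})"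
      using cyc \<tau> by (auto simp: mod2_boundary_def simplices_of_card_def)
    ultimately show ?thesis using finZ by (simp only: even_sum_iff)
  qed
  ultimately show ?thesis by simp
qed

text \<open>The contraction joins the identity to a constant map. The constant image stays as an
  explicit term because singular homology is not reduced: in degree 0 it may be nonzero.\<close>

lemma cycle_homologous_to_constant:
  assumes "homotopic_with (\<lambda>x. True) X X id (\<lambda>x. a)"
    and c: "singular_chain p X c" "chain_boundary p c = 0"
  obtains w where "singular_chain (Suc p) X w" "chain_boundary (Suc p) w = c - chain_map p (\<lambda>x. a) c"
proof -
  have "homologous_rel p X {} (chain_map p id c) (chain_map p (\<lambda>x. a) c)"
  proof (rule homotopic_imp_homologous_rel_chain_maps)
    show "homotopic_with (\<lambda>h. h \<in> {} \<rightarrow> {}) X X id (\<lambda>x. a)" using assms(1) by simp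
    show "singular_relcycle p X {} c" using c by (simp add: singular_cycle)
  qed
  then show thesis
    using that c unfolding homologous_rel_def singular_boundary by (auto simp: chain_map_ident)
qed

lemma mod2_cycle_is_boundary:
  assumes contr: "contractible_space X"
    and Z: "Z \<subseteq> simplices_of_card \<K> (Suc p)" and cyc: "mod2_boundary \<K> p Z = {}"
  shows "\<exists>W \<subseteq> simplices_of_card \<K> (Suc (Suc p)). mod2_boundary \<K> (Suc p) W = Z"
proof -
  have finZ: "finite Z" by (rule finite_subset [OF Z]) (simp add: simplices_of_card_def finite_vertices)
  have Z': "\<sigma> \<in> \<K>" "card \<sigma> = Suc p" if "\<sigma> \<in> Z" for \<sigma>
    using Z that by (auto simp: simplices_of_card_def)
  obtain a where a: "homotopic_with (\<lambda>x. True) X X id (\<lambda>x. a)"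
    using contr by (auto simp: contractible_space_def)
  have conta: "continuous_map X X (\<lambda>x. a)" using a homotopic_with_imp_continuous_maps by blast
  let ?k = "\<lambda>p. chain_map p (\<lambda>x. a)"
  define z where "z = (\<Sum>\<sigma>\<in>Z. frag_of (affine_simplex p \<sigma>))"
  have "singular_simplex p X (affine_simplex p \<sigma>)" if "\<sigma> \<in> Z" for \<sigma>
    using singular_simplex_affine_simplex [OF Z' [OF that]] by (simp add: singular_simplex_subtopology)
  then have z: "singular_chain p X z"
    unfolding z_def by (intro singular_chain_sum) (simp add: singular_chain_of)
  \<comment> \<open>Corrects \<open>z\<close> to an integral cycle. Its boundary is 2y with y a
    cycle, and some \<open>u\<close> has boundary y minus the constant image of y. Subtracting 2u
    leaves twice that constant image, which the boundary of the constant image of \<open>z\<close>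
    cancels.\<close>
  obtain u where u: "singular_chain p X u" "chain_boundary p (z - u - u - ?k p z) = 0"
  proof (cases p)
    case 0
    then show thesis using that [of 0] by (simp add: chain_boundary_def)
  next
    case (Suc q)
    obtain y where y: "chain_boundary p z = y + y" "Poly_Mapping.keys y \<subseteq> Poly_Mapping.keys (chain_boundary p z)"
      using halve_even_chain boundary_of_mod2_cycle_even [of Z q] Z cyc unfolding z_def Suc by metis
    have bz: "singular_chain q X (chain_boundary p z)"
      using singular_chain_boundary [OF z] Suc by simp
    then have scy: "singular_chain q X y" using y(2) by (auto simp: singular_chain_def)
    have dd: "chain_boundary q y + chain_boundary q y = 0"
      using chain_boundary_boundary [OF z] y(1) Suc by (simp add: chain_boundary_add)
    have "chain_boundary q y = 0"
    proof (rule poly_mapping_eqI)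
      fix f
      have "Poly_Mapping.lookup (chain_boundary q y + chain_boundary q y) f = 0" using dd by simp
      then show "Poly_Mapping.lookup (chain_boundary q y) f = Poly_Mapping.lookup 0 f"
        by (simp add: lookup_add)
    qed
    then obtain u where u: "singular_chain (Suc q) X u" "chain_boundary (Suc q) u = y - ?k q y"
      using cycle_homologous_to_constant [OF a scy] by blast
    have "chain_boundary p (?k p z) = ?k q y + ?k q y"
      using chain_boundary_chain_map [OF z] Suc y(1) by (simp add: chain_map_add)
    then have "chain_boundary p (z - u - u - ?k p z) = 0"
      using u(2) y(1) Suc by (simp add: chain_boundary_diff)
    then show thesis using that u(1) Suc by blast
  qed
  define c where "c = z - u - u - ?k p z"
  have c: "singular_chain p X c" "chain_boundary p c = 0"
    unfolding c_def using u z singular_chain_chain_map [OF z conta]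
    by (auto intro!: singular_chain_diff)
  obtain w where w: "singular_chain (Suc p) X w" "chain_boundary (Suc p) w = c - ?k p c"
    using cycle_homologous_to_constant [OF a c] by blast
  \<comment> \<open>With n vertices and radius 1/(2n), two points of one box differ by less than 1/n
    in each vertex coordinate, whereas a top coordinate is at least 1/n.\<close>
  define \<C> where "\<C> = (\<lambda>y. {x \<in> topspace X. \<forall>v\<in>\<Union>\<K>. \<bar>x v - y v\<bar> < 1 / (2 * real (card (\<Union>\<K>)))}) ` topspace X"
  have "openin X U" if "U \<in> \<C>" for U
    using that openin_coordinate_box finite_vertices(1) unfolding \<C>_def by blast
  moreover have "topspace X \<subseteq> \<Union>\<C>"
    using top_vertex(4) [OF complex] unfolding \<C>_def by fastforce
  ultimately obtain m where m: "\<And>f. f \<in> Poly_Mapping.keys ((singular_subdivision (Suc p) ^^ m) w) \<Longrightarrow>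
      \<exists>V\<in>\<C>. f \<in> standard_simplex (Suc p) \<rightarrow> V"
    using sufficient_iterated_singular_subdivision_exists [OF _ _ w(1), of \<C>] by (metis order_refl)
  let ?w = "(singular_subdivision (Suc p) ^^ m) w"
  have lab: "vertex_labels top_vertex (Suc p) f \<in> \<K>" if "f \<in> Poly_Mapping.keys ?w" for f
    using m [OF that] vertex_labels_small_in_complex [OF complex] unfolding \<C>_def by blast
  let ?r = "label_coeff top_vertex (Suc p) ?w"
  define W where "W = {\<omega> \<in> simplices_of_card \<K> (Suc (Suc p)). odd (?r \<omega>)}"
  have key: "odd (card {\<omega> \<in> W. \<tau> \<subseteq> \<omega>}) \<longleftrightarrow> \<tau> \<in> Z" if \<tau>: "\<tau> \<in> simplices_of_card \<K> (Suc p)" for \<tau>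
  proof -
    have \<tau>': "\<tau> \<in> \<K>" "card \<tau> = Suc p" "\<tau> \<subseteq> \<Union>\<K>" using \<tau> by (auto simp: simplices_of_card_def)
    interpret Modules.additive "\<lambda>c. subdivided_coeff m p c \<tau>" by (rule additive_subdivided_coeff)
    let ?\<phi> = "\<lambda>c. subdivided_coeff m p c \<tau>"
    \<comment> \<open>In positive degree constant simplices are degenerate. In degree 0,
      \<open>?k p z\<close> contributes \<open>card Z\<close> copies of one vertex, and
      \<open>card Z\<close> is even since the boundary of \<open>Z\<close> misses the empty simplex;
      \<open>?k p c\<close> is minus twice the image of \<open>u\<close>, because the constant map
      is idempotent.\<close>
    have const: "even (?\<phi> (?k p z)) \<and> even (?\<phi> (?k p c))"
    proof (cases p)
      case (Suc q)
      have "?\<phi> (?k p e) = 0" if "singular_chain p X e" for e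
        using naturality_iterated_subdivision [OF that] label_coeff_chain_map_const Suc by metis
      then show ?thesis using z c by simp
    next
      case 0
      have kz: "singular_chain 0 X (?k 0 z)" using singular_chain_chain_map [OF z conta] 0 by simp
      have kk: "?k 0 (?k 0 e) = ?k 0 e" for e
      proof -
        have "?k 0 \<circ> ?k 0 = ?k 0" by (subst chain_map_compose [symmetric]) (simp add: o_def)
        then show ?thesis by (metis comp_apply)
      qed
      have u0: "even (?\<phi> (?k 0 u + ?k 0 u))" using add [of "?k 0 u" "?k 0 u"] 0 by simp
      have "?\<phi> (?k p c) = ?\<phi> (- (?k 0 u + ?k 0 u))"
        unfolding c_def 0 by (simp add: chain_map_diff kk)
      then have "even (?\<phi> (?k p c))" unfolding minus using u0 by simp
      moreover have "?\<phi> (?k p z) = (\<Sum>\<sigma>\<in>Z. of_bool ({top_vertex a} = \<tau>))"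
      proof -
        have "?\<phi> (?k p z) = label_coeff top_vertex 0 (?k 0 z) \<tau>"
          using iterated_subdivision_zero [OF kz] 0 by simp
        also have "?k 0 z = (\<Sum>\<sigma>\<in>Z. frag_of (simplex_map 0 (\<lambda>x. a) (affine_simplex 0 \<sigma>)))"
          unfolding z_def 0 using finZ by (simp add: chain_map_sum o_def)
        also have "label_coeff top_vertex 0 \<dots> \<tau> =
            (\<Sum>\<sigma>\<in>Z. label_coeff top_vertex 0 (frag_of (simplex_map 0 (\<lambda>x. a) (affine_simplex 0 \<sigma>))) \<tau>)"
          by (rule Modules.additive.sum [OF additive_label_coeff])
        also have "\<dots> = (\<Sum>\<sigma>\<in>Z. of_bool ({top_vertex a} = \<tau>))"
          by (rule sum.cong) (use \<tau>' 0 in \<open>auto simp: vertex_labels_def simplex_map_def\<close>)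
        finally show ?thesis .
      qed
      moreover have "even (card Z)"
      proof -
        have "{} \<in> \<K>" using \<tau>'(1) complex by (auto simp: finite_simplicial_complex_def)
        then have "{} \<in> simplices_of_card \<K> 0" by (simp add: simplices_of_card_def)
        then have "even (card {\<sigma> \<in> Z. {} \<subseteq> \<sigma>})" using cyc 0 by (auto simp: mod2_boundary_def)
        then show ?thesis by simp
      qed
      ultimately show ?thesis by simp
    qed
    have "?\<phi> (c - ?k p c) = ?\<phi> z - 2 * ?\<phi> u - ?\<phi> (?k p z) - ?\<phi> (?k p c)"
      unfolding c_def diff by simp
    then have "even (?\<phi> (c - ?k p c)) \<longleftrightarrow> even (?\<phi> z)" using const by simp
    moreover have "?\<phi> (c - ?k p c) = label_coeff top_vertex p (chain_boundary (Suc p) ?w) \<tau>"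
      using chain_boundary_iterated_subdivision [OF w(1)] w(2) by simp
    moreover have "even (label_coeff top_vertex p (chain_boundary (Suc p) ?w) \<tau>) \<longleftrightarrow>
        even (\<Sum>\<omega>\<in>{\<omega> \<in> Pow (\<Union>\<K>). \<tau> \<subseteq> \<omega>}. ?r \<omega>)"
      unfolding even_add [symmetric] even_diff [symmetric]
      by (rule label_coeff_boundary) (use finite_vertices \<tau>' lab in auto)
    moreover have "even (\<Sum>\<omega>\<in>{\<omega> \<in> Pow (\<Union>\<K>). \<tau> \<subseteq> \<omega>}. ?r \<omega>) \<longleftrightarrow> even (card {\<omega> \<in> W. \<tau> \<subseteq> \<omega>})"
    proof -
      have "?r \<omega> = 0" if "\<omega> \<notin> simplices_of_card \<K> (Suc (Suc p))" for \<omega>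
        by (rule label_coeff_eq_0) (use lab that in \<open>auto simp: simplices_of_card_def\<close>)
      then have "{\<omega> \<in> {\<omega> \<in> Pow (\<Union>\<K>). \<tau> \<subseteq> \<omega>}. odd (?r \<omega>)} = {\<omega> \<in> W. \<tau> \<subseteq> \<omega>}"
        unfolding W_def by (auto simp: simplices_of_card_def) (metis even_zero)+
      then show ?thesis using finite_vertices(1) by (simp add: even_sum_iff)
    qed
    moreover have "odd (?\<phi> z) \<longleftrightarrow> \<tau> \<in> Z"
    proof -
      have odd: "odd (?\<phi> (frag_of (affine_simplex p \<sigma>))) \<longleftrightarrow> \<tau> = \<sigma>" if "\<sigma> \<in> Z" for \<sigma>
        using odd_subdivided_coeff_affine_simplex Z' [OF that] \<tau>' by blast
      have "?\<phi> z = (\<Sum>\<sigma>\<in>Z. ?\<phi> (frag_of (affine_simplex p \<sigma>)))"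
        unfolding z_def by (rule sum)
      moreover have "{\<sigma> \<in> Z. odd (?\<phi> (frag_of (affine_simplex p \<sigma>)))} = (if \<tau> \<in> Z then {\<tau>} else {})"
        using odd by (auto split: if_splits)
      then have "card {\<sigma> \<in> Z. odd (?\<phi> (frag_of (affine_simplex p \<sigma>)))} = of_bool (\<tau> \<in> Z)"
        by simp
      ultimately show ?thesis using finZ by (simp only: even_sum_iff) simp
    qed
    ultimately show ?thesis by argo
  qed
  show ?thesis
  proof (intro exI conjI)
    show "W \<subseteq> simplices_of_card \<K> (Suc (Suc p))" by (auto simp: W_def)
    show "mod2_boundary \<K> (Suc p) W = Z" using key Z by (auto simp: mod2_boundary_def)
  qed
qed

end

theorem Euler_char_contractible_realization:
  assumes \<K>: "finite_simplicial_complex \<K>" and ne: "{v} \<in> \<K>"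
    and contr: "contractible_space (realization \<K>)"
  shows "(\<Sum>\<sigma>\<in>\<K>. (- 1) ^ card \<sigma>) = (0::real)"
proof -
  have "finite (\<Union>\<K>)" using \<K> by (auto simp: finite_simplicial_complex_def)
  then obtain en where "enumerated_complex \<K> en"
    unfolding enumerated_complex_def using simplex_enumeration_exists \<K> by metis
  then interpret enumerated_complex \<K> en .
  show ?thesis
  proof (rule mod2_acyclic_imp_Euler_char [OF \<K>])
    show "{} \<in> \<K>" using ne \<K> by (auto simp: finite_simplicial_complex_def)
    show "{v} \<in> \<K>" by (rule ne)
  qed (rule mod2_cycle_is_boundary [OF contr])
qed

section \<open>Simplicial complexes homeomorphic to balls\<close>

text \<open>If n < m, invariance of domain makes the image of U open in m-space, although its
  coordinate n vanishes identically. Moving a point of the image slightly along that coordinate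
  gives the contradiction.\<close>

lemma Euclidean_space_dimension_le:
  assumes U: "openin (Euclidean_space m) U" "U \<noteq> {}"
    and f: "continuous_map (subtopology (Euclidean_space m) U) (Euclidean_space n) f" "inj_on f U"
  shows "m \<le> n"
proof (rule ccontr)
  assume "\<not> m \<le> n"
  then have nm: "n < m" by simp
  have "Euclidean_space n = subtopology (Euclidean_space m) {x. \<forall>i\<ge>n. x i = 0}"
    using nm by (simp add: Euclidean_space_def subtopology_subtopology)
      (metis (no_types, lifting) inf.absorb_iff2 subset_Euclidean_space topspace_Euclidean_space less_imp_le)
  then have "continuous_map (subtopology (Euclidean_space m) U) (Euclidean_space m) f"
    using f(1) by (simp add: continuous_map_in_subtopology)
  then have op: "openin (Euclidean_space m) (f ` U)"
    by (intro invariance_of_domain_Euclidean_space U f)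
  obtain u where u: "u \<in> U" using U(2) by blast
  have Us: "U \<subseteq> topspace (Euclidean_space m)" using U(1) openin_subset by blast
  have fn: "f x i = 0" if "x \<in> U" "n \<le> i" for x i
  proof -
    have "f x \<in> topspace (Euclidean_space n)"
      using continuous_map_funspace [OF f(1)] that Us by auto
    then show ?thesis using that by (simp add: topspace_Euclidean_space)
  qed
  let ?g = "\<lambda>t i. if i = n then t else f u i"
  have "continuous_map euclideanreal (Euclidean_space m) ?g"
    unfolding Euclidean_space_def continuous_map_in_subtopology continuous_map_componentwise_UNIV
    using nm fn [OF u] by auto
  from openin_continuous_map_preimage [OF this op]
  have "open {t. ?g t \<in> f ` U}" by simp
  moreover have "?g 0 = f u" using fn [OF u, of n] by auto
  then have "0 \<in> {t. ?g t \<in> f ` U}" using u by simp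
  ultimately obtain e where e: "e > 0" "ball 0 e \<subseteq> {t. ?g t \<in> f ` U}"
    using openE by blast
  then have "e / 2 \<in> ball 0 e" by (simp add: dist_real_def)
  then have "?g (e / 2) \<in> f ` U" using e by blast
  then obtain x where x: "?g (e / 2) = f x" "x \<in> U" by (rule imageE)
  have "?g (e / 2) n = f x n" by (rule fun_cong [OF x(1)])
  then show False using fn [OF x(2), of n] e by simp
qed

lemma contractible_nball: "contractible_space (nball n)"
proof -
  have "homotopic_with (\<lambda>x. True) (nball n) (nball n) id (\<lambda>x i. 0)"
    unfolding homotopic_with_def
  proof (intro exI conjI allI ballI)
    let ?h = "\<lambda>(t::real, x::nat \<Rightarrow> real). \<lambda>i. (1 - t) * x i"
    show "continuous_map (prod_topology (top_of_set {0..1}) (nball n)) (nball n) ?h"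
    proof -
      have cx: "continuous_map (nball n) euclideanreal (\<lambda>x. x i)" for i
        unfolding nball_def Euclidean_space_def
        by (intro continuous_map_from_subtopology continuous_map_product_projection) auto
      have "continuous_map (prod_topology (top_of_set {0..1}) (nball n)) (powertop_real UNIV) ?h"
        unfolding continuous_map_componentwise_UNIV
      proof
        fix i
        have "continuous_map (prod_topology (top_of_set {0..1}) (nball n)) euclideanreal
            (\<lambda>z. (1 - fst z) * snd z i)"
          using continuous_map_compose [OF continuous_map_snd cx]
          by (intro continuous_intros continuous_map_into_fulltopology [OF continuous_map_fst])
            (simp add: o_def)
        then show "continuous_map (prod_topology (top_of_set {0..1}) (nball n)) euclideanreal (\<lambda>z. ?h z i)"
          by (simp add: case_prod_unfold)
      qed
      moreover have "(\<Sum>i<n. ((1 - t) * x i)\<^sup>2) \<le> 1" if "0 \<le> t" "t \<le> 1" "(\<Sum>i<n. (x i)\<^sup>2) \<le> 1" for t and x :: "nat \<Rightarrow> real"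
      proof -
        have "(\<Sum>i<n. ((1 - t) * x i)\<^sup>2) = (1 - t)\<^sup>2 * (\<Sum>i<n. (x i)\<^sup>2)"
          by (simp add: power_mult_distrib sum_distrib_left)
        also have "\<dots> \<le> 1 * 1"
          using that by (intro mult_mono power_le_one sum_nonneg) auto
        finally show ?thesis by simp
      qed
      ultimately show ?thesis
        unfolding nball_def Euclidean_space_def continuous_map_in_subtopology by auto
    qed
  qed auto
  then show ?thesis unfolding contractible_space_def by blast
qed

text \<open>Positive coordinates on a largest simplex \<open>\<sigma>\<close> force the support to
  be \<open>\<sigma>\<close>, so these points form an open set; dropping the last coordinate makes
  it an open subset of m-space. The two inequalities come from embedding it in n-space and from
  embedding an open piece of the ball in m-space.\<close>

lemma realization_homeomorphic_nball_dim:
  assumes \<K>: "finite_simplicial_complex \<K>" and hom: "realization \<K> homeomorphic_space nball n"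
    and \<sigma>: "\<sigma> \<in> \<K>" "card \<sigma> = Suc m" and max: "\<And>\<tau>. \<tau> \<in> \<K> \<Longrightarrow> card \<tau> \<le> Suc m"
  shows "m = n"
proof -
  let ?X = "realization \<K>"
  have fin: "finite \<tau>" if "\<tau> \<in> \<K>" for \<tau> using \<K> that by (auto simp: finite_simplicial_complex_def)
  obtain h k where hk: "homeomorphic_maps ?X (nball n) h k"
    using hom by (auto simp: homeomorphic_space_def)
  have ch: "continuous_map ?X (nball n) h" and ck: "continuous_map (nball n) ?X k"
    and kh: "\<And>x. x \<in> topspace ?X \<Longrightarrow> k (h x) = x" and hk': "\<And>x. x \<in> topspace (nball n) \<Longrightarrow> h (k x) = x"
    using hk by (auto simp: homeomorphic_maps_def)
  obtain en where "bij_betw en {0..<card \<sigma>} \<sigma>" using ex_bij_betw_nat_finite fin \<sigma> by blast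
  then have en: "bij_betw en {..m} \<sigma>" by (simp add: \<sigma> atLeast0LessThan lessThan_Suc_atMost)
  have en_in: "en i \<in> \<sigma>" if "i \<le> m" for i using en that by (auto simp: bij_betw_def)
  have en_inj: "en i = en j \<longleftrightarrow> i = j" if "i \<le> m" "j \<le> m" for i j
    using en that by (auto simp: bij_betw_def inj_on_def)
  have proj: "continuous_map ?X euclideanreal (\<lambda>\<alpha>. \<alpha> v)" for v
    unfolding realization_def by (intro continuous_map_from_subtopology continuous_map_product_projection) auto
  have projE: "continuous_map (Euclidean_space l) euclideanreal (\<lambda>\<alpha>. \<alpha> v)" for v l
    unfolding Euclidean_space_def by (intro continuous_map_from_subtopology continuous_map_product_projection) auto
  define U where "U = {\<alpha> \<in> topspace ?X. \<forall>v\<in>\<sigma>. \<alpha> v > 0}"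
  have suppU: "{v. \<alpha> v \<noteq> 0} = \<sigma>" if \<alpha>: "\<alpha> \<in> U" for \<alpha>
  proof -
    have "\<sigma> \<subseteq> {v. \<alpha> v \<noteq> 0}" "{v. \<alpha> v \<noteq> 0} \<in> \<K>" using \<alpha> by (force simp: U_def topspace_realization)+
    then show ?thesis using max fin \<sigma> by (metis card_seteq)
  qed
  have sumU: "(\<Sum>i<m. \<alpha> (en i)) + \<alpha> (en m) = 1" if \<alpha>: "\<alpha> \<in> U" for \<alpha>
  proof -
    have "(\<Sum>i\<le>m. \<alpha> (en i)) = sum \<alpha> \<sigma>" by (rule sum.reindex_bij_betw [OF en])
    also have "\<dots> = 1" using \<alpha> suppU [OF \<alpha>] by (auto simp: U_def topspace_realization)
    finally show ?thesis by (simp add: lessThan_Suc_atMost [symmetric])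
  qed
  have openU: "openin ?X U"
  proof -
    have "openin ?X {\<alpha> \<in> topspace ?X. \<alpha> v \<in> {0<..}}" for v
      by (rule openin_continuous_map_preimage [OF proj]) auto
    then have "openin ?X (\<Inter>v\<in>\<sigma>. {\<alpha> \<in> topspace ?X. \<alpha> v \<in> {0<..}})"
      using fin \<sigma> by (intro openin_INT2) auto
    moreover have "(\<Inter>v\<in>\<sigma>. {\<alpha> \<in> topspace ?X. \<alpha> v \<in> {0<..}}) = U"
      using en_in [of 0] by (auto simp: U_def)
    ultimately show ?thesis by simp
  qed
  define V where "V = {x \<in> topspace (Euclidean_space m). (\<forall>i<m. x i > 0) \<and> (\<Sum>i<m. x i) < 1}"
  have openV: "openin (Euclidean_space m) V"
  proof -
    have "openin (Euclidean_space m) {x \<in> topspace (Euclidean_space m). x v \<in> {0<..}}" for v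
      by (rule openin_continuous_map_preimage [OF projE]) auto
    then have "openin (Euclidean_space m) (topspace (Euclidean_space m) \<inter>
        (\<Inter>i\<in>{..<m}. {x \<in> topspace (Euclidean_space m). x i \<in> {0<..}}))"
      by (cases "m = 0") (auto intro!: openin_Int openin_INT2)
    moreover have "openin (Euclidean_space m) {x \<in> topspace (Euclidean_space m). (\<Sum>i<m. x i) \<in> {..<1}}"
      by (rule openin_continuous_map_preimage [OF continuous_map_sum]) (use projE in auto)
    ultimately have "openin (Euclidean_space m) ((topspace (Euclidean_space m) \<inter>
        (\<Inter>i\<in>{..<m}. {x \<in> topspace (Euclidean_space m). x i \<in> {0<..}})) \<inter>
        {x \<in> topspace (Euclidean_space m). (\<Sum>i<m. x i) \<in> {..<1}})" by (rule openin_Int)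
    moreover have "((topspace (Euclidean_space m) \<inter>
        (\<Inter>i\<in>{..<m}. {x \<in> topspace (Euclidean_space m). x i \<in> {0<..}})) \<inter>
        {x \<in> topspace (Euclidean_space m). (\<Sum>i<m. x i) \<in> {..<1}}) = V"
      by (auto simp: V_def)
    ultimately show ?thesis by simp
  qed
  define \<psi> where "\<psi> x v = (\<Sum>i\<le>m. of_bool (v = en i) * (if i < m then x i else 1 - (\<Sum>i<m. x i)))"
    for x :: "nat \<Rightarrow> real" and v
  have \<psi>_en: "\<psi> x (en i) = (if i < m then x i else 1 - (\<Sum>i<m. x i))" if "i \<le> m" for x i
  proof -
    have "\<psi> x (en i) = (\<Sum>j\<le>m. if j = i then (if j < m then x j else 1 - (\<Sum>i<m. x i)) else 0)"
      unfolding \<psi>_def by (rule sum.cong) (use en_inj that in auto)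
    then show ?thesis using that by simp
  qed
  have \<psi>_out: "\<psi> x v = 0" if "v \<notin> \<sigma>" for x v
    unfolding \<psi>_def by (rule sum.neutral) (use en_in that in auto)
  have \<psi>_pos: "\<psi> x v > 0" if x: "x \<in> V" and v: "v \<in> \<sigma>" for x v
  proof -
    obtain i where i: "i \<le> m" "v = en i" using en v by (auto simp: bij_betw_def)
    then show ?thesis using \<psi>_en [of i x] x by (simp add: V_def)
  qed
  have \<psi>_U: "\<psi> x \<in> U" if x: "x \<in> V" for x
  proof -
    have supp: "{v. \<psi> x v \<noteq> 0} = \<sigma>" using \<psi>_pos [OF x] \<psi>_out by force
    have "sum (\<psi> x) \<sigma> = (\<Sum>i\<le>m. \<psi> x (en i))" by (rule sum.reindex_bij_betw [OF en, symmetric])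
    also have "\<dots> = (\<Sum>i<m. \<psi> x (en i)) + \<psi> x (en m)" by (simp add: lessThan_Suc_atMost [symmetric])
    also have "\<dots> = 1" using \<psi>_en by simp
    finally have "sum (\<psi> x) \<sigma> = 1" .
    moreover have "0 \<le> \<psi> x v" for v using \<psi>_pos [OF x, of v] \<psi>_out [of v x] by (cases "v \<in> \<sigma>") auto
    ultimately show ?thesis using supp \<sigma> \<psi>_pos [OF x] by (simp add: U_def topspace_realization)
  qed
  \<comment> \<open>The coordinates 1/(2m) sum to 1/2; for \<open>m = 0\<close> the zero function
    remains.\<close>
  have V0: "(\<lambda>i. if i < m then 1 / (2 * real m) else 0) \<in> V"
    by (simp add: V_def topspace_Euclidean_space)
  have c\<psi>: "continuous_map (subtopology (Euclidean_space m) V) ?X \<psi>"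
  proof -
    have "continuous_map (Euclidean_space m) (powertop_real UNIV) \<psi>"
      unfolding continuous_map_componentwise_UNIV \<psi>_def
    proof
      fix v
      have "continuous_map (Euclidean_space m) euclideanreal (\<lambda>x. if i < m then x i else 1 - (\<Sum>i<m. x i))" for i
        using projE by (cases "i < m") (auto intro!: continuous_intros)
      then show "continuous_map (Euclidean_space m) euclideanreal
          (\<lambda>x. \<Sum>i\<le>m. of_bool (v = en i) * (if i < m then x i else 1 - (\<Sum>i<m. x i)))"
        by (intro continuous_map_sum continuous_map_real_mult) auto
    qed
    moreover have "\<psi> x \<in> {\<alpha>. (\<forall>v. 0 \<le> \<alpha> v) \<and> {v. \<alpha> v \<noteq> 0} \<in> \<K> \<and> sum \<alpha> {v. \<alpha> v \<noteq> 0} = 1}" if "x \<in> V" for x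
      using \<psi>_U [OF that] unfolding U_def topspace_realization by blast
    ultimately show ?thesis
      unfolding realization_def continuous_map_in_subtopology
      by (auto intro: continuous_map_from_subtopology)
  qed
  have topball: "topspace (nball n) = {x. (\<forall>i\<ge>n. x i = 0) \<and> (\<Sum>i<n. (x i)\<^sup>2) \<le> 1}"
    by (auto simp: nball_def topspace_Euclidean_space)
  have "m \<le> n"
  proof (rule Euclidean_space_dimension_le [OF openV])
    show "V \<noteq> {}" using V0 by blast
    show "continuous_map (subtopology (Euclidean_space m) V) (Euclidean_space n) (h \<circ> \<psi>)"
      using continuous_map_compose [OF c\<psi> ch] unfolding nball_def
      by (rule continuous_map_into_fulltopology)
    show "inj_on (h \<circ> \<psi>) V"
    proof
      fix x y assume xy: "x \<in> V" "y \<in> V" "(h \<circ> \<psi>) x = (h \<circ> \<psi>) y"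
      then have "\<psi> x = \<psi> y" using kh \<psi>_U by (metis (no_types, lifting) U_def comp_apply mem_Collect_eq)
      then have "x i = y i" if "i < m" for i using \<psi>_en [of i x] \<psi>_en [of i y] that by simp
      moreover have "x i = y i" if "\<not> i < m" for i
        using xy that by (simp add: V_def topspace_Euclidean_space)
      ultimately show "x = y" by blast
    qed
  qed
  moreover have "n \<le> m"
  proof -
    define B where "B = {x \<in> topspace (nball n). k x \<in> U}"
    have "openin (nball n) B" unfolding B_def by (rule openin_continuous_map_preimage [OF ck openU])
    then obtain T where T: "openin (Euclidean_space n) T" "B = T \<inter> {x. (\<Sum>i<n. (x i)\<^sup>2) \<le> 1}"
      unfolding nball_def openin_subtopology by blast
    \<comment> \<open>\<open>B\<close> is only relatively open in the closed ball; intersecting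
      \<open>T\<close> with the open ball gives a set open in n-space.\<close>
    define S where "S = T \<inter> {x \<in> topspace (Euclidean_space n). (\<Sum>i<n. (x i)\<^sup>2) \<in> {..<1}}"
    have "openin (Euclidean_space n) {x \<in> topspace (Euclidean_space n). (\<Sum>i<n. (x i)\<^sup>2) \<in> {..<1}}"
      by (rule openin_continuous_map_preimage [where Y = euclideanreal])
        (use projE in \<open>auto intro!: continuous_map_sum continuous_map_real_pow\<close>)
    then have openS: "openin (Euclidean_space n) S" unfolding S_def using T by blast
    have SB: "S \<subseteq> B" unfolding S_def T by auto
    have "h (\<psi> (\<lambda>i. if i < m then 1 / (2 * real m) else 0)) \<in> B"
      using \<psi>_U [OF V0] kh continuous_map_funspace [OF ch] by (auto simp: B_def U_def)
    then obtain x where x: "x \<in> B" by blast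
    have xE: "\<And>i. i \<ge> n \<Longrightarrow> x i = 0" and x1: "(\<Sum>i<n. (x i)\<^sup>2) \<le> 1"
      using x by (auto simp: B_def topball)
    let ?g = "\<lambda>t i. t * x i"
    have "continuous_map euclideanreal (Euclidean_space n) ?g"
      unfolding Euclidean_space_def continuous_map_in_subtopology continuous_map_componentwise_UNIV
      using xE by (auto intro!: continuous_intros)
    from openin_continuous_map_preimage [OF this T(1)]
    have "open {t. ?g t \<in> T}" by simp
    moreover have "1 \<in> {t. ?g t \<in> T}" using x T by simp
    ultimately obtain e where e: "e > 0" "ball 1 e \<subseteq> {t. ?g t \<in> T}" using openE by blast
    \<comment> \<open>A point of \<open>B\<close> may lie on the sphere, so it is shrunk towards the
      origin by a factor below 1 but within \<open>e\<close> of 1.\<close>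
    define t where "t = max (1 / 2) (1 - e / 2)"
    have t: "0 < t" "t < 1" "t \<in> ball 1 e" using e by (auto simp: t_def dist_real_def)
    have "(\<Sum>i<n. (t * x i)\<^sup>2) = t\<^sup>2 * (\<Sum>i<n. (x i)\<^sup>2)"
      by (simp add: power_mult_distrib sum_distrib_left)
    also have "\<dots> \<le> t\<^sup>2 * 1" using x1 by (intro mult_left_mono) auto
    also have "\<dots> < 1" using t by (simp add: power_less_one_iff)
    finally have "?g t \<in> S" using e t xE by (auto simp: S_def topspace_Euclidean_space)
    then have "S \<noteq> {}" by blast
    define \<phi> where "\<phi> \<alpha> i = (if i < m then \<alpha> (en i) else 0)" for \<alpha> :: "'a \<Rightarrow> real" and i
    have c\<phi>: "continuous_map ?X (Euclidean_space m) \<phi>"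
      unfolding \<phi>_def continuous_map_componentwise_Euclidean_space using proj by blast
    have inj\<phi>: "\<alpha> = \<beta>" if "\<alpha> \<in> U" "\<beta> \<in> U" "\<phi> \<alpha> = \<phi> \<beta>" for \<alpha> \<beta>
    proof
      fix v
      have lt: "\<alpha> (en i) = \<beta> (en i)" if "i < m" for i
        using fun_cong [OF \<open>\<phi> \<alpha> = \<phi> \<beta>\<close>, of i] that by (simp add: \<phi>_def)
      then have "(\<Sum>i<m. \<alpha> (en i)) = (\<Sum>i<m. \<beta> (en i))" by simp
      then have eqm: "\<alpha> (en m) = \<beta> (en m)" using sumU [OF that(1)] sumU [OF that(2)] by simp
      show "\<alpha> v = \<beta> v"
      proof (cases "v \<in> \<sigma>")
        case True
        then obtain i where "i \<le> m" "v = en i" using en by (auto simp: bij_betw_def)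
        then show ?thesis using lt eqm by (cases "i = m") auto
      next
        case False
        then have "v \<notin> {v. \<alpha> v \<noteq> 0}" "v \<notin> {v. \<beta> v \<noteq> 0}"
          unfolding suppU [OF that(1)] suppU [OF that(2)] by auto
        then show ?thesis by simp
      qed
    qed
    have kS: "continuous_map (subtopology (Euclidean_space n) S) ?X k"
    proof -
      have "subtopology (Euclidean_space n) S = subtopology (nball n) S"
      proof -
        have "{x. (\<Sum>i<n. (x i)\<^sup>2) \<le> 1} \<inter> S = S" using SB T(2) by blast
        then show ?thesis unfolding nball_def subtopology_subtopology by simp
      qed
      then show ?thesis using continuous_map_from_subtopology [OF ck] by metis
    qed
    show ?thesis
    proof (rule Euclidean_space_dimension_le [OF openS \<open>S \<noteq> {}\<close>])
      show "continuous_map (subtopology (Euclidean_space n) S) (Euclidean_space m) (\<phi> \<circ> k)"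
        by (rule continuous_map_compose [OF kS c\<phi>])
      show "inj_on (\<phi> \<circ> k) S"
      proof
        fix x y assume xy: "x \<in> S" "y \<in> S" "(\<phi> \<circ> k) x = (\<phi> \<circ> k) y"
        have "x \<in> B" "y \<in> B" using xy SB by auto
        then have "k x = k y" using inj\<phi> xy by (auto simp: B_def)
        then show "x = y" using hk' \<open>x \<in> B\<close> \<open>y \<in> B\<close> unfolding B_def by (metis (no_types, lifting) mem_Collect_eq)
      qed
    qed
  qed
  ultimately show ?thesis by simp
qed

section \<open>Order complexes of cubical complexes\<close>

context cubical
begin

definition face_chains :: "'a set \<Rightarrow> 'a set set" where
  "face_chains D = {C. C \<subseteq> D \<and> C \<in> Chains K}"

lemma finite_simplicial_complex_face_chains:
  assumes "finite D"
  shows "finite_simplicial_complex (face_chains D)"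
  unfolding finite_simplicial_complex_def face_chains_def
proof (intro conjI ballI allI impI)
  show "finite {C. C \<subseteq> D \<and> C \<in> Chains K}" using assms by simp
  fix C assume C: "C \<in> {C. C \<subseteq> D \<and> C \<in> Chains K}"
  then show "finite C" using assms finite_subset by blast
  fix B assume "B \<subseteq> C"
  then show "B \<in> {C. C \<subseteq> D \<and> C \<in> Chains K}" using C unfolding Chains_def by blast
qed

lemma order_complex_space_eq_realization:
  "order_complex_space K = realization (face_chains faces)"
proof -
  have "sum \<alpha> faces = sum \<alpha> {E. \<alpha> E \<noteq> 0}" if "{E. \<alpha> E \<noteq> 0} \<subseteq> faces" for \<alpha> :: "'a \<Rightarrow> real"
    by (rule sum.mono_neutral_right) (use finite_faces that in auto)
  then show ?thesis
    unfolding order_complex_space_def realization_def face_chains_def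
    by (intro arg_cong2 [of _ _ _ _ subtopology] HOL.refl Collect_cong) auto
qed

text \<open>Remove a face M of largest dimension. The chains through M are M added to chains of its
  proper faces B, and the signs of all nonempty faces of the cube M sum to 1; so M changes the left
  side by minus the sign of its dimension, as on the right.\<close>

lemma Euler_char_face_chains:
  assumes "D \<subseteq> faces" and "\<And>E F. F \<in> D \<Longrightarrow> E \<in> faces \<Longrightarrow> (E, F) \<in> K \<Longrightarrow> E \<in> D"
  shows "(\<Sum>C\<in>face_chains D. (- 1) ^ card C) = 1 - (\<Sum>E\<in>D. (- 1) ^ dim E :: real)"
  using assms
proof (induction "card D" arbitrary: D rule: less_induct)
  case less
  have finD: "finite D" using less.prems finite_faces finite_subset by blast
  show ?case
  proof (cases "D = {}")
    case True
    have "face_chains {} = {{}}" by (auto simp: face_chains_def Chains_def)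
    then show ?thesis using True by simp
  next
    case False
    have "Max (dim ` D) \<in> dim ` D" using finD False by (intro Max_in) auto
    then obtain M where "Max (dim ` D) = dim M" and M: "M \<in> D" by (rule imageE)
    then have dM: "dim F \<le> dim M" if "F \<in> D" for F
      using Max_ge [of "dim ` D" "dim F"] finD that by simp
    have Mf: "M \<in> faces" using M less.prems by blast
    have top: "(M, F) \<notin> K" if "F \<in> D" "F \<noteq> M" for F
      using dim_strict_mono [OF Mf] dM [OF that(1)] that by fastforce
    define B where "B = {E \<in> faces. (E, M) \<in> K} - {M}"
    have BD: "B \<subseteq> D - {M}" unfolding B_def using less.prems M by blast
    have finB: "finite B" using BD finD finite_subset by blast
    have small: "card (D - {M}) < card D" using M finD by (metis card_Diff1_less)
    then have smallB: "card B < card D" using card_mono [OF _ BD] finD by simp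
    have IH1: "(\<Sum>C\<in>face_chains (D - {M}). (- 1) ^ card C) = 1 - (\<Sum>E\<in>D - {M}. (- 1) ^ dim E :: real)"
    proof (rule less.hyps [OF small])
      show "D - {M} \<subseteq> faces" using less.prems by blast
      show "E \<in> D - {M}" if "F \<in> D - {M}" "E \<in> faces" "(E, F) \<in> K" for E F
        using that less.prems top by blast
    qed
    have IH2: "(\<Sum>C\<in>face_chains B. (- 1) ^ card C) = 1 - (\<Sum>E\<in>B. (- 1) ^ dim E :: real)"
    proof (rule less.hyps [OF smallB])
      show "B \<subseteq> faces" by (auto simp: B_def)
      show "E \<in> B" if "F \<in> B" "E \<in> faces" "(E, F) \<in> K" for E F
        using that trans antisym unfolding B_def by blast
    qed
    have eq: "face_chains D = face_chains (D - {M}) \<union> insert M ` face_chains B"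
    proof (intro equalityI subsetI)
      fix C assume C: "C \<in> face_chains D"
      show "C \<in> face_chains (D - {M}) \<union> insert M ` face_chains B"
      proof (cases "M \<in> C")
        case True
        have "C - {M} \<in> face_chains B"
        proof -
          have "E \<in> B" if E: "E \<in> C - {M}" for E
          proof -
            have "E \<in> D" using C E by (auto simp: face_chains_def)
            moreover have "(E, M) \<in> K \<or> (M, E) \<in> K" using C E True by (auto simp: face_chains_def Chains_def)
            ultimately show ?thesis using top E less.prems unfolding B_def by blast
          qed
          then show ?thesis using C unfolding face_chains_def Chains_def by blast
        qed
        then show ?thesis using True by (metis UnI2 image_eqI insert_Diff)
      next
        case False
        then show ?thesis using C unfolding face_chains_def by blast
      qed
    next
      fix C assume "C \<in> face_chains (D - {M}) \<union> insert M ` face_chains B"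
      then show "C \<in> face_chains D"
      proof
        assume "C \<in> insert M ` face_chains B"
        then obtain C' where C': "C' \<subseteq> B" "C' \<in> Chains K" "C = insert M C'" by (auto simp: face_chains_def)
        have "(E, M) \<in> K" if "E \<in> C'" for E using that C' unfolding B_def by blast
        moreover have "(M, M) \<in> K" using refl faces_Field Mf by blast
        ultimately have "C \<in> Chains K" using C' unfolding Chains_def by blast
        then show ?thesis using C' BD M unfolding face_chains_def by blast
      qed (auto simp: face_chains_def)
    qed
    have notin: "M \<notin> C" if "C \<in> face_chains B" for C using that unfolding face_chains_def B_def by blast
    have fin: "finite (face_chains B)" "finite (face_chains (D - {M}))"
      using finite_simplicial_complex_face_chains finB finD by (auto simp: finite_simplicial_complex_def)
    have finC: "finite C" if "C \<in> face_chains B" for C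
      using that finB finite_subset unfolding face_chains_def by blast
    have "(\<Sum>C\<in>insert M ` face_chains B. (- 1) ^ card C) = (\<Sum>C\<in>face_chains B. (- 1) ^ card (insert M C) :: real)"
    proof (rule sum.reindex_cong [of "insert M"])
      show "inj_on (insert M) (face_chains B)"
        using notin by (metis inj_onI insert_ident)
    qed auto
    also have "\<dots> = (\<Sum>C\<in>face_chains B. - ((- 1) ^ card C))"
      by (rule sum.cong) (use notin finC in auto)
    finally have ins: "(\<Sum>C\<in>insert M ` face_chains B. (- 1) ^ card C) = - (\<Sum>C\<in>face_chains B. (- 1) ^ card C :: real)"
      by (simp add: sum_negf)
    have "(\<Sum>C\<in>face_chains D. (- 1) ^ card C) =
        (\<Sum>C\<in>face_chains (D - {M}). (- 1) ^ card C) + (\<Sum>C\<in>insert M ` face_chains B. (- 1) ^ card C :: real)"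
      unfolding eq by (rule sum.union_disjoint) (use fin in \<open>auto simp: face_chains_def\<close>)
    moreover have "(\<Sum>E\<in>B. (- 1) ^ dim E) = 1 - ((- 1) ^ dim M :: real)"
    proof -
      have "M \<in> {E \<in> faces. (E, M) \<in> K}" using Mf refl faces_Field by blast
      then have "(\<Sum>E\<in>{E \<in> faces. (E, M) \<in> K}. (- 1) ^ dim E) = (- 1) ^ dim M + (\<Sum>E\<in>B. (- 1) ^ dim E :: real)"
        unfolding B_def using finite_faces by (intro sum.remove) auto
      then show ?thesis using sum_sign_faces_below [OF Mf, where 'b = real] by simp
    qed
    moreover have "(\<Sum>E\<in>D. (- 1) ^ dim E) = (- 1) ^ dim M + (\<Sum>E\<in>D - {M}. (- 1) ^ dim E :: real)"
      by (rule sum.remove [OF finD M])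
    ultimately show ?thesis using IH1 IH2 ins by simp
  qed
qed

text \<open>Dimension is injective on a chain. With \<open>chain_exists\<close>, which descends
  through facets, this shows that the order complex has the same dimension as K.\<close>

lemma chain_card_le:
  assumes C: "C \<in> face_chains faces" and n: "\<And>E. E \<in> faces \<Longrightarrow> dim E \<le> n"
  shows "card C \<le> Suc n"
proof -
  have "inj_on dim C"
  proof (rule inj_onI, rule ccontr)
    fix E F assume EF: "E \<in> C" "F \<in> C" "dim E = dim F" "E \<noteq> F"
    then have "E \<in> faces" "F \<in> faces" "(E, F) \<in> K \<or> (F, E) \<in> K"
      using C by (auto simp: face_chains_def Chains_def)
    then show False using dim_strict_mono [of E F] dim_strict_mono [of F E] EF by auto
  qed
  then have "card C = card (dim ` C)" by (simp add: card_image)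
  also have "\<dots> \<le> card {..n}" by (rule card_mono) (use C n in \<open>auto simp: face_chains_def\<close>)
  finally show ?thesis by simp
qed

lemma chain_exists:
  assumes "F \<in> faces" "dim F = n"
  shows "\<exists>C\<in>face_chains faces. card C = Suc n \<and> (\<forall>E\<in>C. (E, F) \<in> K)"
  using assms
proof (induction n arbitrary: F)
  case 0
  then have "{F} \<in> face_chains faces" using refl faces_Field by (auto simp: face_chains_def Chains_def)
  then show ?case using 0 refl faces_Field by (intro bexI [of _ "{F}"]) auto
next
  case (Suc n)
  obtain E where E: "E \<in> faces" "(E, F) \<in> K" "dim E = n" using facet_exists [OF Suc.prems] by blast
  obtain C where C: "C \<in> face_chains faces" "card C = Suc n" "\<forall>D\<in>C. (D, E) \<in> K" using Suc.IH [OF E(1,3)] by blast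
  have le: "(D, F) \<in> K" if "D \<in> insert F C" for D
    using that C E trans refl faces_Field Suc.prems by blast
  have "F \<notin> C"
  proof
    assume "F \<in> C"
    then have "F = E" using C E antisym by blast
    then show False using E Suc.prems by simp
  qed
  moreover have "finite C" using C by (metis card.infinite nat.distinct(1))
  moreover have "insert F C \<in> face_chains faces"
    using C le Suc.prems unfolding face_chains_def Chains_def by blast
  ultimately show ?case using C le by (intro bexI [of _ "insert F C"]) auto
qed

lemma ball_complex_dim_and_Euler_char:
  assumes hom: "order_complex_space K homeomorphic_space nball n"
  shows "complex_dim K = int n" "(\<Sum>E\<in>faces. (- 1) ^ dim E) = (1::real)"
proof -
  let ?C = "face_chains faces"
  have cx: "finite_simplicial_complex ?C" by (rule finite_simplicial_complex_face_chains [OF finite_faces])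
  have hom': "realization ?C homeomorphic_space nball n"
    using hom by (simp add: order_complex_space_eq_realization)
  \<comment> \<open>The origin of the ball shows that the realization is nonempty, hence that there
    is a nonempty face.\<close>
  have "(\<lambda>i. 0) \<in> topspace (nball n)" by (simp add: nball_def topspace_Euclidean_space)
  then have "topspace (realization ?C) \<noteq> {}" using homeomorphic_empty_space [OF hom'] by auto
  then obtain \<alpha> :: "'a \<Rightarrow> real" where \<alpha>: "{E. \<alpha> E \<noteq> 0} \<in> ?C" "sum \<alpha> {E. \<alpha> E \<noteq> 0} = 1"
    by (auto simp: topspace_realization)
  then have "{E. \<alpha> E \<noteq> 0} \<noteq> {}" by (metis sum.empty zero_neq_one)
  then obtain E0 where E0: "E0 \<in> faces" using \<alpha> by (auto simp: face_chains_def)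
  have "Max (dim ` faces) \<in> dim ` faces" using finite_faces E0 by (intro Max_in) auto
  then obtain F where "Max (dim ` faces) = dim F" and F: "F \<in> faces" by (rule imageE)
  then have max: "dim E \<le> dim F" if "E \<in> faces" for E
    using Max_ge [of "dim ` faces" "dim E"] finite_faces that by simp
  obtain C where C: "C \<in> ?C" "card C = Suc (dim F)" using chain_exists [OF F HOL.refl] by blast
  have dF: "dim F = n"
    by (rule realization_homeomorphic_nball_dim [OF cx hom' C]) (use chain_card_le max in blast)
  show "complex_dim K = int n"
    unfolding complex_dim_def
  proof (rule Max_eqI)
    show "int n \<in> face_dim K ` Field K"
      using dF F face_dim_card(2) faces_Field by (metis image_eqI)
    fix y assume "y \<in> face_dim K ` Field K"
    then obtain E where E: "E \<in> Field K" "y = face_dim K E" by blast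
    show "y \<le> int n"
    proof (cases "E = empty_face K")
      case True
      then show ?thesis using E by (simp add: face_dim_def)
    next
      case False
      then have "E \<in> faces" using E by (simp add: nonempty_faces_def)
      then show ?thesis using max dF E face_dim_card(2) by (metis of_nat_le_iff)
    qed
  qed (use finite_Field in auto)
  have "contractible_space (realization ?C)"
    using homeomorphic_space_contractibility [OF hom'] contractible_nball by blast
  moreover have "{E0} \<in> ?C" using E0 refl faces_Field by (auto simp: face_chains_def Chains_def)
  ultimately have "(\<Sum>\<sigma>\<in>?C. (- 1) ^ card \<sigma>) = (0::real)"
    using Euler_char_contractible_realization [OF cx] by blast
  then show "(\<Sum>E\<in>faces. (- 1) ^ dim E) = (1::real)"
    using Euler_char_face_chains [of faces] by simp
qed

section \<open>Sums over the face poset\<close>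


text \<open>This is e(G), which is minus the reduced Euler characteristic of the link, where H
  counts as a face of dimension dim H - dim G - 1. The ring is left generic because the weights
  serve for reals and for polynomials.\<close>

definition link_sign :: "'a \<Rightarrow> 'b::comm_ring_1" where
  "link_sign G = (\<Sum>H\<in>{H. (G, H) \<in> K}. (- 1) ^ (dim H - dim G))"

lemma finite_above: "finite {H. (G, H) \<in> K}"
  by (rule finite_subset [OF _ finite_Field]) (auto simp: Field_def)

lemma sum_flags_above:
  assumes "G \<in> faces"
  shows "(\<Sum>F\<in>{F. (G, F) \<in> K}. \<Sum>H\<in>{H. (F, H) \<in> K}. f F H) =
         (\<Sum>H\<in>{H. (G, H) \<in> K}. \<Sum>F\<in>{F. (G, F) \<in> K \<and> (F, H) \<in> K}. f F H :: 'b::comm_monoid_add)"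
proof -
  have "(\<Sum>F\<in>{F. (G, F) \<in> K}. \<Sum>H\<in>{H. (F, H) \<in> K}. f F H) =
      (\<Sum>F\<in>{F. (G, F) \<in> K}. \<Sum>H\<in>{H \<in> {H. (G, H) \<in> K}. (F, H) \<in> K}. f F H)"
    using trans by (intro sum.cong HOL.refl) blast
  also have "\<dots> = (\<Sum>H\<in>{H. (G, H) \<in> K}. \<Sum>F\<in>{F \<in> {F. (G, F) \<in> K}. (F, H) \<in> K}. f F H)"
    by (rule sum.swap_restrict [OF finite_above finite_above])
  finally show ?thesis by simp
qed

text \<open>After the interchange each interval from G to H contributes (1 - 1)^(dim H - dim G), so
  only H = G survives.\<close>

lemma sum_link_sign_above:
  assumes G: "G \<in> faces"
  shows "(\<Sum>F\<in>{F. (G, F) \<in> K}. link_sign F) = (1::'b::comm_ring_1)"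
proof -
  have "(\<Sum>F\<in>{F. (G, F) \<in> K}. link_sign F) =
      (\<Sum>H\<in>{H. (G, H) \<in> K}. \<Sum>F\<in>{F. (G, F) \<in> K \<and> (F, H) \<in> K}. (- 1) ^ (dim H - dim F) :: 'b)"
    unfolding link_sign_def by (rule sum_flags_above [OF G])
  also have "\<dots> = (\<Sum>H\<in>{H. (G, H) \<in> K}. if H = G then 1 else 0)"
  proof (rule sum.cong)
    fix H assume "H \<in> {H. (G, H) \<in> K}"
    then have GH: "(G, H) \<in> K" by simp
    have "(\<Sum>F\<in>{F. (G, F) \<in> K \<and> (F, H) \<in> K}. (- 1) ^ (dim H - dim F)) = (0 :: 'b) ^ (dim H - dim G)"
      using sum_interval [OF G GH, of "1 :: 'b" "- 1"] by simp
    then show "(\<Sum>F\<in>{F. (G, F) \<in> K \<and> (F, H) \<in> K}. (- 1) ^ (dim H - dim F)) = (if H = G then 1 else 0 :: 'b)"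
    proof (cases "H = G")
      case False
      then have "dim G < dim H" using dim_strict_mono [OF G GH] by blast
      then have "(0 :: 'b) ^ (dim H - dim G) = 0" by (metis zero_less_diff zero_power)
      with \<open>_ = (0 :: 'b) ^ _\<close> False show ?thesis by simp
    qed simp
  qed auto
  also have "\<dots> = 1" using refl [OF faces_Field [OF G]] finite_above by simp
  finally show ?thesis .
qed

text \<open>Every cell \<open>s\<close> is counted with the total weight of \<open>link_sign\<close> above \<open>\<sigma> s\<close>, which is \<open>1\<close>.\<close>

lemma sum_carried_cells:
  fixes w :: "'c \<Rightarrow> 'b::comm_ring_1"
  assumes "finite S" and \<sigma>: "\<And>s. s \<in> S \<Longrightarrow> \<sigma> s \<in> faces"
  shows "(\<Sum>G\<in>faces. link_sign G * (\<Sum>s\<in>{s \<in> S. (\<sigma> s, G) \<in> K}. w s)) = (\<Sum>s\<in>S. w s)"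
proof -
  have "(\<Sum>G\<in>faces. link_sign G * (\<Sum>s\<in>{s \<in> S. (\<sigma> s, G) \<in> K}. w s)) =
      (\<Sum>G\<in>faces. \<Sum>s\<in>{s \<in> S. (\<sigma> s, G) \<in> K}. link_sign G * w s)"
    by (simp add: sum_distrib_left)
  also have "\<dots> = (\<Sum>s\<in>S. \<Sum>G\<in>{G \<in> faces. (\<sigma> s, G) \<in> K}. link_sign G * w s)"
    using sum.swap_restrict [OF finite_faces assms(1), of "\<lambda>G s. link_sign G * w s" "\<lambda>G s. (\<sigma> s, G) \<in> K"] .
  also have "\<dots> = (\<Sum>s\<in>S. w s)"
  proof (rule sum.cong)
    fix s assume s: "s \<in> S"
    have "{G \<in> faces. (\<sigma> s, G) \<in> K} = {G. (\<sigma> s, G) \<in> K}" using faces_up \<sigma> [OF s] by blast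
    then show "(\<Sum>G\<in>{G \<in> faces. (\<sigma> s, G) \<in> K}. link_sign G * w s) = w s"
      using sum_link_sign_above [OF \<sigma> [OF s], where 'b = 'b] by (simp flip: sum_distrib_right)
  qed auto
  finally show ?thesis .
qed

lemma face_dim_le_complex_dim: "E \<in> Field K \<Longrightarrow> face_dim K E \<le> complex_dim K"
  unfolding complex_dim_def using finite_Field by (intro Max_ge) auto

lemma dim_diff:
  assumes "E \<in> faces" "F \<in> faces"
  shows "nat (face_dim K F - face_dim K E) = dim F - dim E"
  using face_dim_nonneg assms by (intro nat_diff_distrib') auto

lemma codim:
  assumes "E \<in> faces"
  shows "nat (complex_dim K - face_dim K E) = nat (complex_dim K) - dim E" "dim E \<le> nat (complex_dim K)"
  using face_dim_le_complex_dim [OF faces_Field [OF assms]] face_dim_nonneg [OF assms]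
  by (auto simp: nat_diff_distrib')

lemma short_cubical_h_eq:
  "short_cubical_h K = (\<Sum>E\<in>faces. [:0, 2:] ^ dim E * [:1, - 1:] ^ (nat (complex_dim K) - dim E))"
  unfolding short_cubical_h_def by (rule sum.cong) (auto simp: codim)

lemma reduced_euler_char_eq: "reduced_euler_char K = (\<Sum>E\<in>faces. (- 1) ^ dim E) - 1"
proof -
  have "reduced_euler_char K = (- 1) powi face_dim K (empty_face K) + (\<Sum>E\<in>faces. (- 1) powi face_dim K E)"
    unfolding reduced_euler_char_def nonempty_faces_def
    by (rule sum.remove [OF finite_Field empty_face_in_Field [OF cubical]])
  also have "(\<Sum>E\<in>faces. (- 1) powi face_dim K E) = (\<Sum>E\<in>faces. (- 1) ^ dim E :: real)"
    by (rule sum.cong) (use face_dim_nonneg in \<open>auto simp: power_int_def\<close>)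
  finally show ?thesis by (simp add: face_dim_def)
qed

lemma link_h_eq:
  assumes "F \<in> faces"
  shows "link_h K F = (\<Sum>H\<in>{H. (F, H) \<in> K}. [:0, 1:] ^ (dim H - dim F) * [:1, - 1:] ^ (nat (complex_dim K) - dim H))"
proof -
  have "{H \<in> Field K. (F, H) \<in> K} = {H. (F, H) \<in> K}" by (auto simp: Field_def)
  then show ?thesis unfolding link_h_def
    using faces_up [OF assms] by (intro sum.cong) (auto simp: codim dim_diff assms)
qed

lemma signed_sum_link_h:
  assumes G: "G \<in> faces"
  shows "(\<Sum>F\<in>{F. (G, F) \<in> K}. (- 1) ^ (dim F - dim G) * link_h K F) =
         [:1, - 1:] ^ (nat (complex_dim K) - dim G) * link_sign G"
proof -
  let ?d = "nat (complex_dim K)"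
  let ?X = "[:0, 1:] :: real poly" and ?Y = "[:1, - 1:] :: real poly"
  have "(\<Sum>F\<in>{F. (G, F) \<in> K}. (- 1) ^ (dim F - dim G) * link_h K F) =
      (\<Sum>F\<in>{F. (G, F) \<in> K}. \<Sum>H\<in>{H. (F, H) \<in> K}. (- 1) ^ (dim F - dim G) * (?X ^ (dim H - dim F) * ?Y ^ (?d - dim H)))"
    by (rule sum.cong) (use faces_up [OF G] in \<open>auto simp: link_h_eq sum_distrib_left\<close>)
  also have "\<dots> = (\<Sum>H\<in>{H. (G, H) \<in> K}. \<Sum>F\<in>{F. (G, F) \<in> K \<and> (F, H) \<in> K}.
      (- 1) ^ (dim F - dim G) * (?X ^ (dim H - dim F) * ?Y ^ (?d - dim H)))"
    by (rule sum_flags_above [OF G])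
  also have "\<dots> = (\<Sum>H\<in>{H. (G, H) \<in> K}. ?Y ^ (?d - dim G) * (- 1) ^ (dim H - dim G))"
  proof (rule sum.cong)
    fix H assume "H \<in> {H. (G, H) \<in> K}"
    then have GH: "(G, H) \<in> K" by simp
    have H: "H \<in> faces" using faces_up [OF G GH] .
    \<comment> \<open>The interval sum becomes (-(1-x))^(dim H - dim G), whose power of 1-x joins
      the one from the link polynomial to an exponent free of \<open>H\<close>.\<close>
    have neg: "- 1 + ?X = - 1 * ?Y" by (simp add: one_pCons)
    have exp: "(?d - dim H) + (dim H - dim G) = ?d - dim G"
    proof -
      have "g \<le> h \<Longrightarrow> h \<le> e \<Longrightarrow> (e - h) + (h - g) = e - g" for e g h :: nat by auto
      then show ?thesis using dim_mono [OF G GH] codim(2) [OF H] .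
    qed
    have "(\<Sum>F\<in>{F. (G, F) \<in> K \<and> (F, H) \<in> K}. (- 1) ^ (dim F - dim G) * (?X ^ (dim H - dim F) * ?Y ^ (?d - dim H))) =
        (\<Sum>F\<in>{F. (G, F) \<in> K \<and> (F, H) \<in> K}. (- 1) ^ (dim F - dim G) * ?X ^ (dim H - dim F)) * ?Y ^ (?d - dim H)"
      by (simp add: sum_distrib_right mult.assoc)
    also have "\<dots> = (- 1 * ?Y) ^ (dim H - dim G) * ?Y ^ (?d - dim H)"
      unfolding sum_interval [OF G GH] neg ..
    also have "\<dots> = ?Y ^ ((?d - dim H) + (dim H - dim G)) * (- 1) ^ (dim H - dim G)"
      unfolding power_mult_distrib power_add by (simp only: mult_ac)
    finally show "(\<Sum>F\<in>{F. (G, F) \<in> K \<and> (F, H) \<in> K}. (- 1) ^ (dim F - dim G) * (?X ^ (dim H - dim F) * ?Y ^ (?d - dim H))) =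
        ?Y ^ (?d - dim G) * (- 1) ^ (dim H - dim G)" unfolding exp .
  qed auto
  finally show ?thesis unfolding link_sign_def by (simp add: sum_distrib_left)
qed

end

section \<open>Cubical subdivisions\<close>

locale subdivision = K: cubical K + K': cubical K'
  for K :: "'a rel" and K' :: "'b rel" +
  fixes \<sigma> :: "'b \<Rightarrow> 'a"
  assumes subdiv: "cubical_subdivision K K' \<sigma>"
begin

lemma carrier_in: "E \<in> K'.faces \<Longrightarrow> \<sigma> E \<in> K.faces"
  using subdiv by (auto simp: cubical_subdivision_def)

section \<open>Dimension and Euler characteristic under subdivision\<close>

lemma restriction_facts:
  assumes G: "G \<in> K.faces"
  shows "cubical_complex (restriction K K' \<sigma> G)"
    and "nonempty_faces (restriction K K' \<sigma> G) = {E \<in> K'.faces. (\<sigma> E, G) \<in> K}"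
    and "E \<in> K'.faces \<Longrightarrow> (\<sigma> E, G) \<in> K \<Longrightarrow> face_dim (restriction K K' \<sigma> G) E = face_dim K' E"
    and "complex_dim (restriction K K' \<sigma> G) = face_dim K G"
    and "(\<Sum>E\<in>{E \<in> K'.faces. (\<sigma> E, G) \<in> K}. (- 1) ^ K'.dim E) = (1::real)"
proof -
  let ?A = "restriction_faces K K' \<sigma> G" and ?L = "restriction K K' \<sigma> G"
  have sub: "subcomplex K' ?A"
    and hom: "order_complex_space ?L homeomorphic_space nball (K.dim G)"
    using subdiv G by (auto simp: cubical_subdivision_def)
  note sc = subcomplex_cubical [OF K'.cubical sub]
  show cub: "cubical_complex ?L" unfolding restriction_def by (rule sc)
  interpret L: cubical ?L by unfold_locales (rule cub)
  show faces: "nonempty_faces ?L = {E \<in> K'.faces. (\<sigma> E, G) \<in> K}"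
    unfolding nonempty_faces_def [of ?L] unfolding restriction_def sc(2,3)
    by (auto simp: restriction_faces_def nonempty_faces_def)
  show fd: "face_dim ?L E = face_dim K' E" if "E \<in> K'.faces" "(\<sigma> E, G) \<in> K" for E
    unfolding restriction_def by (rule sc(4)) (use that in \<open>auto simp: restriction_faces_def\<close>)
  show "complex_dim ?L = face_dim K G"
    using L.ball_complex_dim_and_Euler_char(1) [OF hom] K.face_dim_card(2) [OF G] by simp
  have "(\<Sum>E\<in>{E \<in> K'.faces. (\<sigma> E, G) \<in> K}. (- 1) ^ K'.dim E) = (\<Sum>E\<in>L.faces. (- 1) ^ L.dim E :: real)"
    unfolding faces by (rule sum.cong) (auto simp: fd)
  then show "(\<Sum>E\<in>{E \<in> K'.faces. (\<sigma> E, G) \<in> K}. (- 1) ^ K'.dim E) = (1::real)"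
    using L.ball_complex_dim_and_Euler_char(2) [OF hom] by simp
qed

lemma carrier_dim_le:
  assumes "E \<in> K'.faces" "(\<sigma> E, G) \<in> K"
  shows "K'.dim E \<le> K.dim G"
proof -
  have G: "G \<in> K.faces" using K.faces_up [OF carrier_in] assms by blast
  let ?L = "restriction K K' \<sigma> G"
  interpret L: cubical ?L by unfold_locales (rule restriction_facts(1) [OF G])
  have "E \<in> L.faces" using restriction_facts(2) [OF G] assms by simp
  then have "L.dim E \<le> nat (complex_dim ?L)" by (rule L.codim(2))
  then show ?thesis using restriction_facts(3,4) [OF G] assms by simp
qed

text \<open>A face of K' has at most the dimension of its carrier; conversely the ball over G
  contains a face of dimension dim G. The empty faces, of dimension -1, are treated apart.\<close>

lemma complex_dim_eq: "complex_dim K' = complex_dim K"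
proof (rule antisym)
  have finI: "finite (face_dim K ` Field K)" "finite (face_dim K' ` Field K')"
    using K.finite_Field K'.finite_Field by auto
  have ne: "face_dim K ` Field K \<noteq> {}" "face_dim K' ` Field K' \<noteq> {}"
    using empty_face_in_Field K.cubical K'.cubical by blast+
  have e: "- 1 \<le> complex_dim K" "- 1 \<le> complex_dim K'"
    using K.face_dim_le_complex_dim [OF empty_face_in_Field [OF K.cubical]]
      K'.face_dim_le_complex_dim [OF empty_face_in_Field [OF K'.cubical]] by (simp_all add: face_dim_def)
  show "complex_dim K' \<le> complex_dim K"
    unfolding complex_dim_def [of K']
  proof (rule Max.boundedI [OF finI(2) ne(2)])
    fix y assume "y \<in> face_dim K' ` Field K'"
    then obtain E where E: "E \<in> Field K'" "y = face_dim K' E" by blast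
    show "y \<le> complex_dim K"
    proof (cases "E = empty_face K'")
      case True
      then show ?thesis using E e by (simp add: face_dim_def)
    next
      case False
      then have E': "E \<in> K'.faces" using E K'.faces_iff by blast
      have s: "\<sigma> E \<in> Field K" using carrier_in [OF E'] K.faces_Field by blast
      have "K'.dim E \<le> K.dim (\<sigma> E)" by (rule carrier_dim_le [OF E' K.refl [OF s]])
      then have "y \<le> face_dim K (\<sigma> E)"
        using E K'.face_dim_card(2) [OF E'] K.face_dim_card(2) [OF carrier_in [OF E']] by linarith
      then show ?thesis using K.face_dim_le_complex_dim [OF s] by linarith
    qed
  qed
  show "complex_dim K \<le> complex_dim K'"
    unfolding complex_dim_def [of K]
  proof (rule Max.boundedI [OF finI(1) ne(1)])
    fix y assume "y \<in> face_dim K ` Field K"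
    then obtain G where G: "G \<in> Field K" "y = face_dim K G" by blast
    show "y \<le> complex_dim K'"
    proof (cases "G = empty_face K")
      case True
      then show ?thesis using G e by (simp add: face_dim_def)
    next
      case False
      then have G': "G \<in> K.faces" using G K.faces_iff by blast
      let ?L = "restriction K K' \<sigma> G"
      interpret L: cubical ?L by unfold_locales (rule restriction_facts(1) [OF G'])
      have "complex_dim ?L \<in> face_dim ?L ` Field ?L"
        unfolding complex_dim_def
        using L.finite_Field empty_face_in_Field [OF L.cubical] by (intro Max_in) auto
      then obtain E where E: "E \<in> Field ?L" "face_dim ?L E = y"
        using restriction_facts(4) [OF G'] G by auto
      have "0 \<le> y" using K.face_dim_nonneg [OF G'] G by simp
      then have "E \<noteq> empty_face ?L" using E by (auto simp: face_dim_def)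
      then have "E \<in> L.faces" using E L.faces_iff by blast
      then have E': "E \<in> K'.faces" "(\<sigma> E, G) \<in> K" using restriction_facts(2) [OF G'] by auto
      then have "y = face_dim K' E" using restriction_facts(3) [OF G'] E by simp
      then show ?thesis using K'.face_dim_le_complex_dim K'.faces_Field E' by blast
    qed
  qed
qed

text \<open>Both complexes are the same weighted sum of local Euler characteristics, since the ball
  over G and the cube G each contribute 1.\<close>

lemma reduced_euler_char_subdivision: "reduced_euler_char K' = reduced_euler_char K"
proof -
  have "(\<Sum>E\<in>K'.faces. (- 1) ^ K'.dim E) =
      (\<Sum>G\<in>K.faces. K.link_sign G * (\<Sum>E\<in>{E \<in> K'.faces. (\<sigma> E, G) \<in> K}. (- 1) ^ K'.dim E :: real))"
    by (rule K.sum_carried_cells [OF K'.finite_faces carrier_in, symmetric])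
  also have "\<dots> = (\<Sum>G\<in>K.faces. K.link_sign G * (\<Sum>E\<in>{E \<in> K.faces. (E, G) \<in> K}. (- 1) ^ K.dim E :: real))"
    by (rule sum.cong) (simp_all add: restriction_facts(5) K.sum_sign_faces_below)
  also have "\<dots> = (\<Sum>E\<in>K.faces. (- 1) ^ K.dim E)"
    by (rule K.sum_carried_cells [OF K.finite_faces])
  finally show ?thesis by (simp add: K.reduced_euler_char_eq K'.reduced_euler_char_eq)
qed

section \<open>From local to short cubical h-polynomials\<close>

abbreviation "X \<equiv> [:0, 1:] :: real poly"
abbreviation "Y \<equiv> [:1, - 1:] :: real poly"

text \<open>The outer terms of the defining equation depend only on the dimension and the reduced
  Euler characteristic, on which K and K' agree.\<close>

lemma cubical_h_diff:
  "[:1, 1:] * (cubical_h K' - cubical_h K) = X * (short_cubical_h K' - short_cubical_h K)"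
  unfolding right_diff_distrib cubical_h_eq [OF K.cubical] cubical_h_eq [OF K'.cubical] cubical_h_rhs_def
    complex_dim_eq reduced_euler_char_subdivision by simp

lemma cubical_h_restriction:
  assumes G: "G \<in> K.faces"
  shows "[:1, 1:] * cubical_h (restriction K K' \<sigma> G) = [:2 ^ K.dim G:] +
     X * (\<Sum>E\<in>{E \<in> K'.faces. (\<sigma> E, G) \<in> K}. [:0, 2:] ^ K'.dim E * Y ^ (K.dim G - K'.dim E))"
proof -
  let ?L = "restriction K K' \<sigma> G"
  note rf = restriction_facts [OF G]
  interpret L: cubical ?L by unfold_locales (rule rf(1))
  have chi: "reduced_euler_char ?L = 0"
  proof -
    have "(\<Sum>E\<in>L.faces. (- 1) ^ L.dim E) = (\<Sum>E\<in>{E \<in> K'.faces. (\<sigma> E, G) \<in> K}. (- 1) ^ K'.dim E :: real)"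
      unfolding rf(2) by (rule sum.cong) (auto simp: rf(3))
    then show ?thesis using rf(5) by (simp add: L.reduced_euler_char_eq)
  qed
  have short: "short_cubical_h ?L =
      (\<Sum>E\<in>{E \<in> K'.faces. (\<sigma> E, G) \<in> K}. [:0, 2:] ^ K'.dim E * Y ^ (K.dim G - K'.dim E))"
    unfolding L.short_cubical_h_eq rf(2,4) by (rule sum.cong) (auto simp: rf(3))
  have "2 powi face_dim K G = (2 ^ K.dim G :: real)"
    using K.face_dim_nonneg [OF G] by (simp add: power_int_def)
  then show ?thesis
    unfolding cubical_h_eq [OF rf(1)] cubical_h_rhs_def short chi rf(4) by simp
qed

text \<open>All nonempty faces of this ball have dimension 0 and their signs sum to 1, so there is
  just one.\<close>

lemma cubical_h_restriction_vertex:
  assumes G: "G \<in> K.faces" and "K.dim G = 0"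
  shows "cubical_h (restriction K K' \<sigma> G) = 1"
proof -
  let ?S = "{E \<in> K'.faces. (\<sigma> E, G) \<in> K}"
  have 0: "K'.dim E = 0" if "E \<in> ?S" for E using carrier_dim_le [of E G] that assms by simp
  have "real (card ?S) = (\<Sum>E\<in>?S. (- 1) ^ K'.dim E)" by (simp add: 0)
  also have "\<dots> = 1" by (rule restriction_facts(5) [OF G])
  finally have card: "card ?S = 1" by simp
  have "[:1, 1:] * cubical_h (restriction K K' \<sigma> G) = [:1:] + X * (\<Sum>E\<in>?S. 1)"
    unfolding cubical_h_restriction [OF G] assms(2) by (simp add: 0)
  also have "\<dots> = [:1, 1:] * 1" unfolding sum_constant card by simp
  finally show ?thesis by (subst (asm) mult_left_cancel) auto
qed

text \<open>The excess over the trivial subdivision: \<open>2 ^ dim G\<close> is the cubical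
  h-polynomial of the cube \<open>G\<close>.\<close>

definition excess_h :: "'a \<Rightarrow> real poly" where
  "excess_h G = cubical_h (restriction K K' \<sigma> G) - 2 ^ K.dim G"

text \<open>The alternating sum of 2^dim over the nonempty faces of F is 0^dim F. The subtraction
  thus changes nothing in positive dimension and cancels the value 1 at a vertex, which allows the
  sum over dimension at least 1 to be extended to all nonempty faces.\<close>

lemma cubical_local_h_eq:
  assumes F: "F \<in> K.faces"
  shows "(\<Sum>G\<in>{G \<in> K.faces. (G, F) \<in> K}. (- 1) ^ (K.dim F - K.dim G) * excess_h G) =
    (if 1 \<le> K.dim F then cubical_local_h K K' \<sigma> F else 0)"
proof -
  have loc: "cubical_local_h K K' \<sigma> F =
      (\<Sum>G\<in>{G \<in> K.faces. (G, F) \<in> K}. (- 1) ^ (K.dim F - K.dim G) * cubical_h (restriction K K' \<sigma> G))"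
    unfolding cubical_local_h_def by (rule sum.cong) (auto simp: K.dim_diff F)
  have "(\<Sum>G\<in>{G \<in> K.faces. (G, F) \<in> K}. 2 ^ K.dim G * (- 1) ^ (K.dim F - K.dim G)) = (0 :: real poly) ^ K.dim F"
    using K.sum_faces_below [OF F, of "2 :: real poly" "- 1"] by simp
  then have diff: "(\<Sum>G\<in>{G \<in> K.faces. (G, F) \<in> K}. (- 1) ^ (K.dim F - K.dim G) * excess_h G) =
      cubical_local_h K K' \<sigma> F - 0 ^ K.dim F"
    unfolding loc excess_h_def right_diff_distrib sum_subtractf by (simp add: mult.commute)
  show ?thesis
  proof (cases "1 \<le> K.dim F")
    case True
    then have "(0 :: real poly) ^ K.dim F = 0" by (metis One_nat_def Suc_le_lessD zero_power)
    then show ?thesis using diff True by simp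
  next
    case False
    then have 0: "K.dim F = 0" by linarith
    have "{G \<in> K.faces. (G, F) \<in> K} = {F}"
      using K.dim_strict_mono [of _ F] 0 F K.refl [OF K.faces_Field [OF F]] by (metis (mono_tags, lifting) less_nat_zero_code Collect_cong singleton_conv)
    then have "cubical_local_h K K' \<sigma> F = 1"
      unfolding loc by (simp add: cubical_h_restriction_vertex [OF F 0])
    then show ?thesis using diff 0 by simp
  qed
qed

text \<open>The constant 2^dim G cancels because (1+x) 2^dim G is that constant plus x times the
  short polynomial of the cube. After multiplication by the power of 1-x, the term of a face E no
  longer mentions G.\<close>

lemma excess_h_eq:
  assumes G: "G \<in> K.faces"
  shows "[:1, 1:] * (excess_h G * Y ^ (nat (complex_dim K) - K.dim G)) =
    X * ((\<Sum>E\<in>{E \<in> K'.faces. (\<sigma> E, G) \<in> K}. [:0, 2:] ^ K'.dim E * Y ^ (nat (complex_dim K) - K'.dim E))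
       - (\<Sum>E\<in>{E \<in> K.faces. (E, G) \<in> K}. [:0, 2:] ^ K.dim E * Y ^ (nat (complex_dim K) - K.dim E)))"
proof -
  let ?d = "nat (complex_dim K)"
  have Gd: "K.dim G \<le> ?d" by (rule K.codim(2) [OF G])
  have shift: "(\<Sum>E\<in>S. [:0, 2:] ^ e E * Y ^ (K.dim G - e E)) * Y ^ (?d - K.dim G) =
      (\<Sum>E\<in>S. [:0, 2:] ^ e E * Y ^ (?d - e E))" if "\<And>E. E \<in> S \<Longrightarrow> e E \<le> K.dim G" for S and e :: "'c \<Rightarrow> nat"
    unfolding sum_distrib_right
  proof (rule sum.cong)
    fix E assume "E \<in> S"
    have eq: "(K.dim G - e E) + (?d - K.dim G) = ?d - e E"
    proof -
      have "x \<le> g \<Longrightarrow> g \<le> d \<Longrightarrow> (g - x) + (d - g) = d - x" for x g d :: nat by auto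
      then show ?thesis using that [OF \<open>E \<in> S\<close>] Gd .
    qed
    show "[:0, 2:] ^ e E * Y ^ (K.dim G - e E) * Y ^ (?d - K.dim G) = [:0, 2:] ^ e E * Y ^ (?d - e E)"
      unfolding mult.assoc power_add [symmetric] eq ..
  qed auto
  have two: "(\<Sum>E\<in>{E \<in> K.faces. (E, G) \<in> K}. [:0, 2:] ^ K.dim E * Y ^ (K.dim G - K.dim E)) = 2 ^ K.dim G"
  proof -
    have "[:0, 2:] + 2 * Y = 2" by (simp add: numeral_poly)
    then show ?thesis unfolding K.sum_faces_below [OF G] by (simp only:)
  qed
  have const: "[:2 ^ K.dim G:] = (2 :: real poly) ^ K.dim G"
    by (simp add: poly_const_pow numeral_poly)
  have "[:1, 1:] * excess_h G = X * ((\<Sum>E\<in>{E \<in> K'.faces. (\<sigma> E, G) \<in> K}. [:0, 2:] ^ K'.dim E * Y ^ (K.dim G - K'.dim E))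
       - (\<Sum>E\<in>{E \<in> K.faces. (E, G) \<in> K}. [:0, 2:] ^ K.dim E * Y ^ (K.dim G - K.dim E)))"
  proof -
    have P: "[:1, 1:] = 1 + X" by (simp add: one_pCons)
    show ?thesis
      unfolding excess_h_def right_diff_distrib cubical_h_restriction [OF G] two const
      unfolding P by (simp add: algebra_simps)
  qed
  then have "[:1, 1:] * (excess_h G * Y ^ (?d - K.dim G)) =
      X * (((\<Sum>E\<in>{E \<in> K'.faces. (\<sigma> E, G) \<in> K}. [:0, 2:] ^ K'.dim E * Y ^ (K.dim G - K'.dim E))
       - (\<Sum>E\<in>{E \<in> K.faces. (E, G) \<in> K}. [:0, 2:] ^ K.dim E * Y ^ (K.dim G - K.dim E))) * Y ^ (?d - K.dim G))"
    by (simp only: mult.assoc [symmetric])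
  also have "\<dots> = X * ((\<Sum>E\<in>{E \<in> K'.faces. (\<sigma> E, G) \<in> K}. [:0, 2:] ^ K'.dim E * Y ^ (?d - K'.dim E))
       - (\<Sum>E\<in>{E \<in> K.faces. (E, G) \<in> K}. [:0, 2:] ^ K.dim E * Y ^ (?d - K.dim E)))"
  proof -
    have 1: "(\<Sum>E\<in>{E \<in> K'.faces. (\<sigma> E, G) \<in> K}. [:0, 2:] ^ K'.dim E * Y ^ (K.dim G - K'.dim E)) * Y ^ (?d - K.dim G) =
        (\<Sum>E\<in>{E \<in> K'.faces. (\<sigma> E, G) \<in> K}. [:0, 2:] ^ K'.dim E * Y ^ (?d - K'.dim E))"
      by (rule shift) (use carrier_dim_le in blast)
    have 2: "(\<Sum>E\<in>{E \<in> K.faces. (E, G) \<in> K}. [:0, 2:] ^ K.dim E * Y ^ (K.dim G - K.dim E)) * Y ^ (?d - K.dim G) =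
        (\<Sum>E\<in>{E \<in> K.faces. (E, G) \<in> K}. [:0, 2:] ^ K.dim E * Y ^ (?d - K.dim E))"
      by (rule shift) (use K.dim_mono in blast)
    show ?thesis unfolding left_diff_distrib 1 2 ..
  qed
  finally show ?thesis .
qed

text \<open>Collecting the sum at G instead of F turns the signed link polynomials into
  \<open>signed_sum_link_h\<close>. As the term of a cell E is independent of G,
  \<open>sum_carried_cells\<close> then counts each cell of K' and of K once.\<close>

lemma local_h_sum:
  "[:1, 1:] * (\<Sum>F\<in>{F \<in> Field K. face_dim K F \<ge> 1}. cubical_local_h K K' \<sigma> F * link_h K F) =
   X * (short_cubical_h K' - short_cubical_h K)"
proof -
  let ?d = "nat (complex_dim K)"
  have set: "{F \<in> Field K. face_dim K F \<ge> 1} = {F \<in> K.faces. 1 \<le> K.dim F}"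
    by (auto simp: K.faces_iff face_dim_def)
  have "(\<Sum>F\<in>{F \<in> Field K. face_dim K F \<ge> 1}. cubical_local_h K K' \<sigma> F * link_h K F) =
      (\<Sum>F\<in>K.faces. (if 1 \<le> K.dim F then cubical_local_h K K' \<sigma> F else 0) * link_h K F)"
    unfolding set using K.finite_faces by (intro sum.mono_neutral_cong_left) auto
  also have "\<dots> = (\<Sum>F\<in>K.faces. \<Sum>G\<in>{G \<in> K.faces. (G, F) \<in> K}. excess_h G * ((- 1) ^ (K.dim F - K.dim G) * link_h K F))"
  proof (rule sum.cong)
    fix F assume F: "F \<in> K.faces"
    show "(if 1 \<le> K.dim F then cubical_local_h K K' \<sigma> F else 0) * link_h K F =
        (\<Sum>G\<in>{G \<in> K.faces. (G, F) \<in> K}. excess_h G * ((- 1) ^ (K.dim F - K.dim G) * link_h K F))"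
      unfolding cubical_local_h_eq [OF F, symmetric] sum_distrib_right by (simp only: mult_ac)
  qed auto
  also have "\<dots> = (\<Sum>G\<in>K.faces. \<Sum>F\<in>{F \<in> K.faces. (G, F) \<in> K}. excess_h G * ((- 1) ^ (K.dim F - K.dim G) * link_h K F))"
    by (rule sum.swap_restrict [OF K.finite_faces K.finite_faces])
  also have "\<dots> = (\<Sum>G\<in>K.faces. excess_h G * (Y ^ (?d - K.dim G) * K.link_sign G))"
  proof (rule sum.cong)
    fix G assume G: "G \<in> K.faces"
    have "{F \<in> K.faces. (G, F) \<in> K} = {F. (G, F) \<in> K}" using K.faces_up [OF G] by blast
    then show "(\<Sum>F\<in>{F \<in> K.faces. (G, F) \<in> K}. excess_h G * ((- 1) ^ (K.dim F - K.dim G) * link_h K F)) =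
        excess_h G * (Y ^ (?d - K.dim G) * K.link_sign G)"
      by (simp only: sum_distrib_left [symmetric] K.signed_sum_link_h [OF G])
  qed auto
  finally have "[:1, 1:] * (\<Sum>F\<in>{F \<in> Field K. face_dim K F \<ge> 1}. cubical_local_h K K' \<sigma> F * link_h K F) =
      (\<Sum>G\<in>K.faces. K.link_sign G * ([:1, 1:] * (excess_h G * Y ^ (?d - K.dim G))))"
    by (simp only: sum_distrib_left mult_ac)
  also have "\<dots> = X *
      ((\<Sum>G\<in>K.faces. K.link_sign G * (\<Sum>E\<in>{E \<in> K'.faces. (\<sigma> E, G) \<in> K}. [:0, 2:] ^ K'.dim E * Y ^ (?d - K'.dim E)))
     - (\<Sum>G\<in>K.faces. K.link_sign G * (\<Sum>E\<in>{E \<in> K.faces. (E, G) \<in> K}. [:0, 2:] ^ K.dim E * Y ^ (?d - K.dim E))))"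
    unfolding sum_subtractf [symmetric] sum_distrib_left [of X]
  proof (rule sum.cong)
    fix G assume G: "G \<in> K.faces"
    show "K.link_sign G * ([:1, 1:] * (excess_h G * Y ^ (?d - K.dim G))) = X *
       (K.link_sign G * (\<Sum>E\<in>{E \<in> K'.faces. (\<sigma> E, G) \<in> K}. [:0, 2:] ^ K'.dim E * Y ^ (?d - K'.dim E)) -
        K.link_sign G * (\<Sum>E\<in>{E \<in> K.faces. (E, G) \<in> K}. [:0, 2:] ^ K.dim E * Y ^ (?d - K.dim E)))"
      unfolding excess_h_eq [OF G] right_diff_distrib [symmetric] by (simp only: mult.left_commute)
  qed auto
  also have "\<dots> = X * (short_cubical_h K' - short_cubical_h K)"
  proof -
    have 1: "(\<Sum>G\<in>K.faces. K.link_sign G * (\<Sum>E\<in>{E \<in> K'.faces. (\<sigma> E, G) \<in> K}. [:0, 2:] ^ K'.dim E * Y ^ (?d - K'.dim E))) =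
        short_cubical_h K'"
      unfolding K'.short_cubical_h_eq complex_dim_eq
      by (rule K.sum_carried_cells [OF K'.finite_faces carrier_in])
    have 2: "(\<Sum>G\<in>K.faces. K.link_sign G * (\<Sum>E\<in>{E \<in> K.faces. (E, G) \<in> K}. [:0, 2:] ^ K.dim E * Y ^ (?d - K.dim E))) =
        short_cubical_h K"
      unfolding K.short_cubical_h_eq by (rule K.sum_carried_cells [OF K.finite_faces])
    show ?thesis unfolding 1 2 ..
  qed
  finally show ?thesis .
qed

end

theorem theorem6p6:
  fixes K :: "'a rel" and K' :: "'b rel" and \<sigma> :: "'b \<Rightarrow> 'a"
  assumes "cubical_complex K"
    and "pure_complex K"
    and "cubical_subdivision K K' \<sigma>"
  shows "cubical_h K' =
    cubical_h K +
    (\<Sum>F\<in>{F \<in> Field K. face_dim K F \<ge> 1}. cubical_local_h K K' \<sigma> F * link_h K F)"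
proof -
  interpret subdivision K K' \<sigma>
    by unfold_locales (use assms in \<open>auto simp: cubical_subdivision_def\<close>)
  have "[:1, 1:] * (cubical_h K' - cubical_h K) =
      [:1, 1:] * (\<Sum>F\<in>{F \<in> Field K. face_dim K F \<ge> 1}. cubical_local_h K K' \<sigma> F * link_h K F)"
    unfolding cubical_h_diff local_h_sum ..
  then have "cubical_h K' - cubical_h K =
      (\<Sum>F\<in>{F \<in> Field K. face_dim K F \<ge> 1}. cubical_local_h K K' \<sigma> F * link_h K F)"
    by (subst (asm) mult_left_cancel) auto
  then show ?thesis by (simp add: algebra_simps)
qed

end
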